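(* Let $n\ge 1$, $a>0$, and $W:\mathbb{R}^n\to[0,+\infty)$. Then for any nonnegative smooth function $g$ on $\mathbb{R}^n$ such that $$\int_{\mathbb{R}^n} g^{a}=\int_{\mathbb{R}^n} W^{a}=1$$ we have $$(a+1)\int_{\mathbb{R}^n} W_*(\nabla g)\,g^{a}+(a+n)\int_{\mathbb{R}^n} g^{1+a}\ \le\ -\int_{\mathbb{R}^n} W^{1+a},$$ with equality if $g=W$ and is concave on its support.
   Context: All integrals are with respect to Lebesgue measure. For a nonnegative function $W$ on $\mathbb{R}^n$, put $\Omega_W=\{x\in\mathbb{R}^n: W(x)>0\}$. The (concave) Legendre transform of $W$ is $$W_*(y)=\inf_{x\in\Omega_W}\{x\cdot y-W(x)\},\qquad y\in\mathbb{R}^n.$$ $W$ is said to be concave on its support if the function $\tilde W$ on $\mathbb{R}^n$, equal to $W$ on $\Omega_W$ and to $-\infty$ outside $\Omega_W$, is concave (in particular $\Omega_W$ is convex). *)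

theory Defs
  imports "HOL-Analysis.Analysis"
begin

definition pos_set :: "('a \<Rightarrow> real) \<Rightarrow> 'a set" where
  "pos_set W = {x. W x > 0}"

definition legendre :: "('a::real_inner \<Rightarrow> real) \<Rightarrow> 'a \<Rightarrow> ereal" where
  "legendre W y = (INF x\<in>pos_set W. ereal (x \<bullet> y - W x))"

definition support_ext :: "('a \<Rightarrow> real) \<Rightarrow> 'a \<Rightarrow> ereal" where
  "support_ext W x = (if x \<in> pos_set W then ereal (W x) else -\<infinity>)"

text \<open>The function \<^term>\<open>support_ext W\<close> never takes the value \<open>\<infinity>\<close>, so the sums below are
  meaningful; the endpoints \<open>t = 0\<close> and \<open>t = 1\<close> carry no information.\<close>

definition concave_on_support :: "('a::real_vector \<Rightarrow> real) \<Rightarrow> bool" where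
  "concave_on_support W \<longleftrightarrow>
     (\<forall>x y. \<forall>t\<in>{0<..<1}.
        ereal (1 - t) * support_ext W x + ereal t * support_ext W y
          \<le> support_ext W ((1 - t) *\<^sub>R x + t *\<^sub>R y))"

lemma concave_on_support_iff:
  "concave_on_support W \<longleftrightarrow> concave_on (pos_set W) W"
proof
  assume W: "concave_on_support W"
  have *: "(1 - t) *\<^sub>R x + t *\<^sub>R y \<in> pos_set W \<and>
      (1 - t) * W x + t * W y \<le> W ((1 - t) *\<^sub>R x + t *\<^sub>R y)"
    if "x \<in> pos_set W" "y \<in> pos_set W" "0 < t" "t < 1" for x y t
  proof -
    have "ereal ((1 - t) * W x + t * W y) \<le> support_ext W ((1 - t) *\<^sub>R x + t *\<^sub>R y)"
      using W that unfolding concave_on_support_def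
      by (metis greaterThanLessThan_iff plus_ereal.simps(1) support_ext_def times_ereal.simps(1))
    then show ?thesis
      by (auto simp: support_ext_def split: if_splits)
  qed
  have "convex (pos_set W)"
    unfolding convex_alt
  proof (intro ballI allI impI)
    fix x y u assume "x \<in> pos_set W" "y \<in> pos_set W" "0 \<le> u \<and> u \<le> (1::real)"
    then show "(1 - u) *\<^sub>R x + u *\<^sub>R y \<in> pos_set W"
      using *[of x y u] by (cases "u = 0 \<or> u = 1") auto
  qed
  then show "concave_on (pos_set W) W"
    unfolding concave_on_def
    by (intro convex_onI) (use * in force)+
next
  assume W: "concave_on (pos_set W) W"
  show "concave_on_support W"
    unfolding concave_on_support_def
  proof (intro allI ballI)
    fix x y and t :: real assume t: "t \<in> {0<..<1}"
    show "ereal (1 - t) * support_ext W x + ereal t * support_ext W y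
          \<le> support_ext W ((1 - t) *\<^sub>R x + t *\<^sub>R y)"
    proof (cases "x \<in> pos_set W \<and> y \<in> pos_set W")
      case True
      then have "(1 - t) *\<^sub>R x + t *\<^sub>R y \<in> pos_set W"
        using W t concave_on_imp_convex unfolding convex_alt by fastforce
      moreover have "(1 - t) * W x + t * W y \<le> W ((1 - t) *\<^sub>R x + t *\<^sub>R y)"
        using concave_onD[OF W, of t x y] True t by auto
      ultimately show ?thesis
        using True by (simp add: support_ext_def)
    next
      case False
      then show ?thesis
        using t by (auto simp: support_ext_def)
    qed
  qed
qed

definition grad :: "(real ^ 'n \<Rightarrow> real) \<Rightarrow> real ^ 'n \<Rightarrow> real ^ 'n" where
  "grad f x = (\<chi> i. frechet_derivative f (at x) (axis i 1))"

lemma grad_GDERIV: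
  fixes f :: "real ^ 'n \<Rightarrow> real"
  assumes "f differentiable (at x)"
  shows "GDERIV f x :> grad f x"
proof -
  let ?D = "frechet_derivative f (at x)"
  have D: "(f has_derivative ?D) (at x)"
    using assms frechet_derivative_works by blast
  then have lin: "linear ?D"
    by (rule has_derivative_linear)
  have "?D h = h \<bullet> grad f x" for h
  proof -
    have "?D h = ?D (\<Sum>i\<in>UNIV. h $ i *\<^sub>R axis i 1)"
      by (simp add: basis_expansion flip: scalar_mult_eq_scaleR)
    also have "\<dots> = (\<Sum>i\<in>UNIV. h $ i * ?D (axis i 1))"
      by (simp add: linear_sum[OF lin] linear_cmul[OF lin])
    finally show ?thesis
      by (simp add: grad_def inner_vec_def)
  qed
  with D show ?thesis
    by (metis (no_types, lifting) ext gderiv_def)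
qed

text \<open>Smoothness on an open set: all iterated directional derivatives exist and are differentiable.\<close>

fun times_differentiable_on :: "nat \<Rightarrow> 'a::real_normed_vector set \<Rightarrow> ('a \<Rightarrow> real) \<Rightarrow> bool" where
  "times_differentiable_on 0 S f \<longleftrightarrow> continuous_on S f"
| "times_differentiable_on (Suc k) S f \<longleftrightarrow>
     (\<forall>x\<in>S. f differentiable (at x)) \<and>
     (\<forall>v. times_differentiable_on k S (\<lambda>x. frechet_derivative f (at x) v))"

definition smooth_on :: "'a::real_normed_vector set \<Rightarrow> ('a \<Rightarrow> real) \<Rightarrow> bool" where
  "smooth_on S f \<longleftrightarrow> (\<forall>k. times_differentiable_on k S f)"

text \<open>A nonzero nonnegative function smooth on the whole space, some positive power of which is integrable, is never
  concave on its support: such a support is bounded, and both \<open>g\<close> and its gradient vanish on the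
  boundary. To allow extremal functions, such as a multiple of \<open>max 0 (1 - \<bar>x\<bar>\<^sup>2)\<close>, smoothness is
  required only where \<open>g > 0\<close>, together with continuity across the boundary.\<close>

definition smooth_nonneg :: "('a::real_normed_vector \<Rightarrow> real) \<Rightarrow> bool" where
  "smooth_nonneg g \<longleftrightarrow> (\<forall>x. 0 \<le> g x) \<and> continuous_on UNIV g \<and> smooth_on (pos_set g) g"

lemma times_differentiable_on_subset:
  "times_differentiable_on k S f \<Longrightarrow> T \<subseteq> S \<Longrightarrow> times_differentiable_on k T f"
  by (induction k arbitrary: f) (auto intro: continuous_on_subset)

lemma smooth_imp_smooth_nonneg:
  assumes "\<And>x. 0 \<le> g x" "smooth_on UNIV g"
  shows "smooth_nonneg g"
  using assms times_differentiable_on_subset[of _ UNIV g "pos_set g"]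
  unfolding smooth_nonneg_def smooth_on_def
  by (metis subset_UNIV times_differentiable_on.simps(1))

text \<open>The Lebesgue integral with values in the extended reals, for integrands whose positive or
  negative part has finite integral.\<close>

definition leb_int :: "('a::euclidean_space \<Rightarrow> ereal) \<Rightarrow> ereal" where
  "leb_int f = enn2ereal (\<integral>\<^sup>+ x. e2ennreal (f x) \<partial>lebesgue)
             - enn2ereal (\<integral>\<^sup>+ x. e2ennreal (- f x) \<partial>lebesgue)"

definition has_leb_int :: "('a::euclidean_space \<Rightarrow> ereal) \<Rightarrow> bool" where
  "has_leb_int f \<longleftrightarrow> f \<in> borel_measurable lebesgue \<and>
     ((\<integral>\<^sup>+ x. e2ennreal (f x) \<partial>lebesgue) < \<infinity> \<or> (\<integral>\<^sup>+ x. e2ennreal (- f x) \<partial>lebesgue) < \<infinity>)"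

lemma leb_int_eq_lebesgue_integral:
  assumes "integrable lebesgue f"
  shows "has_leb_int (\<lambda>x. ereal (f x)) \<and> leb_int (\<lambda>x. ereal (f x)) = ereal (integral\<^sup>L lebesgue f)"
proof -
  have fin: "(\<integral>\<^sup>+ x. ennreal (f x) \<partial>lebesgue) < \<infinity>" "(\<integral>\<^sup>+ x. ennreal (- f x) \<partial>lebesgue) < \<infinity>"
    using assms by (auto simp: real_integrable_def top.not_eq_extremum)
  then have "enn2ereal (\<integral>\<^sup>+ x. ennreal (f x) \<partial>lebesgue)
        = ereal (enn2real (\<integral>\<^sup>+ x. ennreal (f x) \<partial>lebesgue))"
      "enn2ereal (\<integral>\<^sup>+ x. ennreal (- f x) \<partial>lebesgue)
        = ereal (enn2real (\<integral>\<^sup>+ x. ennreal (- f x) \<partial>lebesgue))"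
    by (simp_all add: enn2ereal_ennreal[symmetric])
  then show ?thesis
    using assms fin
    by (simp add: has_leb_int_def leb_int_def real_lebesgue_integral_def flip: ennreal.abs_eq)
qed

end

theory Submission
  imports Defs "HOL-Probability.Probability"
begin

text \<open>The inequality is a mass transport argument. A Knothe rearrangement \<open>S\<close>, monotone in one coordinate
  at a time, pushes the density \<open>W\<^sup>a\<close> to \<open>g\<^sup>a\<close>. Bounding \<open>W\<^sub>*(\<nabla>g(S y))\<close> by \<open>y \<bullet> \<nabla>g(S y) - W y\<close> and
  integrating by parts in each coordinate leaves the diagonal derivatives \<open>l\<^sub>i\<close> of the inverse map, whose
  product is the ratio of the densities; the arithmetic-geometric mean inequality
  \<open>(a + n) g(S y) \<le> a W y + g(S y) \<Sum>\<^sub>i l\<^sub>i\<close> then gives the claim.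

  The rearrangement needs no regularity of \<open>W\<close>: if \<open>\<sigma>\<close> pushes a density \<open>q\<close> monotonically to \<open>p\<close> on the
  line and \<open>\<psi>\<close> has derivative \<open>d\<close>, then writing \<open>t\<close> as an integral of indicators of \<open>{s<..}\<close> turns
  \<open>- \<integral> t d(\<sigma> t) / p(\<sigma> t) q(t) dt\<close> into \<open>\<integral> \<psi>(\<sigma> s) ds\<close>, so the map is never differentiated. The function \<open>g\<close>
  enters through the compactly supported functions obtained by cutting off \<open>g\<^bsup>a+1\<^esup>\<close> near \<open>0\<close>, near \<open>\<infinity>\<close> and
  far out in space; all passages to the limit are by Fatou's lemma.

  When \<open>g = W\<close> is concave on its support, the support is bounded, the infimum defining \<open>W\<^sub>*(\<nabla>g x)\<close> is
  attained at \<open>x\<close>, and the same cut-offs give \<open>(a + 1) \<integral> (x \<bullet> \<nabla>g) g\<^sup>a = - n \<integral> g\<^bsup>a+1\<^esup>\<close>.\<close>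

section \<open>Monotone rearrangement on the line\<close>

text \<open>A coordinate-wise rearrangement is triangular, so the determinant of its inverse is the
  product of its diagonal derivatives, and each of these is an explicit quotient of conditional
  densities. Its existence needs only quantile functions. The power a + 1 is forced: the gradient of
  \<open>g powr (a + 1)\<close>, divided by the target density \<open>g powr a\<close>, is a
  multiple of the gradient of g, which is the argument of the Legendre transform. The weights a and
  1 of the mean inequality come from the same source: the product of the l is the a-th power of g(S
  y) / W y. Two obstacles shape the rest. W may be unbounded, have unbounded support or an infinite
  integral of \<open>W powr (a + 1)\<close>, while the integration by parts wants bounded
  coordinates and the final cancellation a finite term. So the inequality is first shown for a
  density V of bounded support, with a separate function U in the Legendre bound; a rescaled
  truncation of W serves as V and the truncation itself as U. Moreover the integral of the Legendre
  transform may have an infinite part, so estimates are kept among nonnegative integrals, with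
  negative terms moved across.\<close>

definition quantile :: "(real \<Rightarrow> real) \<Rightarrow> real \<Rightarrow> real" where
  "quantile F u = (if 0 < u \<and> u < 1 then Inf {x. u \<le> F x} else 0)"

context real_distribution
begin

text \<open>The Galois connection between quantile and distribution function, through which later
  comparisons of quantiles go.\<close>

lemma quantile_le_iff:
  assumes "0 < u" "u < 1"
  shows "quantile (cdf M) u \<le> x \<longleftrightarrow> u \<le> cdf M x"
proof -
  interpret cdf_distribution M by (simp add: cdf_distribution_def real_distribution_axioms)
  show ?thesis using pseudoinverse[of u x] assms by (simp add: quantile_def)
qed

text \<open>One inequality is the Galois connection and holds for any law; the reverse one needs
  that there is no atom at the quantile, which enters as continuity from the left.\<close>

lemma cdf_quantile:
  assumes "0 < u" "u < 1" "\<And>x. isCont (cdf M) x"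
  shows "cdf M (quantile (cdf M) u) = u"
proof (rule antisym)
  let ?s = "quantile (cdf M) u"
  show "u \<le> cdf M ?s" using quantile_le_iff[OF assms(1,2), of ?s] by simp
  have "cdf M x \<le> u" if "x < ?s" for x
    using quantile_le_iff[OF assms(1,2), of x] that by auto
  moreover have "(cdf M \<longlongrightarrow> cdf M ?s) (at_left ?s)"
    using assms(3)[of ?s] by (simp add: isCont_def filterlim_at_split)
  ultimately show "cdf M ?s \<le> u"
    by (intro tendsto_upperbound[of "cdf M" _ "at_left ?s"])
       (auto simp: eventually_at_left_field intro!: exI[of _ "?s - 1"])
qed

lemma measurable_cdf: "cdf M \<in> borel_measurable borel"
  by (intro borel_measurable_mono monoI cdf_nondecreasing)

lemma sets_cdf_le: "{t. cdf M t \<le> u} \<in> sets borel"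
proof -
  note [measurable] = measurable_cdf
  show ?thesis by measurable
qed

text \<open>A law without atoms makes its own distribution function uniformly distributed. The
  sublevel set may extend beyond \<open>{..quantile (cdf M) u}\<close> by a flat piece; the upper
  bound therefore compares with the quantiles of all v > u and lets v decrease to u.\<close>

lemma measure_cdf_le:
  assumes "0 < u" "u < 1" "\<And>x. isCont (cdf M) x"
  shows "measure M {t. cdf M t \<le> u} = u"
proof -
  note [measurable] = measurable_cdf
  have sub: "{..quantile (cdf M) v} \<subseteq> {t. cdf M t \<le> v}" if "0 < v" "v < 1" for v
    using cdf_quantile[OF that assms(3)] cdf_nondecreasing by fastforce
  have 1: "u \<le> measure M {t. cdf M t \<le> u}"
    using finite_measure_mono[OF sub[OF assms(1,2)]] cdf_quantile[OF assms] sets_cdf_le[of u]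
    unfolding cdf_def2[symmetric] by simp
  have "measure M {t. cdf M t \<le> u} \<le> v" if "u < v" "v < 1" for v
  proof -
    have v: "0 < v" using assms that by auto
    have "{t. cdf M t \<le> u} \<subseteq> {..quantile (cdf M) v}"
    proof safe
      fix t assume "cdf M t \<le> u"
      show "t \<le> quantile (cdf M) v"
      proof (rule ccontr)
        assume "\<not> ?thesis"
        then have "cdf M (quantile (cdf M) v) \<le> cdf M t" by (intro cdf_nondecreasing) auto
        then show False using cdf_quantile[OF v that(2) assms(3)] \<open>cdf M t \<le> u\<close> that by auto
      qed
    qed
    from finite_measure_mono[OF this] show ?thesis
      using cdf_quantile[OF v that(2) assms(3)] by (simp add: cdf_def)
  qed
  then have "measure M {t. cdf M t \<le> u} \<le> u"
    using assms(2) by (intro dense_ge_bounded[of u 1]) auto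
  with 1 show ?thesis by simp
qed

text \<open>Ensures that the arguments at which \<open>quantile\<close> takes its default value are
  negligible. Both extreme sets are squeezed by the uniform law as u tends to 0 and to 1.\<close>

lemma AE_cdf_pos_less_1:
  assumes "\<And>x. isCont (cdf M) x"
  shows "AE t in M. 0 < cdf M t \<and> cdf M t < 1"
proof -
  note [measurable] = measurable_cdf
  have "measure M {t. cdf M t \<le> 0} \<le> u" if "0 < u" "u < 1" for u
  proof -
    have "{t. cdf M t \<le> 0} \<subseteq> {t. cdf M t \<le> u}" using that by auto
    from finite_measure_mono[OF this] show ?thesis
      using measure_cdf_le[OF that assms] sets_cdf_le[of u] by simp
  qed
  then have "measure M {t. cdf M t \<le> 0} \<le> 0"
    by (intro dense_ge_bounded[of 0 1]) auto
  then have "measure M {t. cdf M t \<le> 0} = 0"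
    using measure_nonneg[of M] by (simp add: antisym)
  then have A: "AE t in M. \<not> cdf M t \<le> 0"
    by (subst AE_iff_measurable[of "{t. cdf M t \<le> 0}"]) (auto simp: emeasure_eq_measure)
  have "u \<le> measure M {t. cdf M t < 1}" if "0 < u" "u < 1" for u
  proof -
    have "{t. cdf M t \<le> u} \<subseteq> {t. cdf M t < 1}" using that by auto
    from finite_measure_mono[OF this] show ?thesis
      using measure_cdf_le[OF that assms] by simp
  qed
  then have "1 \<le> measure M {t. cdf M t < 1}"
    by (intro dense_le_bounded[of 0 1]) auto
  then have "prob {t. cdf M t < 1} = 1" by (simp add: antisym)
  then have "AE t in M. t \<in> {t. cdf M t < 1}"
    by (intro AE_prob_1)
  with A show ?thesis by eventually_elim auto
qed

end

lemma measurable_quantile: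
  assumes "real_distribution P" 
  shows "quantile (cdf P) \<in> borel_measurable borel"
proof -
  interpret P: real_distribution P by fact
  have "{u. quantile (cdf P) u \<le> x} = {u. 0 < u \<and> u < 1 \<and> u \<le> cdf P x} \<union> {u. \<not> (0 < u \<and> u < 1) \<and> 0 \<le> x}" for x
    using P.quantile_le_iff by (auto simp: quantile_def)
  moreover have "\<dots> x \<in> sets borel" for x
    by (intro sets.Un) measurable
  ultimately show ?thesis
    by (intro borel_measurable_iff_le[THEN iffD2]) auto
qed

text \<open>The distribution function carries \<open>Q\<close> to the uniform law, and the quantile
  carries the uniform law to \<open>P\<close>. Points x where \<open>cdf P x\<close> is 0 or 1 are
  outside the range of \<open>measure_cdf_le\<close> and are treated separately.\<close>

lemma distr_quantile_cdf:
  assumes P: "real_distribution P" and Q: "real_distribution Q"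
    and cP: "\<And>x. isCont (cdf P) x" and cQ: "\<And>x. isCont (cdf Q) x"
  shows "distr Q borel (\<lambda>t. quantile (cdf P) (cdf Q t)) = P"
proof -
  interpret P: real_distribution P by fact
  interpret Q: real_distribution Q by fact
  note [measurable] = P.measurable_cdf Q.measurable_cdf measurable_quantile[OF P]
  have meas: "(\<lambda>t. quantile (cdf P) (cdf Q t)) \<in> borel_measurable borel" by measurable
  have "cdf (distr Q borel (\<lambda>t. quantile (cdf P) (cdf Q t))) x = cdf P x" for x
  proof -
    have "cdf (distr Q borel (\<lambda>t. quantile (cdf P) (cdf Q t))) x
        = measure Q {t. quantile (cdf P) (cdf Q t) \<le> x}"
      using meas by (subst cdf_def2, subst measure_distr) (auto simp: vimage_def)
    also have "\<dots> = measure Q {t. cdf Q t \<le> cdf P x}"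
    proof (rule measure_eq_AE)
      show "AE t in Q. t \<in> {t. quantile (cdf P) (cdf Q t) \<le> x} \<longleftrightarrow> t \<in> {t. cdf Q t \<le> cdf P x}"
        using Q.AE_cdf_pos_less_1[OF cQ] by eventually_elim (use P.quantile_le_iff in auto)
      show "{t. quantile (cdf P) (cdf Q t) \<le> x} \<in> sets Q" "{t. cdf Q t \<le> cdf P x} \<in> sets Q"
        unfolding Q.events_eq_borel using meas by measurable
    qed
    also have "\<dots> = cdf P x"
    proof (cases "0 < cdf P x \<and> cdf P x < 1")
      case True
      then show ?thesis using Q.measure_cdf_le cQ by blast
    next
      case False
      then consider "cdf P x = 0" | "cdf P x = 1"
        using P.cdf_nonneg[of x] P.cdf_bounded_prob[of x] by fastforce
      then show ?thesis
      proof cases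
        case 1
        have "measure Q {t. cdf Q t \<le> cdf P x} = measure Q {}"
        proof (rule measure_eq_AE)
          show "AE t in Q. t \<in> {t. cdf Q t \<le> cdf P x} \<longleftrightarrow> t \<in> {}"
            using Q.AE_cdf_pos_less_1[OF cQ] by eventually_elim (auto simp: 1)
        qed (use Q.sets_cdf_le in auto)
        then show ?thesis by (simp add: 1)
      next
        case 2
        then show ?thesis using Q.cdf_bounded_prob Q.prob_space by simp
      qed
    qed
    finally show ?thesis .
  qed
  then show ?thesis
    by (intro cdf_unique P) (use meas in auto)
qed

text \<open>The quotient is \<open>0\<close> if \<open>p\<close> has total mass \<open>0\<close> or is not integrable.\<close>

definition nprim :: "(real \<Rightarrow> real) \<Rightarrow> real \<Rightarrow> real" where
  "nprim p x = (LINT s|lborel. indicator {..x} s * p s) / (LINT s|lborel. p s)"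

text \<open>Target density first, source second. Both are normalised inside \<open>nprim\<close>, so
  their masses may differ and fibres of a joint density can be inserted as they are.\<close>

definition rearrange :: "(real \<Rightarrow> real) \<Rightarrow> (real \<Rightarrow> real) \<Rightarrow> real \<Rightarrow> real" where
  "rearrange p q t = quantile (nprim p) (nprim q t)"

context
  fixes p :: "real \<Rightarrow> real"
  assumes int: "integrable lborel p" and nonneg: "\<And>s. 0 \<le> p s" and pos: "0 < (LINT s|lborel. p s)"
begin

private abbreviation "m \<equiv> LINT s|lborel. p s"
private abbreviation "D \<equiv> density lborel (\<lambda>s. ennreal (p s / m))"

lemma
  shows real_distribution_ndensity: "real_distribution D"
    and cdf_ndensity: "cdf D = nprim p"
    and isCont_cdf_ndensity: "isCont (cdf D) x"
proof -
  have [measurable]: "p \<in> borel_measurable borel" using int by auto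
  have "emeasure D UNIV = (\<integral>\<^sup>+s. ennreal (p s / m) \<partial>lborel)"
    by (simp add: emeasure_density)
  also have "\<dots> = ennreal (LINT s|lborel. p s / m)"
    by (intro nn_integral_eq_integral) (use int nonneg pos in auto)
  also have "\<dots> = 1" using pos by simp
  finally have "prob_space D"
    by (intro prob_spaceI) simp
  then show R: "real_distribution D"
    by (simp add: real_distribution_def real_distribution_axioms_def)
  have "measure D {..x} = nprim p x" for x
  proof -
    have "emeasure D {..x} = (\<integral>\<^sup>+s. ennreal (indicator {..x} s * p s / m) \<partial>lborel)"
      by (simp add: emeasure_density) (auto intro!: nn_integral_cong simp: indicator_def)
    also have "\<dots> = ennreal (LINT s|lborel. indicator {..x} s * p s / m)"
      by (intro nn_integral_eq_integral)
         (use int nonneg pos in \<open>auto intro!: integrable_real_mult_indicator integrable_divide simp: mult.commute[of "indicator _ _"]\<close>)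
    also have "\<dots> = ennreal (nprim p x)" by (simp add: nprim_def)
    finally show ?thesis
      using nonneg pos by (simp add: measure_def nprim_def)
  qed
  then show "cdf D = nprim p" by (auto simp: cdf_def)
  interpret real_distribution D by fact
  have "emeasure D {x} = 0"
    using AE_lborel_singleton[of x] by (auto simp: emeasure_density nn_integral_0_iff_AE)
  then show "isCont (cdf D) x"
    by (simp add: isCont_cdf measure_def)
qed

end


context
  fixes p q :: "real \<Rightarrow> real"
  assumes p: "integrable lborel p" "\<And>s. 0 \<le> p s" "0 < (LINT s|lborel. p s)"
    and q: "integrable lborel q" "\<And>s. 0 \<le> q s" "0 < (LINT s|lborel. q s)"
begin

private abbreviation "mp \<equiv> LINT s|lborel. p s"
private abbreviation "mq \<equiv> LINT s|lborel. q s"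
private abbreviation "P \<equiv> density lborel (\<lambda>s. ennreal (p s / mp))"
private abbreviation "Q \<equiv> density lborel (\<lambda>s. ennreal (q s / mq))"

interpretation P: real_distribution P by (rule real_distribution_ndensity[OF p])
interpretation Q: real_distribution Q by (rule real_distribution_ndensity[OF q])

lemma borel_measurable_pq: "p \<in> borel_measurable borel" "q \<in> borel_measurable borel"
  using p(1) q(1) by auto

lemma borel_measurable_nprim: "nprim p \<in> borel_measurable borel" "nprim q \<in> borel_measurable borel"
  using P.measurable_cdf Q.measurable_cdf by (simp_all add: cdf_ndensity[OF p] cdf_ndensity[OF q])

lemma borel_measurable_rearrange: "rearrange p q \<in> borel_measurable borel"
proof -
  note [measurable] = borel_measurable_nprim measurable_quantile[OF P.real_distribution_axioms, unfolded cdf_ndensity[OF p]]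
  show ?thesis unfolding rearrange_def[abs_def] by measurable
qed

lemma AE_nprim: "AE t in lborel. 0 < q t \<longrightarrow> 0 < nprim q t \<and> nprim q t < 1"
proof -
  note [measurable] = borel_measurable_pq
  show ?thesis
    using Q.AE_cdf_pos_less_1[OF isCont_cdf_ndensity[OF q]]
    by (subst (asm) AE_density)
       (use q(3) in \<open>simp_all add: cdf_ndensity[OF q] zero_less_divide_iff not_less order.asym del: AE_conj_iff\<close>)
qed

lemma distr_rearrange: "distr Q borel (rearrange p q) = P"
  using distr_quantile_cdf[OF P.real_distribution_axioms Q.real_distribution_axioms
      isCont_cdf_ndensity[OF p] isCont_cdf_ndensity[OF q]]
  by (simp add: cdf_ndensity[OF p] cdf_ndensity[OF q] rearrange_def[abs_def])

lemma nn_integral_rearrange: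
  fixes \<rho> :: "real \<Rightarrow> ennreal"
  assumes [measurable]: "\<rho> \<in> borel_measurable borel"
  shows "(\<integral>\<^sup>+t. \<rho> (rearrange p q t) * ennreal (q t) \<partial>lborel)
    = ennreal (mq / mp) * (\<integral>\<^sup>+s. \<rho> s * ennreal (p s) \<partial>lborel)"
proof -
  note [measurable] = borel_measurable_pq borel_measurable_rearrange
  have *: "ennreal (q t) = ennreal (q t / mq) * ennreal mq" "ennreal (p t / mp) = ennreal (p t) * ennreal (1/mp)" for t
    using p q by (simp_all flip: ennreal_mult)
  have "(\<integral>\<^sup>+t. \<rho> (rearrange p q t) * ennreal (q t) \<partial>lborel)
     = (\<integral>\<^sup>+t. \<rho> (rearrange p q t) \<partial>Q) * ennreal mq"
    by (subst nn_integral_density) (simp_all add: *(1) nn_integral_cmult[symmetric] mult_ac)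
  also have "(\<integral>\<^sup>+t. \<rho> (rearrange p q t) \<partial>Q) = (\<integral>\<^sup>+s. \<rho> s \<partial>P)"
    using nn_integral_distr[of "rearrange p q" Q borel \<rho>] by (simp add: distr_rearrange)
  also have "\<dots> * ennreal mq = ((\<integral>\<^sup>+s. \<rho> s * ennreal (p s) \<partial>lborel) * ennreal (1/mp)) * ennreal mq"
    by (subst nn_integral_density)
       (simp_all add: *(2) nn_integral_multc[symmetric] mult.assoc, simp add: mult_ac)
  also have "\<dots> = ennreal (mq / mp) * (\<integral>\<^sup>+s. \<rho> s * ennreal (p s) \<partial>lborel)"
    using p q ennreal_mult[of mq "1 / mp"] by (simp add: mult_ac)
  finally show ?thesis .
qed

lemma integral_rearrange:
  fixes r :: "real \<Rightarrow> real"
  assumes [measurable]: "r \<in> borel_measurable borel"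
  shows "integrable lborel (\<lambda>t. r (rearrange p q t) * q t) \<longleftrightarrow> integrable lborel (\<lambda>s. r s * p s)"
    and "(LINT t|lborel. r (rearrange p q t) * q t) = mq / mp * (LINT s|lborel. r s * p s)"
proof -
  note [measurable] = borel_measurable_pq borel_measurable_rearrange
  have "integrable Q (\<lambda>t. r (rearrange p q t)) \<longleftrightarrow> integrable P r"
    using integrable_distr_eq[of "rearrange p q" Q borel r] by (simp add: distr_rearrange)
  moreover have "integrable Q (\<lambda>t. r (rearrange p q t)) \<longleftrightarrow> integrable lborel (\<lambda>t. r (rearrange p q t) * q t / mq)"
    using q by (subst integrable_density) (auto simp: mult.commute)
  moreover have "integrable P r \<longleftrightarrow> integrable lborel (\<lambda>t. r t * p t / mp)"
    using p by (subst integrable_density) (auto simp: mult.commute)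
  ultimately show "integrable lborel (\<lambda>t. r (rearrange p q t) * q t) \<longleftrightarrow> integrable lborel (\<lambda>s. r s * p s)"
    using p q by (auto simp: divide_inverse integrable_mult_left_iff)
  have "(LINT t|lborel. r (rearrange p q t) * q t) = mq * (LINT t|Q. r (rearrange p q t))"
    using q by (subst integral_density) (auto simp: mult.commute)
  also have "(LINT t|Q. r (rearrange p q t)) = (LINT s|P. r s)"
    using integral_distr[of "rearrange p q" Q borel r] by (simp add: distr_rearrange)
  also have "\<dots> = (LINT s|lborel. r s * p s) / mp"
    using p by (subst integral_density) (auto simp: mult.commute)
  finally show "(LINT t|lborel. r (rearrange p q t) * q t) = mq / mp * (LINT s|lborel. r s * p s)"
    by simp
qed

text \<open>Through the Galois connection the left comparison becomes
  \<open>nprim q s < nprim q t\<close>. This differs from \<open>s < t\<close> only on a flat piece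
  of \<open>nprim q\<close>, and such a piece carries no mass of \<open>q\<close>.\<close>

lemma rearrange_less_iff:
  assumes "0 < nprim q s" "nprim q s < 1"
  shows "AE t in lborel. 0 < q t \<longrightarrow> (rearrange p q s < rearrange p q t \<longleftrightarrow> s < t)"
proof -
  note [measurable] = borel_measurable_pq
  have mono: "nprim q x \<le> nprim q y" if "x \<le> y" for x y
    using Q.cdf_nondecreasing[OF that] by (simp add: cdf_ndensity[OF q])
  have "AE t in lborel. 0 < q t \<longrightarrow> \<not> (s < t \<and> nprim q t \<le> nprim q s)"
  proof -
    note [measurable] = borel_measurable_nprim
    have sets: "{t. nprim q t \<le> nprim q s} \<in> sets borel" by measurable
    have "measure Q {t. nprim q t \<le> nprim q s} = nprim q s"
      using Q.measure_cdf_le[OF _ _ isCont_cdf_ndensity[OF q], of "nprim q s"] assms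
      by (simp add: cdf_ndensity[OF q])
    moreover have "measure Q {..s} = nprim q s"
      using fun_cong[OF cdf_ndensity[OF q], of s] by (simp add: cdf_def)
    moreover have "{..s} \<subseteq> {t. nprim q t \<le> nprim q s}" using mono by auto
    ultimately have "measure Q ({t. nprim q t \<le> nprim q s} - {..s}) = 0"
      using sets by (subst Q.finite_measure_Diff) auto
    then have "AE t in Q. t \<notin> {t. nprim q t \<le> nprim q s} - {..s}"
      using sets by (intro AE_not_in) (simp add: null_sets_def Q.emeasure_eq_measure)
    then show ?thesis using q(3) sets by (auto simp: AE_density)
  qed
  with AE_nprim show ?thesis
  proof eventually_elim
    case (elim t)
    show ?case
    proof
      assume t: "0 < q t"
      have "rearrange p q t \<le> rearrange p q s \<longleftrightarrow> nprim q t \<le> nprim p (rearrange p q s)"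
        using P.quantile_le_iff[of "nprim q t"] elim t
        by (simp add: cdf_ndensity[OF p] rearrange_def)
      also have "nprim p (rearrange p q s) = nprim q s"
        using P.cdf_quantile[OF assms isCont_cdf_ndensity[OF p]] by (simp add: cdf_ndensity[OF p] rearrange_def)
      finally show "rearrange p q s < rearrange p q t \<longleftrightarrow> s < t"
        using elim t mono[of t s] by force
    qed
  qed
qed


lemma nprim_range: "0 \<le> nprim q s" "nprim q s \<le> 1"
  using Q.cdf_nonneg[of s] Q.cdf_bounded_prob[of s] by (simp_all add: cdf_ndensity[OF q])

lemma AE_nprim_0:
  assumes "nprim q s = 0" shows "AE t in lborel. 0 < q t \<longrightarrow> s < t"
proof -
  note [measurable] = borel_measurable_pq
  have "measure Q {..s} = 0"
    using fun_cong[OF cdf_ndensity[OF q], of s] assms by (simp add: cdf_def)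
  then have "AE t in Q. t \<notin> {..s}"
    by (intro AE_not_in) (simp add: null_sets_def Q.emeasure_eq_measure)
  then show ?thesis using q(3)
    by (subst (asm) AE_density) (auto simp: zero_less_divide_iff not_le order.asym)
qed

lemma AE_nprim_1:
  assumes "nprim q s = 1" shows "AE t in lborel. 0 < q t \<longrightarrow> t \<le> s"
proof -
  note [measurable] = borel_measurable_pq
  have "measure Q {..s} = 1"
    using fun_cong[OF cdf_ndensity[OF q], of s] assms by (simp add: cdf_def)
  then have "AE t in Q. t \<in> {..s}"
    by (intro Q.AE_prob_1) 
  then show ?thesis using q(3)
    by (subst (asm) AE_density) (auto simp: zero_less_divide_iff order.asym)
qed

text \<open>Let \<tau> be the inverse of the rearrangement. The integral equals
  \<open>mq / mp\<close> times the integral of \<tau> d, and integrating by parts against the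
  monotone \<tau> turns the latter into minus the integral of \<psi> with respect to d\<tau>. Gaps
  in the set where \<open>q\<close> is positive are jumps of \<tau>: they count in d\<tau> but not
  on the left of the last claim, hence an inequality.\<close>

lemma rearrange_by_parts:
  fixes d \<psi> :: "real \<Rightarrow> real"
  assumes d [measurable]: "d \<in> borel_measurable borel" and int_d: "integrable lborel d"
    and zero: "AE s in lborel. p s = 0 \<longrightarrow> d s = 0" and d0: "(LINT s|lborel. d s) = 0"
    and \<psi>: "\<And>c. \<psi> c = - (LINT s|lborel. indicator {c<..} s * d s)" and \<psi>0: "\<And>c. 0 \<le> \<psi> c"
    and k: "0 \<le> k" "AE t in lborel. 0 < q t \<longrightarrow> \<bar>t\<bar> \<le> k"
  shows "integrable lborel (\<lambda>t. t * (d (rearrange p q t) / p (rearrange p q t)) * q t)"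
    and "(LINT t|lborel. t * (d (rearrange p q t) / p (rearrange p q t)) * q t) \<le> 0"
    and "(\<integral>\<^sup>+t. indicator {t. 0 < q t} t * ennreal (\<psi> (rearrange p q t)) \<partial>lborel)
      \<le> ennreal (- (mp / mq) * (LINT t|lborel. t * (d (rearrange p q t) / p (rearrange p q t)) * q t))"
proof -
  note [measurable] = borel_measurable_pq borel_measurable_rearrange
  define r where "r s = d s / p s" for s
  define e where "e t = r (rearrange p q t) * q t" for t
  have [measurable]: "r \<in> borel_measurable borel" "e \<in> borel_measurable borel"
    unfolding r_def e_def by measurable
  \<comment> \<open>Where \<open>p\<close> vanishes so does \<open>d\<close>, so multiplying the
    quotient by \<open>p\<close> recovers \<open>d\<close>.\<close>
  have rp: "AE s in lborel. r s * p s = d s"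
    using zero by eventually_elim (auto simp: r_def)
  have "integrable lborel (\<lambda>s. r s * p s)"
    using int_d by (subst integrable_cong_AE[OF _ _ rp]) auto
  then have e: "integrable lborel e"
    using integral_rearrange(1)[of r] unfolding e_def by simp
  have e0: "(LINT t|lborel. e t) = 0"
    using integral_rearrange(2)[of r] d0 integral_cong_AE[OF _ _ rp] unfolding e_def by simp
  have eq: "t * (d (rearrange p q t) / p (rearrange p q t)) * q t = t * e t" for t
    by (simp add: r_def e_def)
  have q0: "AE t in lborel. q t = 0 \<longrightarrow> e t = 0" by (simp add: e_def)
  show I: "integrable lborel (\<lambda>t. t * (d (rearrange p q t) / p (rearrange p q t)) * q t)"
    unfolding eq
  proof (rule Bochner_Integration.integrable_bound)
    show "integrable lborel (\<lambda>t. k * e t)" using e by simp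
    show "AE t in lborel. norm (t * e t) \<le> norm (k * e t)"
      using k(2) q0
    proof eventually_elim
      case (elim t)
      then show ?case using q(2)[of t] k(1)
        by (cases "q t = 0") (auto simp: abs_mult intro!: mult_right_mono)
    qed
  qed measurable
  define J where "J s = (LINT t|lborel. indicator {s<..} t * e t)" for s
  \<comment> \<open>By monotonicity the tail \<open>{s<..}\<close> of the source corresponds to the
    tail \<open>{rearrange p q s<..}\<close> of the target, where \<open>d\<close> integrates to
    -\<psi>. If \<open>nprim q s\<close> is 0 or 1, the tail carries all or nothing of
    \<open>q\<close>; since \<open>e\<close> has integral 0, \<open>J s\<close> vanishes either
    way.\<close>
  have J: "- J s = (if 0 < nprim q s \<and> nprim q s < 1 then mq / mp * \<psi> (rearrange p q s) else 0)" for s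
  proof (cases "0 < nprim q s \<and> nprim q s < 1")
    case True
    have "J s = (LINT t|lborel. (indicator {rearrange p q s<..} (rearrange p q t) * r (rearrange p q t)) * q t)"
      unfolding J_def
    proof (rule integral_cong_AE)
      show "AE t in lborel. indicator {s<..} t * e t
          = indicator {rearrange p q s<..} (rearrange p q t) * r (rearrange p q t) * q t"
        using rearrange_less_iff[OF True[THEN conjunct1] True[THEN conjunct2]]
      proof eventually_elim
        case (elim t)
        then show ?case using q(2)[of t]
          by (cases "q t = 0") (auto simp: e_def indicator_def)
      qed
    qed measurable
    also have "\<dots> = mq / mp * (LINT x|lborel. indicator {rearrange p q s<..} x * r x * p x)"
      by (subst integral_rearrange) auto
    also have "(LINT x|lborel. indicator {rearrange p q s<..} x * r x * p x)
        = (LINT x|lborel. indicator {rearrange p q s<..} x * d x)"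
      by (rule integral_cong_AE, measurable, use rp in eventually_elim) (auto simp: mult.assoc)
    finally show ?thesis using True \<psi> by simp
  next
    case False
    then consider "nprim q s = 0" | "nprim q s = 1" using nprim_range[of s] by fastforce
    then have "J s = 0"
    proof cases
      case 1
      have "J s = (LINT t|lborel. e t)"
        unfolding J_def
      proof (rule integral_cong_AE)
        show "AE t in lborel. indicator {s<..} t * e t = e t"
          using AE_nprim_0[OF 1] q0
        proof eventually_elim
          case (elim t)
          then show ?case using q(2)[of t] by (cases "q t = 0") auto
        qed
      qed measurable
      then show ?thesis using e0 by simp
    next
      case 2
      have "J s = (LINT t::real|lborel. 0)"
        unfolding J_def
      proof (rule integral_cong_AE)
        show "AE t in lborel. indicator {s<..} t * e t = 0"
          using AE_nprim_1[OF 2] q0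
        proof eventually_elim
          case (elim t)
          then show ?case using q(2)[of t] by (cases "q t = 0") auto
        qed
      qed measurable
      then show ?thesis by simp
    qed
    then show ?thesis using False by auto
  qed
  define H where "H s t = indicator {-k..k} s * (indicator {s<..} t * e t)" for s t :: real
  have [measurable]: "case_prod H \<in> borel_measurable (lborel \<Otimes>\<^sub>M lborel)"
  proof -
    have "H = (\<lambda>s t. indicator {-k..k} s * (indicator {p. fst p < snd p} (s, t) * e t))"
      by (auto simp: H_def fun_eq_iff indicator_def)
    then show ?thesis by (simp add: split_beta')
  qed
  have ii: "integrable lborel (indicator {-k..k} :: real \<Rightarrow> real)"
    by (rule integrable_real_indicator) (auto simp: emeasure_lborel_Icc_eq)
  have intH: "integrable (lborel \<Otimes>\<^sub>M lborel) (case_prod H)"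
  proof (rule Bochner_Integration.integrable_bound)
    show "integrable (lborel \<Otimes>\<^sub>M lborel) (\<lambda>(s, t). indicator {-k..k} s * e t)"
    proof (rule lborel_pair.Fubini_integrable)
      show "integrable lborel (\<lambda>x. LINT y|lborel. norm (case (x, y) of (s, t) \<Rightarrow> indicat_real {- k..k} s * e t))"
        using ii by (simp add: abs_mult)
    qed (use e in auto)
  qed (auto simp: H_def indicator_def)
  have "(LINT s|lborel. indicator {-k..k} s * J s) = (LINT s|lborel. LINT t|lborel. H s t)"
    by (simp add: H_def J_def)
  also have "\<dots> = (LINT t|lborel. LINT s|lborel. H s t)"
    using lborel_pair.Fubini_integral[OF intH] by simp
  \<comment> \<open>For \<open>\<bar>t\<bar> \<le> k\<close> the interval \<open>{-k..<t}\<close>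
    has length t + k. The constant k disappears below because \<open>e\<close> has integral
    0.\<close>
  also have "\<dots> = (LINT t|lborel. (t + k) * e t)"
  proof (rule integral_cong_AE)
    show "AE t in lborel. (LINT s|lborel. H s t) = (t + k) * e t"
      using k(2) q0
    proof eventually_elim
      case (elim t)
      have "(LINT s|lborel. H s t) = (LINT s|lborel. indicator {-k..<t} s * e t)" if "\<bar>t\<bar> \<le> k"
        using that by (intro Bochner_Integration.integral_cong) (auto simp: H_def indicator_def)
      then show ?case using elim q(2)[of t] k(1)
        by (cases "q t = 0") (auto simp: H_def)
    qed
  qed measurable
  also have "\<dots> = (LINT t|lborel. t * e t) + k * (LINT t|lborel. e t)"
    using I[unfolded eq] e by (simp add: distrib_right)
  finally have Jt: "(LINT s|lborel. indicator {-k..k} s * J s) = (LINT t|lborel. t * e t)"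
    by (simp add: e0)
  have intJ: "integrable lborel (\<lambda>s. indicator {-k..k} s * J s)"
    using lborel_pair.integrable_fst[OF intH] by (simp add: H_def J_def)
  have J_le: "J t \<le> 0" for t
  proof -
    have "0 \<le> - J t" unfolding J using p(3) q(3) \<psi>0 by auto
    then show ?thesis by simp
  qed
  show "(LINT t|lborel. t * (d (rearrange p q t) / p (rearrange p q t)) * q t) \<le> 0"
    unfolding eq Jt[symmetric]
    using J_le Bochner_Integration.integral_nonneg[where M = lborel and f = "\<lambda>s. - (indicator {-k..k} s * J s)"]
    by (simp add: indicator_def)
  have "(\<integral>\<^sup>+t. indicator {t. 0 < q t} t * ennreal (\<psi> (rearrange p q t)) \<partial>lborel)
      \<le> (\<integral>\<^sup>+t. ennreal (- (mp / mq) * (indicator {-k..k} t * J t)) \<partial>lborel)"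
  proof (rule nn_integral_mono_AE)
    show "AE t in lborel. indicator {t. 0 < q t} t * ennreal (\<psi> (rearrange p q t))
        \<le> ennreal (- (mp / mq) * (indicator {-k..k} t * J t))"
      using AE_nprim k(2)
    proof eventually_elim
      case (elim t)
      have "J t = - (if 0 < nprim q t \<and> nprim q t < 1 then mq / mp * \<psi> (rearrange p q t) else 0)"
        using J[of t] by simp
      then show ?case using elim q(2)[of t] p(3) q(3) \<psi>0
        by (auto simp: indicator_def)
    qed
  qed
  also have "\<dots> = ennreal (LINT t|lborel. - (mp / mq) * (indicator {-k..k} t * J t))"
  proof (rule nn_integral_eq_integral)
    show "AE t in lborel. 0 \<le> - (mp / mq) * (indicator {-k..k} t * J t)"
      using p(3) q(3) J_le
      by (auto simp: indicator_def mult_nonneg_nonpos intro!: AE_I2 divide_nonpos_pos)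
  qed (use intJ in simp)
  also have "\<dots> = ennreal (- (mp / mq) * (LINT t|lborel. t * e t))"
    by (simp add: Jt)
  finally show "(\<integral>\<^sup>+t. indicator {t. 0 < q t} t * ennreal (\<psi> (rearrange p q t)) \<partial>lborel)
      \<le> ennreal (- (mp / mq) * (LINT t|lborel. t * (d (rearrange p q t) / p (rearrange p q t)) * q t))"
    unfolding eq .
qed

end

section \<open>The Knothe coupling\<close>

text \<open>The parameter enters the density and the argument alike, so measurability is read off
  sublevel sets, which the Galois connection reduces to conditions on \<open>nprim\<close>. Fibres
  with \<open>m x = 0\<close>, among them the non-integrable ones, are a case of their own: there
  \<open>nprim\<close> is 0 and the quantile is the constant \<open>Inf {}\<close>.\<close>

lemma measurable_quantile_nprim:
  fixes p :: "'a \<Rightarrow> real \<Rightarrow> real"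
  assumes [measurable]: "case_prod p \<in> borel_measurable (N \<Otimes>\<^sub>M lborel)" "u \<in> borel_measurable N"
    and nonneg: "\<And>x s. 0 \<le> p x s"
  shows "(\<lambda>x. quantile (nprim (p x)) (u x)) \<in> borel_measurable N"
proof -
  have [measurable]: "(\<lambda>x. nprim (p x) s) \<in> borel_measurable N" for s
    unfolding nprim_def by measurable
  define m where "m x = (LINT s|lborel. p x s)" for x
  have [measurable]: "m \<in> borel_measurable N" unfolding m_def by measurable
  have le: "quantile (nprim (p x)) v \<le> s \<longleftrightarrow> v \<le> nprim (p x) s" if "m x \<noteq> 0" "0 < v" "v < 1" for x v s
  proof -
    have int: "integrable lborel (p x)"
      using that by (metis m_def not_integrable_integral_eq)
    have "0 \<le> m x" unfolding m_def by (intro Bochner_Integration.integral_nonneg nonneg)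
    with that have pos: "0 < (LINT s|lborel. p x s)" by (simp add: m_def)
    show ?thesis
      using real_distribution.quantile_le_iff[OF real_distribution_ndensity[OF int nonneg pos] that(2,3), of s]
      by (simp add: cdf_ndensity[OF int nonneg pos])
  qed
  have 0: "nprim (p x) = (\<lambda>s. 0)" if "m x = 0" for x
    using that by (auto simp: nprim_def m_def)
  have q0: "quantile (\<lambda>s. 0) v = Inf {}" if "0 < v" "v < 1" for v
    using that by (auto simp: quantile_def not_le intro!: arg_cong[where f = Inf])
  have iff: "quantile (nprim (p x)) (u x) \<le> s \<longleftrightarrow>
      (m x \<noteq> 0 \<and> 0 < u x \<and> u x < 1 \<and> u x \<le> nprim (p x) s) \<or>
      (m x = 0 \<and> 0 < u x \<and> u x < 1 \<and> Inf {} \<le> s) \<or> (\<not> (0 < u x \<and> u x < 1) \<and> 0 \<le> s)" for x s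
  proof (cases "0 < u x \<and> u x < 1")
    case True
    then show ?thesis using le[of x "u x" s] 0[of x] q0[of "u x"] by (cases "m x = 0") auto
  next
    case False
    then show ?thesis by (auto simp: quantile_def)
  qed
  have eq: "{x\<in>space N. quantile (nprim (p x)) (u x) \<le> s} =
      {x\<in>space N. m x \<noteq> 0 \<and> 0 < u x \<and> u x < 1 \<and> u x \<le> nprim (p x) s} \<union>
      {x\<in>space N. m x = 0 \<and> 0 < u x \<and> u x < 1 \<and> Inf {} \<le> s} \<union>
      {x\<in>space N. \<not> (0 < u x \<and> u x < 1) \<and> 0 \<le> s}" for s
    unfolding iff by blast
  show ?thesis
    unfolding borel_measurable_iff_le eq by (intro allI sets.Un) measurable
qed

section \<open>Lebesgue measure on a finite product of lines\<close>

abbreviation PL :: "'i set \<Rightarrow> ('i \<Rightarrow> real) measure" where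
  "PL I \<equiv> Pi\<^sub>M I (\<lambda>_. lborel)"

interpretation PL: product_sigma_finite "\<lambda>_. lborel :: real measure"
  by (simp add: product_sigma_finite_def lborel.sigma_finite_measure_axioms)

lemma space_PL_upd: "x \<in> space (PL I) \<Longrightarrow> x(j := s) \<in> space (PL (insert j I))"
  by (auto simp: space_PiM PiE_iff extensional_def)

lemma space_PL_upd_in: "x \<in> space (PL I) \<Longrightarrow> i \<in> I \<Longrightarrow> x(i := s) \<in> space (PL I)"
  using space_PL_upd[of x I i s] by (simp add: insert_absorb)

lemma restrict_PL_upd: "x \<in> space (PL I) \<Longrightarrow> j \<notin> I \<Longrightarrow> restrict (x(j := s)) I = x"
  by (auto simp: space_PiM PiE_iff extensional_def restrict_def)

lemma measurable_PL_upd [measurable (raw)]: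
  assumes "f \<in> measurable N (PL I)" "h \<in> measurable N lborel"
  shows "(\<lambda>x. (f x)(j := h x)) \<in> measurable N (PL (insert j I))"
  using measurable_fun_upd[OF _ assms(1), of "insert j I" j h] assms(2) by simp

lemma AE_PL_insert:
  assumes fin: "finite I" "j \<notin> I" and "AE z in PL (insert j I). P z"
  shows "AE x in PL I. AE s in lborel. P (x(j := s))"
proof -
  obtain N where N: "{z \<in> space (PL (insert j I)). \<not> P z} \<subseteq> N" and [measurable]: "N \<in> sets (PL (insert j I))"
    and null: "emeasure (PL (insert j I)) N = 0"
    using assms(3) by (rule AE_E)
  have "(\<integral>\<^sup>+z. indicator N z \<partial>PL (insert j I)) = 0" using null by simp
  then have "(\<integral>\<^sup>+x. \<integral>\<^sup>+s. indicator N (x(j := s)) \<partial>lborel \<partial>PL I) = 0"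
    by (subst (asm) PL.product_nn_integral_insert[OF fin]) auto
  then have "AE x in PL I. (\<integral>\<^sup>+s. indicator N (x(j := s)) \<partial>lborel) = 0"
    by (subst (asm) nn_integral_0_iff_AE) simp_all
  then show ?thesis
    using AE_space
  proof eventually_elim
    case (elim x)
    then have [measurable]: "x \<in> space (PL I)" by simp
    have "AE s in lborel. (indicator N (x(j := s)) :: ennreal) = 0"
      using elim by (subst (asm) nn_integral_0_iff_AE) simp_all
    then show ?case
      by eventually_elim (use N space_PL_upd[OF elim(2)] in \<open>auto simp: indicator_def split: if_splits\<close>)
  qed
qed

lemma AE_PL_insertI:
  assumes fin: "finite I" "j \<notin> I" and [measurable]: "Measurable.pred (PL (insert j I)) P"
    and "AE x in PL I. AE s in lborel. P (x(j := s))"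
  shows "AE z in PL (insert j I). P z"
proof -
  let ?N = "{z \<in> space (PL (insert j I)). \<not> P z}"
  have "(\<integral>\<^sup>+z. indicator ?N z \<partial>PL (insert j I)) = (\<integral>\<^sup>+x. \<integral>\<^sup>+s. indicator ?N (x(j := s)) \<partial>lborel \<partial>PL I)"
    by (rule PL.product_nn_integral_insert[OF fin]) measurable
  also have "\<dots> = (\<integral>\<^sup>+x. 0 \<partial>PL I)"
  proof (rule nn_integral_cong_AE)
    show "AE x in PL I. (\<integral>\<^sup>+s. indicator ?N (x(j := s)) \<partial>lborel) = 0"
      using assms(4)
    proof eventually_elim
      case (elim x)
      have "(\<integral>\<^sup>+s. indicator ?N (x(j := s)) \<partial>lborel) = (\<integral>\<^sup>+(s::real). 0 \<partial>lborel)"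
        by (rule nn_integral_cong_AE, use elim in eventually_elim) auto
      then show ?case by simp
    qed
  qed
  finally have "emeasure (PL (insert j I)) ?N = 0" by simp
  then show ?thesis by (intro AE_I[OF subset_refl]) measurable
qed


section \<open>Test functions on products and their marginals\<close>

abbreviation box01 :: "'i set \<Rightarrow> real \<Rightarrow> ('i \<Rightarrow> real) \<Rightarrow> real" where
  "box01 I R x \<equiv> \<Prod>k\<in>I. indicator {-R..R} (x k)"

text \<open>The derivative in direction \<open>i\<close> is expressed by integration along lines because this form is
  inherited by marginals.\<close>

definition test_pair :: "'i set \<Rightarrow> 'i \<Rightarrow> (('i \<Rightarrow> real) \<Rightarrow> real) \<Rightarrow> (('i \<Rightarrow> real) \<Rightarrow> real) \<Rightarrow> bool" where
  "test_pair I i \<Psi> D \<longleftrightarrow> \<Psi> \<in> borel_measurable (PL I) \<and> D \<in> borel_measurable (PL I) \<and>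
     (\<forall>x\<in>space (PL I). 0 \<le> \<Psi> x) \<and>
     (\<exists>C\<ge>0. \<exists>R\<ge>0. \<forall>x\<in>space (PL I). \<bar>D x\<bar> \<le> C * box01 I R x) \<and>
     (\<forall>x\<in>space (PL I). (LINT s|lborel. D (x(i := s))) = 0 \<and>
       (\<forall>c. \<Psi> (x(i := c)) = - (LINT s|lborel. indicator {c<..} s * D (x(i := s)))))"

lemma integrable_box: "integrable lborel (indicator {-R..R} :: real \<Rightarrow> real)"
  by (rule integrable_real_indicator) (auto simp: emeasure_lborel_Icc_eq)

lemma test_pair_boundE:
  assumes "test_pair I i \<Psi> D"
  obtains C R where "0 \<le> C" "0 \<le> R" "\<And>x. x \<in> space (PL I) \<Longrightarrow> \<bar>D x\<bar> \<le> C * box01 I R x"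
  using assms unfolding test_pair_def by blast

lemma test_pair_integrable:
  assumes "test_pair I i \<Psi> D" and fin: "finite I"
  shows "integrable (PL I) D"
proof -
  obtain C R where CR: "0 \<le> C" "0 \<le> R"
    "\<And>x. x \<in> space (PL I) \<Longrightarrow> \<bar>D x\<bar> \<le> C * box01 I R x"
    using test_pair_boundE[OF assms(1)] by blast
  have [measurable]: "D \<in> borel_measurable (PL I)"
    using assms(1) by (simp add: test_pair_def)
  show ?thesis
  proof (rule Bochner_Integration.integrable_bound)
    show "integrable (PL I) (\<lambda>x. C * box01 I R x)"
      by (intro integrable_mult_right PL.product_integrable_prod fin integrable_box)
    show "AE x in PL I. norm (D x) \<le> norm (C * box01 I R x)"
      using AE_space by eventually_elim (use CR(3) in \<open>force intro: order_trans[OF _ abs_ge_self]\<close>)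
  qed measurable
qed

lemma prod_indicator_upd:
  assumes "finite I" "j \<notin> I"
  shows "(\<Prod>k\<in>insert j I. indicator {-R..R} ((x(j := s)) k)) = (indicator {-R..R} s * box01 I R x :: real)"
proof -
  have "(\<Prod>k\<in>I. indicator {-R..R} ((x(j := s)) k)) = box01 I R x"
    by (intro prod.cong) (use assms in auto)
  then show ?thesis using assms by simp
qed

lemma prod_indicator_01: "finite I \<Longrightarrow> 0 \<le> box01 I R x \<and> box01 I R x \<le> 1"
  by (intro conjI prod_nonneg prod_le_1) auto

lemma test_pair_fibre:
  assumes "test_pair (insert j I) i \<Psi> D" and fin: "finite I" "j \<notin> I" and x: "x \<in> space (PL I)"
  shows "integrable lborel (\<lambda>s. D (x(j := s)))"
proof -
  obtain C R where CR: "0 \<le> C" "0 \<le> R"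
    "\<And>x. x \<in> space (PL (insert j I)) \<Longrightarrow> \<bar>D x\<bar> \<le> C * box01 (insert j I) R x"
    using test_pair_boundE[OF assms(1)] by blast
  have [measurable]: "D \<in> borel_measurable (PL (insert j I))"
    using assms(1) by (simp add: test_pair_def)
  show ?thesis
  proof (rule Bochner_Integration.integrable_bound)
    show "integrable lborel (\<lambda>s::real. C * indicator {-R..R} s)"
      by (intro integrable_mult_right integrable_box)
    have "\<bar>D (x(j := s))\<bar> \<le> C * indicator {-R..R} s" for s
    proof -
      have "\<bar>D (x(j := s))\<bar> \<le> C * (indicator {-R..R} s * box01 I R x)"
        using CR(3)[OF space_PL_upd[OF x, of j s]] unfolding prod_indicator_upd[OF fin] .
      also have "\<dots> \<le> C * (indicator {-R..R} s * 1)"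
        using CR(1) prod_indicator_01[OF fin(1), of R x] by (intro mult_left_mono) (auto simp: indicator_def)
      finally show ?thesis by simp
    qed
    then show "AE s in lborel. norm (D (x(j := s))) \<le> norm (C * indicator {-R..R} s)"
      using CR(1) by (auto simp: abs_mult)
  qed (use x in measurable)
qed

text \<open>Integrating out coordinate \<open>j\<close> commutes with the line integrals in
  direction \<open>i\<close> by Fubini, so nothing is differentiated under the integral.
  Integrability of \<Psi> along fibres is itself read off from its form as a tail integral of
  \<open>D\<close>.\<close>

lemma test_pair_marginal:
  assumes T: "test_pair (insert j I) i \<Psi> D" and fin: "finite I" "j \<notin> I" and i: "i \<in> I"
  defines "\<Psi>' \<equiv> \<lambda>x. LINT s|lborel. \<Psi> (x(j := s))" and "D' \<equiv> \<lambda>x. LINT s|lborel. D (x(j := s))"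
  shows "test_pair I i \<Psi>' D'"
    and "\<And>x. x \<in> space (PL I) \<Longrightarrow> integrable lborel (\<lambda>s. \<Psi> (x(j := s)))"
proof -
  obtain C R where CR: "0 \<le> C" "0 \<le> R"
    "\<And>x. x \<in> space (PL (insert j I)) \<Longrightarrow> \<bar>D x\<bar> \<le> C * box01 (insert j I) R x"
    using test_pair_boundE[OF T] by blast
  have [measurable]: "D \<in> borel_measurable (PL (insert j I))" "\<Psi> \<in> borel_measurable (PL (insert j I))"
    and nonneg: "\<And>x. x \<in> space (PL (insert j I)) \<Longrightarrow> 0 \<le> \<Psi> x"
    and D0: "\<And>x. x \<in> space (PL (insert j I)) \<Longrightarrow> (LINT s|lborel. D (x(i := s))) = 0"
    and \<Psi>: "\<And>x c. x \<in> space (PL (insert j I)) \<Longrightarrow> \<Psi> (x(i := c)) = - (LINT s|lborel. indicator {c<..} s * D (x(i := s)))"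
    using T unfolding test_pair_def by blast+
  have ij: "i \<noteq> j" using fin i by auto
  have bound: "\<bar>D (x(j := r))\<bar> \<le> C * (indicator {-R..R} r * box01 I R x)"
    if "x \<in> space (PL I)" for x r
    using CR(3)[OF space_PL_upd[OF that, of j r]] unfolding prod_indicator_upd[OF fin] .
  have bound2: "\<bar>D (x(i := s, j := r))\<bar> \<le> C * (indicator {-R..R} r * indicator {-R..R} s)"
    if "x \<in> space (PL I)" for x r s
  proof -
    have "\<bar>D (x(i := s, j := r))\<bar> \<le> C * (indicator {-R..R} r * box01 I R (x(i := s)))"
      by (rule bound[OF space_PL_upd_in[OF that i]])
    also have "box01 I R (x(i := s)) = indicator {-R..R} s * (\<Prod>k\<in>I-{i}. indicator {-R..R} ((x(i := s)) k))"
      using fin i by (simp add: prod.remove)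
    also have "C * (indicator {-R..R} r * \<dots>) \<le> C * (indicator {-R..R} r * (indicator {-R..R} s * 1))"
      using CR(1) prod_indicator_01[of "I - {i}" R "x(i := s)"] fin
      by (intro mult_left_mono) (auto simp: indicator_def)
    finally show ?thesis unfolding mult_1_right .
  qed
  have int2: "integrable (lborel \<Otimes>\<^sub>M lborel) (\<lambda>(s, r). D (x(i := s, j := r)))" if x: "x \<in> space (PL I)" for x
  proof (rule Bochner_Integration.integrable_bound)
    have "integrable (lborel \<Otimes>\<^sub>M lborel) (\<lambda>(s, r). (indicator {-R..R} s :: real) * indicator {-R..R} r)"
      by (intro lborel_pair.Fubini_integrable) (auto simp: integrable_box abs_mult)
    then show "integrable (lborel \<Otimes>\<^sub>M lborel) (\<lambda>(s, r). C * (indicator {-R..R} r * indicator {-R..R} s))"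
      by (simp add: split_beta' mult.commute)
    have "insert i I = I" using i by auto
    then have "(\<lambda>s. x(i := s)) \<in> measurable lborel (PL I)"
      using x measurable_PL_upd[of "\<lambda>_. x" lborel I "\<lambda>s. s" i] by simp
    then show "(\<lambda>(s, r). D (x(i := s, j := r))) \<in> borel_measurable (lborel \<Otimes>\<^sub>M lborel)"
      by measurable
  qed (use bound2[OF x] CR(1) in \<open>auto simp: abs_mult\<close>)
  have int2c: "integrable (lborel \<Otimes>\<^sub>M lborel) (\<lambda>(s, r). indicator {c<..} s * D (x(i := s, j := r)))"
    if x: "x \<in> space (PL I)" for x c
  proof (rule Bochner_Integration.integrable_bound[OF int2[OF x]])
    show "(\<lambda>(s, r). indicator {c<..} s * D (x(i := s, j := r))) \<in> borel_measurable (lborel \<Otimes>\<^sub>M lborel)"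
      using borel_measurable_integrable[OF int2[OF x]] by (simp add: split_beta')
  qed (auto simp: indicator_def)
  have tw: "x(i := s, j := r) = x(j := r, i := s)" for x :: "'a \<Rightarrow> real" and s r
    using ij by (simp add: fun_upd_twist)
  have \<Psi>2: "\<Psi> (x(i := c, j := r)) = - (LINT s|lborel. indicator {c<..} s * D (x(i := s, j := r)))"
    if "x \<in> space (PL I)" for x c r
    using \<Psi>[OF space_PL_upd[OF that, of j r], of c] by (simp add: tw)
  have int\<Psi>: "integrable lborel (\<lambda>r. \<Psi> (x(i := c, j := r)))" if "x \<in> space (PL I)" for x c
    using lborel_pair.integrable_snd[OF int2c[OF that, of c]] by (simp add: \<Psi>2[OF that])
  show int\<Psi>': "integrable lborel (\<lambda>s. \<Psi> (x(j := s)))" if "x \<in> space (PL I)" for x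
    using int\<Psi>[OF that, of "x i"] by simp
  show "test_pair I i \<Psi>' D'"
    unfolding test_pair_def
  proof (intro conjI ballI allI)
    show "\<Psi>' \<in> borel_measurable (PL I)" "D' \<in> borel_measurable (PL I)"
      unfolding \<Psi>'_def D'_def by measurable
    show "0 \<le> \<Psi>' x" if "x \<in> space (PL I)" for x
      unfolding \<Psi>'_def using nonneg space_PL_upd[OF that] by (intro Bochner_Integration.integral_nonneg) auto
    \<comment> \<open>The factor \<open>2 * R\<close> is the length of the interval that contains
      the support in direction \<open>j\<close>.\<close>
    have "\<bar>D' x\<bar> \<le> (2 * R * C) * box01 I R x" if x: "x \<in> space (PL I)" for x
    proof -
      have "\<bar>D' x\<bar> \<le> (LINT r|lborel. \<bar>D (x(j := r))\<bar>)"
        unfolding D'_def by (rule integral_abs_bound)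
      also have "\<dots> \<le> (LINT r|lborel. C * (indicator {-R..R} r * box01 I R x))"
        using test_pair_fibre[OF T fin x] bound[OF x] integrable_box[of R]
        by (intro integral_mono integrable_abs integrable_mult_right integrable_mult_left)
      also have "\<dots> = (2 * R * C) * box01 I R x"
        using CR(2) by simp
      finally show ?thesis .
    qed
    then show "\<exists>C\<ge>0. \<exists>R\<ge>0. \<forall>x\<in>space (PL I). \<bar>D' x\<bar> \<le> C * box01 I R x"
      using CR(1,2) by (intro exI[of _ "2 * R * C"] exI[of _ R] conjI ballI) auto
    fix x assume x: "x \<in> space (PL I)"
    have "(LINT s|lborel. D' (x(i := s))) = (LINT s|lborel. LINT r|lborel. D (x(i := s, j := r)))"
      by (simp add: D'_def)
    also have "\<dots> = (LINT r|lborel. LINT s|lborel. D (x(i := s, j := r)))"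
      using lborel_pair.Fubini_integral[OF int2[OF x]] by simp
    also have "\<dots> = 0"
      using D0[OF space_PL_upd[OF x]] by (simp add: tw)
    finally show "(LINT s|lborel. D' (x(i := s))) = 0" .
    fix c
    have "\<Psi>' (x(i := c)) = - (LINT r|lborel. LINT s|lborel. indicator {c<..} s * D (x(i := s, j := r)))"
      by (simp add: \<Psi>'_def \<Psi>2[OF x])
    also have "\<dots> = - (LINT s|lborel. LINT r|lborel. indicator {c<..} s * D (x(i := s, j := r)))"
      using lborel_pair.Fubini_integral[OF int2c[OF x, of c]] by simp
    also have "\<dots> = - (LINT s|lborel. indicator {c<..} s * D' (x(i := s)))"
      by (simp add: D'_def)
    finally show "\<Psi>' (x(i := c)) = - (LINT s|lborel. indicator {c<..} s * D' (x(i := s)))" .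
  qed
qed

text \<open>\<open>S\<close> pushes \<open>h\<close> to \<open>f\<close>, and \<open>l i y\<close> is a substitute for the \<open>i\<close>-th diagonal derivative of the inverse of
  \<open>S\<close> at \<open>S y\<close>.\<close>

definition coupling :: "'i set \<Rightarrow> (('i \<Rightarrow> real) \<Rightarrow> real) \<Rightarrow> (('i \<Rightarrow> real) \<Rightarrow> real) \<Rightarrow>
    (('i \<Rightarrow> real) \<Rightarrow> 'i \<Rightarrow> real) \<Rightarrow> ('i \<Rightarrow> ('i \<Rightarrow> real) \<Rightarrow> real) \<Rightarrow> bool" where
  "coupling I f h S l \<longleftrightarrow>
     S \<in> measurable (PL I) (PL I) \<and>
     (\<forall>i\<in>I. l i \<in> borel_measurable (PL I)) \<and> (\<forall>i y. 0 \<le> l i y) \<and>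
     (\<forall>\<phi>\<in>borel_measurable (PL I).
        (\<integral>\<^sup>+y. \<phi> (S y) * ennreal (h y) \<partial>PL I) = (\<integral>\<^sup>+x. \<phi> x * ennreal (f x) \<partial>PL I)) \<and>
     (AE y in PL I. 0 < h y \<longrightarrow> 0 < f (S y) \<and> (\<Prod>i\<in>I. l i y) = f (S y) / h y) \<and>
     (\<forall>i\<in>I. \<forall>\<Psi> D. test_pair I i \<Psi> D \<longrightarrow> (AE x in PL I. f x = 0 \<longrightarrow> \<Psi> x = 0 \<and> D x = 0) \<longrightarrow>
        (LINT y|PL I. y i * (D (S y) / f (S y)) * h y) \<le> 0 \<and>
        (\<integral>\<^sup>+y. ennreal (\<Psi> (S y) / f (S y) * l i y * h y) \<partial>PL I)
          \<le> ennreal (- (LINT y|PL I. y i * (D (S y) / f (S y)) * h y)))"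

lemma couplingD:
  assumes "coupling I f h S l"
  shows "S \<in> measurable (PL I) (PL I)" "\<And>i. i \<in> I \<Longrightarrow> l i \<in> borel_measurable (PL I)" "\<And>i y. 0 \<le> l i y"
    "\<And>\<phi>. \<phi> \<in> borel_measurable (PL I) \<Longrightarrow>
        (\<integral>\<^sup>+y. \<phi> (S y) * ennreal (h y) \<partial>PL I) = (\<integral>\<^sup>+x. \<phi> x * ennreal (f x) \<partial>PL I)"
    "AE y in PL I. 0 < h y \<longrightarrow> 0 < f (S y) \<and> (\<Prod>i\<in>I. l i y) = f (S y) / h y"
    "\<And>i \<Psi> D. i \<in> I \<Longrightarrow> test_pair I i \<Psi> D \<Longrightarrow> (AE x in PL I. f x = 0 \<longrightarrow> \<Psi> x = 0 \<and> D x = 0) \<Longrightarrow>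
        (LINT y|PL I. y i * (D (S y) / f (S y)) * h y) \<le> 0 \<and>
        (\<integral>\<^sup>+y. ennreal (\<Psi> (S y) / f (S y) * l i y * h y) \<partial>PL I)
          \<le> ennreal (- (LINT y|PL I. y i * (D (S y) / f (S y)) * h y))"
  using assms unfolding coupling_def by blast+

lemma pushforward_AE:
  fixes f h :: "'a \<Rightarrow> real"
  assumes [measurable]: "S \<in> measurable M M" "h \<in> borel_measurable M"
    and push: "\<And>\<phi>. \<phi> \<in> borel_measurable M \<Longrightarrow>
      (\<integral>\<^sup>+y. \<phi> (S y) * ennreal (h y) \<partial>M) = (\<integral>\<^sup>+x. \<phi> x * ennreal (f x) \<partial>M)"
    and "AE x in M. P x"
  shows "AE y in M. 0 < h y \<longrightarrow> P (S y)"
proof -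
  obtain N where N: "{z \<in> space M. \<not> P z} \<subseteq> N" and [measurable]: "N \<in> sets M" and null: "emeasure M N = 0"
    using assms(4) by (rule AE_E)
  have "AE x in M. x \<notin> N" using null by (intro AE_not_in) (simp add: null_sets_def)
  then have "(\<integral>\<^sup>+x. indicator N x * ennreal (f x) \<partial>M) = (\<integral>\<^sup>+x. 0 \<partial>M)"
    by (intro nn_integral_cong_AE) auto
  then have "(\<integral>\<^sup>+y. indicator N (S y) * ennreal (h y) \<partial>M) = 0"
    using push[of "indicator N"] by simp
  then have "AE y in M. indicator N (S y) * ennreal (h y) = 0"
    by (subst (asm) nn_integral_0_iff_AE) simp_all
  then show ?thesis
    using AE_space
  proof eventually_elim
    case (elim y)
    have "S y \<in> space M" using elim(2) assms(1) by (rule measurable_space[rotated])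
    then show ?case using elim(1) N by (auto simp: indicator_def split: if_splits)
  qed
qed

text \<open>Moved to the target side, the quotient D / f is multiplied by \<open>f\<close>, so the
  integral is dominated by that of a multiple of \<open>D\<close>.\<close>

lemma pushforward_integrable:
  fixes b D f h :: "'a \<Rightarrow> real"
  assumes [measurable]: "S \<in> measurable M M" "h \<in> borel_measurable M" "f \<in> borel_measurable M" "b \<in> borel_measurable M"
    and push: "\<And>\<phi>. \<phi> \<in> borel_measurable M \<Longrightarrow>
      (\<integral>\<^sup>+y. \<phi> (S y) * ennreal (h y) \<partial>M) = (\<integral>\<^sup>+x. \<phi> x * ennreal (f x) \<partial>M)"
    and h0: "\<And>y. 0 \<le> h y" and f0: "\<And>x. 0 \<le> f x"
    and b: "AE y in M. 0 < h y \<longrightarrow> \<bar>b y\<bar> \<le> k" and D: "integrable M D"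
  shows "integrable M (\<lambda>y. b y * (D (S y) / f (S y)) * h y)"
proof (rule integrableI_bounded)
  have [measurable]: "D \<in> borel_measurable M" using D by auto
  show "(\<lambda>y. b y * (D (S y) / f (S y)) * h y) \<in> borel_measurable M" by measurable
  have "(\<integral>\<^sup>+y. ennreal (norm (b y * (D (S y) / f (S y)) * h y)) \<partial>M)
      \<le> (\<integral>\<^sup>+y. ennreal (\<bar>k\<bar> * \<bar>D (S y) / f (S y)\<bar>) * ennreal (h y) \<partial>M)"
  proof (rule nn_integral_mono_AE)
    show "AE y in M. ennreal (norm (b y * (D (S y) / f (S y)) * h y))
        \<le> ennreal (\<bar>k\<bar> * \<bar>D (S y) / f (S y)\<bar>) * ennreal (h y)"
      using b
    proof eventually_elim
      case (elim y)
      show ?case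
      proof (cases "h y = 0")
        case False
        then have "\<bar>b y\<bar> \<le> \<bar>k\<bar>" using elim h0[of y] by auto
        then have "\<bar>b y\<bar> * \<bar>D (S y) / f (S y)\<bar> * h y \<le> \<bar>k\<bar> * \<bar>D (S y) / f (S y)\<bar> * h y"
          using h0[of y] by (intro mult_right_mono) auto
        then show ?thesis using h0[of y]
          by (subst ennreal_mult[symmetric]) (auto simp: abs_mult intro!: ennreal_leI)
      qed simp
    qed
  qed
  also have "\<dots> = (\<integral>\<^sup>+x. ennreal (\<bar>k\<bar> * \<bar>D x / f x\<bar>) * ennreal (f x) \<partial>M)"
    by (rule push) measurable
  also have "\<dots> \<le> (\<integral>\<^sup>+x. ennreal (norm (k * D x)) \<partial>M)"
  proof (rule nn_integral_mono)
    fix x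
    show "ennreal (\<bar>k\<bar> * \<bar>D x / f x\<bar>) * ennreal (f x) \<le> ennreal (norm (k * D x))"
      using f0[of x] by (subst ennreal_mult[symmetric]) (auto simp: abs_mult intro!: ennreal_leI)
  qed
  also have "\<dots> < \<infinity>"
    using integrable_mult_right[OF D, of k] unfolding integrable_iff_bounded by blast
  finally show "(\<integral>\<^sup>+y. ennreal (norm (b y * (D (S y) / f (S y)) * h y)) \<partial>M) < \<infinity>" .
qed

text \<open>The marginal takes the value 0 on fibres that are not integrable; such fibres form a
  null set, and this is why the claims about fibres hold only almost everywhere.\<close>

lemma marginal_density:
  assumes fin: "finite I" "j \<notin> I" and [measurable]: "f \<in> borel_measurable (PL (insert j I))"
    and nonneg: "\<And>x. 0 \<le> f x" and one: "(\<integral>\<^sup>+x. ennreal (f x) \<partial>PL (insert j I)) = 1"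
  defines "f' \<equiv> \<lambda>x. LINT s|lborel. f (x(j := s))"
  shows "f' \<in> borel_measurable (PL I)" "\<And>x. 0 \<le> f' x"
    "AE x in PL I. integrable lborel (\<lambda>s. f (x(j := s)))"
    "(\<integral>\<^sup>+x. ennreal (f' x) \<partial>PL I) = 1"
    "AE x in PL I. f' x = 0 \<longrightarrow> (AE s in lborel. f (x(j := s)) = 0)"
proof -
  show [measurable]: "f' \<in> borel_measurable (PL I)" unfolding f'_def by measurable
  show "0 \<le> f' x" for x unfolding f'_def by (intro Bochner_Integration.integral_nonneg nonneg)
  have *: "(\<integral>\<^sup>+x. \<integral>\<^sup>+s. ennreal (f (x(j := s))) \<partial>lborel \<partial>PL I) = 1"
    using one by (subst (asm) PL.product_nn_integral_insert[OF fin]) auto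
  then have "AE x in PL I. (\<integral>\<^sup>+s. ennreal (f (x(j := s))) \<partial>lborel) \<noteq> \<infinity>"
    by (intro nn_integral_PInf_AE) auto
  then show int: "AE x in PL I. integrable lborel (\<lambda>s. f (x(j := s)))"
    using AE_space
  proof eventually_elim
    case (elim x)
    note [measurable] = elim(2)
    show ?case using elim(1) nonneg by (intro integrableI_bounded) (auto simp: top.not_eq_extremum)
  qed
  then have "AE x in PL I. (\<integral>\<^sup>+s. ennreal (f (x(j := s))) \<partial>lborel) = ennreal (f' x)"
    unfolding f'_def by eventually_elim (intro nn_integral_eq_integral, auto simp: nonneg)
  with * show "(\<integral>\<^sup>+x. ennreal (f' x) \<partial>PL I) = 1"
    by (subst (asm) nn_integral_cong_AE) auto
  show "AE x in PL I. f' x = 0 \<longrightarrow> (AE s in lborel. f (x(j := s)) = 0)"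
    using int by eventually_elim
      (auto simp: f'_def integral_nonneg_eq_0_iff_AE nonneg)
qed

section \<open>Extending a coupling by one coordinate\<close>

context
  fixes I :: "'i set" and j :: 'i and f h :: "('i \<Rightarrow> real) \<Rightarrow> real" and k :: real
    and S' :: "('i \<Rightarrow> real) \<Rightarrow> 'i \<Rightarrow> real" and l' :: "'i \<Rightarrow> ('i \<Rightarrow> real) \<Rightarrow> real"
    and f' h' :: "('i \<Rightarrow> real) \<Rightarrow> real"
  assumes fin: "finite I" "j \<notin> I"
    and f [measurable]: "f \<in> borel_measurable (PL (insert j I))" and f0: "\<And>x. 0 \<le> f x"
    and f1: "(\<integral>\<^sup>+x. ennreal (f x) \<partial>PL (insert j I)) = 1"
    and h [measurable]: "h \<in> borel_measurable (PL (insert j I))" and h0: "\<And>x. 0 \<le> h x"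
    and h1: "(\<integral>\<^sup>+x. ennreal (h x) \<partial>PL (insert j I)) = 1"
    and k: "0 \<le> k" "AE y in PL (insert j I). 0 < h y \<longrightarrow> (\<forall>i\<in>insert j I. \<bar>y i\<bar> \<le> k)"
  defines "f' \<equiv> \<lambda>x. LINT s|lborel. f (x(j := s))" and "h' \<equiv> \<lambda>x. LINT s|lborel. h (x(j := s))"
  assumes C: "coupling I f' h' S' l'"
begin

private abbreviation "PJ \<equiv> PL (insert j I)"
private abbreviation "p y \<equiv> \<lambda>s. f ((S' y)(j := s))"
private abbreviation "q y \<equiv> \<lambda>t. h (y(j := t))"
private abbreviation "\<sigma> y \<equiv> rearrange (p y) (q y)"

definition "step_S z = (let y = restrict z I in (S' y)(j := \<sigma> y (z j)))"
text \<open>In direction \<open>j\<close> this is the conditional density of \<open>f\<close> at the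
  image divided by that of \<open>h\<close> at the point, which is the derivative of the inverse of
  the one-dimensional rearrangement. The other factors see only the earlier coordinates because the
  map is triangular.\<close>

definition "step_l i z = (let y = restrict z I in
   if i = j then f (step_S z) / f' (S' y) * (h' y / h z) else l' i y)"

lemma marginal_eq: "(LINT s|lborel. f (x(j := s))) = f' x" "(LINT s|lborel. h (x(j := s))) = h' x"
  by (simp_all add: f'_def h'_def)

lemmas step_mf = marginal_density[OF fin f f0 f1, unfolded marginal_eq]
lemmas step_mh = marginal_density[OF fin h h0 h1, unfolded marginal_eq]
lemmas step_C = couplingD[OF C]

lemma step_S_upd: "y \<in> space (PL I) \<Longrightarrow> step_S (y(j := t)) = (S' y)(j := \<sigma> y t)"
  by (simp add: step_S_def restrict_PL_upd[OF _ fin(2)])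

lemma step_S_measurable: "step_S \<in> measurable PJ PJ"
proof -
  note [measurable] = step_C(1)
  have r [measurable]: "(\<lambda>z. restrict z I) \<in> measurable PJ (PL I)"
    by (intro measurable_restrict_subset) auto
  have [measurable]: "(\<lambda>z. z j) \<in> borel_measurable PJ"
    using measurable_component_singleton[of j "insert j I" "\<lambda>_. lborel :: real measure"] by simp
  have if_eq: "indicator {..x} s = (if s \<le> x then 1 else 0 :: real)" for x s :: real by auto
  have [measurable]: "(\<lambda>z. nprim (q (restrict z I)) (z j)) \<in> borel_measurable PJ"
    unfolding nprim_def if_eq by measurable
  have "(\<lambda>z. \<sigma> (restrict z I) (z j)) \<in> borel_measurable PJ"
    unfolding rearrange_def
    by (rule measurable_quantile_nprim[where p = "\<lambda>z. p (restrict z I)"]) (measurable, rule f0)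
  then show ?thesis unfolding step_S_def Let_def by measurable
qed

text \<open>Sorts the fibres once and for all: either the fibre of \<open>h\<close> is null, or the
  two fibres satisfy everything that the one-dimensional lemmas ask for.\<close>

lemma step_good:
  "AE y in PL I. (h' y = 0 \<and> (AE t in lborel. q y t = 0)) \<or>
     (0 < h' y \<and> 0 < f' (S' y) \<and> integrable lborel (p y) \<and> integrable lborel (q y) \<and>
      0 < (LINT s|lborel. p y s) \<and> 0 < (LINT t|lborel. q y t) \<and>
      (\<Prod>i\<in>I. l' i y) = f' (S' y) / h' y \<and>
      (\<forall>i\<in>I. \<bar>y i\<bar> \<le> k) \<and> (AE t in lborel. 0 < q y t \<longrightarrow> \<bar>t\<bar> \<le> k))"
  using step_mh(3,5) step_C(5) AE_PL_insert[OF fin k(2)] 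
proof eventually_elim
  case (elim y)
  show ?case
  proof (cases "h' y = 0")
    case True
    then show ?thesis using elim by simp
  next
    case False
    then have hy: "0 < h' y" using step_mh(2)[of y] by simp
    then have fy: "0 < f' (S' y)" "(\<Prod>i\<in>I. l' i y) = f' (S' y) / h' y" using elim by auto
    \<comment> \<open>The integral of a non-integrable function is 0 by convention, so a positive
      integral implies integrability.\<close>
    have "integrable lborel (p y)"
      using fy(1) not_integrable_integral_eq unfolding f'_def by force
    moreover have "\<bar>y i\<bar> \<le> k" if "i \<in> I" for i
    proof (rule ccontr)
      assume *: "\<not> \<bar>y i\<bar> \<le> k"
      have "AE t in lborel. q y t = 0"
        using elim(4)
      proof eventually_elim
        case (elim t)
        have "i \<noteq> j" using that fin by auto
        then show ?case using elim * that h0[of "y(j := t)"] by force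
      qed
      then have "h' y = 0" unfolding h'_def by (rule integral_eq_zero_AE)
      then show False using hy by simp
    qed
    moreover have "AE t in lborel. 0 < q y t \<longrightarrow> \<bar>t\<bar> \<le> k"
      using elim(4) by eventually_elim auto
    ultimately show ?thesis using hy fy elim(1) marginal_eq by simp
  qed
qed

text \<open>The auxiliary \<open>\<phi>'\<close> is the conditional mean of \<open>\<phi>\<close>
  over a target fibre. The rearrangement of fibres turns the inner integral into this mean at
  \<open>S' y\<close> times \<open>h' y\<close>, and the old coupling pushes \<open>\<phi>'\<close>
  forward.\<close>

lemma step_push:
  assumes [measurable]: "\<phi> \<in> borel_measurable PJ"
  shows "(\<integral>\<^sup>+y. \<phi> (step_S y) * ennreal (h y) \<partial>PJ) = (\<integral>\<^sup>+x. \<phi> x * ennreal (f x) \<partial>PJ)"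
proof -
  note [measurable] = step_C(1) step_S_measurable step_mf(1) step_mh(1)
  define \<phi>' where "\<phi>' x = (\<integral>\<^sup>+s. \<phi> (x(j := s)) * ennreal (f (x(j := s))) \<partial>lborel) / ennreal (f' x)" for x
  have [measurable]: "\<phi>' \<in> borel_measurable (PL I)" unfolding \<phi>'_def by measurable
  have "(\<integral>\<^sup>+y. \<phi> (step_S y) * ennreal (h y) \<partial>PJ)
      = (\<integral>\<^sup>+y. \<integral>\<^sup>+t. \<phi> (step_S (y(j := t))) * ennreal (q y t) \<partial>lborel \<partial>PL I)"
    by (rule PL.product_nn_integral_insert[OF fin]) measurable
  also have "\<dots> = (\<integral>\<^sup>+y. \<phi>' (S' y) * ennreal (h' y) \<partial>PL I)"
  proof (rule nn_integral_cong_AE)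
    show "AE y in PL I. (\<integral>\<^sup>+t. \<phi> (step_S (y(j := t))) * ennreal (q y t) \<partial>lborel) = \<phi>' (S' y) * ennreal (h' y)"
      using step_good AE_space
    proof eventually_elim
      case (elim y)
      note y [measurable] = elim(2)
      have S'y [measurable]: "S' y \<in> space (PL I)" using measurable_space[OF step_C(1) y] .
      from elim(1) show ?case
      proof (elim disjE conjE)
        assume *: "h' y = 0" "AE t in lborel. q y t = 0"
        have "(\<integral>\<^sup>+t. \<phi> (step_S (y(j := t))) * ennreal (q y t) \<partial>lborel) = (\<integral>\<^sup>+t. 0 \<partial>(lborel :: real measure))"
          by (rule nn_integral_cong_AE) (use *(2) in \<open>eventually_elim, simp\<close>)
        then show ?thesis using *(1) by simp
      next
        assume pos: "0 < h' y" "0 < f' (S' y)"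
          and int: "integrable lborel (p y)" "0 < (LINT s|lborel. p y s)" "integrable lborel (q y)" "0 < (LINT t|lborel. q y t)"
        have "(\<integral>\<^sup>+t. \<phi> (step_S (y(j := t))) * ennreal (q y t) \<partial>lborel)
           = ennreal (h' y / f' (S' y)) * (\<integral>\<^sup>+s. \<phi> ((S' y)(j := s)) * ennreal (p y s) \<partial>lborel)"
          unfolding step_S_upd[OF y] f'_def h'_def
          by (rule nn_integral_rearrange[OF int(1) f0 int(2) int(3) h0 int(4), where \<rho> = "\<lambda>s. \<phi> ((S' y)(j := s))"]) measurable
        also have "\<dots> = \<phi>' (S' y) * ennreal (h' y)"
          using pos by (simp add: \<phi>'_def divide_ennreal_def divide_ennreal[symmetric] mult_ac)
        finally show ?thesis .
      qed
    qed
  qed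
  also have "\<dots> = (\<integral>\<^sup>+x. \<phi>' x * ennreal (f' x) \<partial>PL I)"
    by (rule step_C(4)) measurable
  also have "\<dots> = (\<integral>\<^sup>+x. \<integral>\<^sup>+s. \<phi> (x(j := s)) * ennreal (f (x(j := s))) \<partial>lborel \<partial>PL I)"
  proof (rule nn_integral_cong_AE)
    show "AE x in PL I. \<phi>' x * ennreal (f' x) = (\<integral>\<^sup>+s. \<phi> (x(j := s)) * ennreal (f (x(j := s))) \<partial>lborel)"
      using step_mf(5)
    proof eventually_elim
      case (elim x)
      show ?case
      proof (cases "f' x = 0")
        case True
        have "(\<integral>\<^sup>+s. \<phi> (x(j := s)) * ennreal (f (x(j := s))) \<partial>lborel) = (\<integral>\<^sup>+s. 0 \<partial>(lborel :: real measure))"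
          by (rule nn_integral_cong_AE) (use elim[rule_format, OF True] in \<open>eventually_elim, simp\<close>)
        then show ?thesis using True by simp
      next
        case False
        then have "0 < f' x" using step_mf(2)[of x] by simp
        then have "inverse (ennreal (f' x)) * ennreal (f' x) = 1"
          by (simp add: inverse_ennreal ennreal_mult''[symmetric])
        then show ?thesis
          by (simp add: \<phi>'_def divide_ennreal_def mult.assoc)
      qed
    qed
  qed
  also have "\<dots> = (\<integral>\<^sup>+x. \<phi> x * ennreal (f x) \<partial>PJ)"
    by (rule PL.product_nn_integral_insert[OF fin, symmetric]) measurable
  finally show ?thesis .
qed


lemma step_l_measurable:
  assumes "i \<in> insert j I" shows "step_l i \<in> borel_measurable PJ"
proof -
  note [measurable] = step_C(1) step_S_measurable step_mf(1) step_mh(1) step_C(2)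
  have [measurable]: "(\<lambda>z. restrict z I) \<in> measurable PJ (PL I)"
    by (intro measurable_restrict_subset) auto
  show ?thesis
  proof (cases "i = j")
    case True
    then show ?thesis unfolding step_l_def[abs_def] Let_def by simp
  next
    case False
    with assms have [simp]: "i \<in> I" by simp
    show ?thesis using False unfolding step_l_def[abs_def] Let_def by simp
  qed
qed

lemma step_l_nonneg: "0 \<le> step_l i z"
  using step_C(3) step_mf(2) step_mh(2) f0 h0 by (simp add: step_l_def Let_def)

text \<open>The product telescopes: the old factors give \<open>f' (S' y) / h' y\<close>, which the
  new factor replaces by the quotient of the joint densities. The density at the image is positive
  because the rearrangement sends no mass into the zeros of the target fibre.\<close>

lemma step_det:
  "AE z in PJ. 0 < h z \<longrightarrow> 0 < f (step_S z) \<and> (\<Prod>i\<in>insert j I. step_l i z) = f (step_S z) / h z"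
proof (rule AE_PL_insertI[OF fin])
  note [measurable] = step_S_measurable
  define L where "L z = (\<Prod>i\<in>insert j I. step_l i z)" for z
  have [measurable]: "L \<in> borel_measurable PJ"
    unfolding L_def by (intro borel_measurable_prod step_l_measurable)
  define R where "R z = f (step_S z) / h z" for z
  have [measurable]: "R \<in> borel_measurable PJ"
    unfolding R_def by measurable
  have [measurable]: "Measurable.pred PJ (\<lambda>z. L z = R z)"
    unfolding pred_def by (rule borel_measurable_eq) measurable
  have "Measurable.pred PJ
     (\<lambda>z. 0 < h z \<longrightarrow> 0 < f (step_S z) \<and> L z = R z)"
    by measurable
  then show "Measurable.pred PJ
     (\<lambda>z. 0 < h z \<longrightarrow> 0 < f (step_S z) \<and> (\<Prod>i\<in>insert j I. step_l i z) = f (step_S z) / h z)"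
    unfolding L_def R_def .
  show "AE y in PL I. AE t in lborel. 0 < q y t \<longrightarrow> 0 < f (step_S (y(j := t))) \<and>
     (\<Prod>i\<in>insert j I. step_l i (y(j := t))) = f (step_S (y(j := t))) / q y t"
    using step_good AE_space
  proof eventually_elim
    case (elim y)
    note y [measurable] = elim(2)
    have S'y [measurable]: "S' y \<in> space (PL I)" using measurable_space[OF step_C(1) y] .
    from elim(1) show ?case
    proof (elim disjE conjE)
      assume "AE t in lborel. q y t = 0"
      then show ?thesis by eventually_elim simp
    next
      assume pos: "0 < h' y" "0 < f' (S' y)" and prod: "(\<Prod>i\<in>I. l' i y) = f' (S' y) / h' y"
        and int: "integrable lborel (p y)" "0 < (LINT s|lborel. p y s)" "integrable lborel (q y)" "0 < (LINT t|lborel. q y t)"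
      have p_meas [measurable]: "p y \<in> borel_measurable borel" "q y \<in> borel_measurable borel"
        using int by auto
      have [measurable]: "\<sigma> y \<in> borel_measurable borel"
        by (rule borel_measurable_rearrange[OF int(1) f0 int(2) int(3) h0 int(4)])
      have "(\<integral>\<^sup>+t. indicator {s. p y s = 0} (\<sigma> y t) * ennreal (q y t) \<partial>lborel) =
          ennreal ((LINT t|lborel. q y t) / (LINT s|lborel. p y s)) *
          (\<integral>\<^sup>+s. indicator {s. p y s = 0} s * ennreal (p y s) \<partial>lborel)"
        by (rule nn_integral_rearrange[OF int(1) f0 int(2) int(3) h0 int(4)]) measurable
      also have "(\<integral>\<^sup>+s. indicator {s. p y s = 0} s * ennreal (p y s) \<partial>lborel) = (\<integral>\<^sup>+s. 0 \<partial>(lborel :: real measure))"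
        by (rule nn_integral_cong) (auto simp: indicator_def)
      finally have "(\<integral>\<^sup>+t. indicator {s. p y s = 0} (\<sigma> y t) * ennreal (q y t) \<partial>lborel) = 0"
        by (simp only: nn_integral_const mult_zero_left mult_zero_right)
      then have "AE t in lborel. indicator {s. p y s = 0} (\<sigma> y t) * ennreal (q y t) = 0"
        by (subst (asm) nn_integral_0_iff_AE) measurable
      then show ?thesis
      proof eventually_elim
        case (elim t)
        show ?case
        proof
          assume q: "0 < q y t"
          then have p: "0 < p y (\<sigma> y t)"
            using elim f0[of "(S' y)(j := \<sigma> y t)"] by (auto simp: indicator_def less_le split: if_splits)
          have "(\<Prod>i\<in>I. step_l i (y(j := t))) = (\<Prod>i\<in>I. l' i y)"
            using fin by (intro prod.cong) (auto simp: step_l_def restrict_PL_upd[OF y fin(2)])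
          then show "0 < f (step_S (y(j := t))) \<and> (\<Prod>i\<in>insert j I. step_l i (y(j := t))) = f (step_S (y(j := t))) / q y t"
            using fin p q pos by (simp add: step_l_def restrict_PL_upd[OF y fin(2)] step_S_upd[OF y] prod)
        qed
      qed
    qed
  qed
qed

context
  fixes i :: 'i and \<Psi> D :: "('i \<Rightarrow> real) \<Rightarrow> real"
  assumes T: "test_pair (insert j I) i \<Psi> D"
    and zero: "AE x in PJ. f x = 0 \<longrightarrow> \<Psi> x = 0 \<and> D x = 0"
    and i: "i \<in> insert j I"
begin

private abbreviation "incr z \<equiv> \<Psi> (step_S z) / f (step_S z) * step_l i z * h z"
private abbreviation "flux z \<equiv> z i * (D (step_S z) / f (step_S z)) * h z"

lemma step_test_meas: "\<Psi> \<in> borel_measurable PJ" "D \<in> borel_measurable PJ"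
  and step_test_nonneg: "\<And>x. x \<in> space PJ \<Longrightarrow> 0 \<le> \<Psi> x"
  using T unfolding test_pair_def by blast+

text \<open>The hypothesis excludes a null set of target fibres, but is used in the fibre over
  \<open>S' y\<close>; the push-forward makes the preimage of a null set negligible where
  \<open>h'\<close> is positive.\<close>

lemma step_test_zero:
  "AE y in PL I. 0 < h' y \<longrightarrow> (AE s in lborel. p y s = 0 \<longrightarrow> \<Psi> ((S' y)(j := s)) = 0 \<and> D ((S' y)(j := s)) = 0)"
  by (rule pushforward_AE[OF step_C(1) step_mh(1) step_C(4) AE_PL_insert[OF fin zero]])

lemma step_flux_integrable:
  "integrable PJ (\<lambda>z. flux z)"
proof (rule pushforward_integrable[OF step_S_measurable h f _ step_push h0 f0])
  show "(\<lambda>z. z i) \<in> borel_measurable PJ"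
    using measurable_component_singleton[of i "insert j I" "\<lambda>_. lborel :: real measure"] i by simp
  show "AE z in PJ. 0 < h z \<longrightarrow> \<bar>z i\<bar> \<le> k"
    using k(2) i by (auto elim: eventually_mono)
  show "integrable PJ D"
    using test_pair_integrable[OF T] fin by simp
qed

text \<open>The coordinate \<open>z i\<close> and the factor \<open>step_l i\<close> do not involve
  the new coordinate. Integrating over the fibre therefore replaces \<Psi> and \<open>D\<close> by
  their marginals at \<open>S' y\<close>, with equality on both sides, and leaves the estimate of
  the old coupling.\<close>

lemma step_by_parts_old:
  assumes "i \<noteq> j"
  shows "(LINT z|PJ. flux z) \<le> 0 \<and>
    (\<integral>\<^sup>+z. ennreal (incr z) \<partial>PJ)
    \<le> ennreal (- (LINT z|PJ. flux z))"
proof -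
  have iI: "i \<in> I" using assms i by simp
  note [measurable] = step_C(1) step_C(2)[OF iI] step_S_measurable step_l_measurable[OF i] step_mf(1) step_mh(1) step_test_meas
  define \<Psi>' where "\<Psi>' x = (LINT s|lborel. \<Psi> (x(j := s)))" for x
  define D' where "D' x = (LINT s|lborel. D (x(j := s)))" for x
  have T': "test_pair I i \<Psi>' D'" and int\<Psi>: "\<And>x. x \<in> space (PL I) \<Longrightarrow> integrable lborel (\<lambda>s. \<Psi> (x(j := s)))"
    using test_pair_marginal[OF T fin iI] by (simp_all add: \<Psi>'_def[abs_def] D'_def[abs_def])
  have [measurable]: "\<Psi>' \<in> borel_measurable (PL I)" "D' \<in> borel_measurable (PL I)"
    and \<Psi>'0: "\<And>x. x \<in> space (PL I) \<Longrightarrow> 0 \<le> \<Psi>' x"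
    using T' unfolding test_pair_def by blast+
  have zero': "AE x in PL I. f' x = 0 \<longrightarrow> \<Psi>' x = 0 \<and> D' x = 0"
    using step_mf(5) AE_PL_insert[OF fin zero]
  proof eventually_elim
    case (elim x)
    show ?case
    proof
      assume "f' x = 0"
      with elim(1) have "AE s in lborel. f (x(j := s)) = 0" by simp
      with elim(2) have "AE s in lborel. \<Psi> (x(j := s)) = 0 \<and> D (x(j := s)) = 0"
        by eventually_elim simp
      then show "\<Psi>' x = 0 \<and> D' x = 0"
        unfolding \<Psi>'_def D'_def by (intro conjI integral_eq_zero_AE) (auto elim: eventually_mono)
    qed
  qed
  have "(\<integral>\<^sup>+z. ennreal (incr z) \<partial>PJ)
      = (\<integral>\<^sup>+y. \<integral>\<^sup>+t. ennreal (incr (y(j := t))) \<partial>lborel \<partial>PL I)"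
    by (rule PL.product_nn_integral_insert[OF fin]) measurable
  also have "\<dots> = (\<integral>\<^sup>+y. ennreal (\<Psi>' (S' y) / f' (S' y) * l' i y * h' y) \<partial>PL I)"
  proof (rule nn_integral_cong_AE)
    show "AE y in PL I. (\<integral>\<^sup>+t. ennreal (incr (y(j := t))) \<partial>lborel)
        = ennreal (\<Psi>' (S' y) / f' (S' y) * l' i y * h' y)"
      using step_good AE_space step_test_zero
    proof eventually_elim
      case (elim y)
      note y [measurable] = elim(2)
      have S'y [measurable]: "S' y \<in> space (PL I)" using measurable_space[OF step_C(1) y] .
      have l: "step_l i (y(j := t)) = l' i y" for t
        using assms by (simp add: step_l_def restrict_PL_upd[OF y fin(2)])
      from elim(1) show ?case
      proof (elim disjE conjE)
        assume *: "h' y = 0" "AE t in lborel. q y t = 0"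
        have "(\<integral>\<^sup>+t. ennreal (incr (y(j := t))) \<partial>lborel)
           = (\<integral>\<^sup>+t. 0 \<partial>(lborel :: real measure))"
          by (rule nn_integral_cong_AE) (use *(2) in \<open>eventually_elim, simp\<close>)
        then show ?thesis using *(1) by simp
      next
        assume pos: "0 < h' y" "0 < f' (S' y)"
          and int: "integrable lborel (p y)" "0 < (LINT s|lborel. p y s)" "integrable lborel (q y)" "0 < (LINT t|lborel. q y t)"
        have \<Psi>pos: "0 \<le> \<Psi> ((S' y)(j := s))" for s using step_test_nonneg space_PL_upd[OF S'y] by blast
        have "(\<integral>\<^sup>+t. ennreal (incr (y(j := t))) \<partial>lborel)
           = (\<integral>\<^sup>+t. ennreal (l' i y * (\<Psi> ((S' y)(j := \<sigma> y t)) / p y (\<sigma> y t))) * ennreal (q y t) \<partial>lborel)"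
          using \<Psi>pos f0 h0 step_C(3)
          by (intro nn_integral_cong) (simp add: l step_S_upd[OF y] ennreal_mult'' [symmetric] mult_ac)
        also have "\<dots> = ennreal (h' y / f' (S' y)) *
            (\<integral>\<^sup>+s. ennreal (l' i y * (\<Psi> ((S' y)(j := s)) / p y s)) * ennreal (p y s) \<partial>lborel)"
          unfolding f'_def h'_def
          by (rule nn_integral_rearrange[OF int(1) f0 int(2) int(3) h0 int(4),
                where \<rho> = "\<lambda>s. ennreal (l' i y * (\<Psi> ((S' y)(j := s)) / p y s))"]) measurable
        also have "(\<integral>\<^sup>+s. ennreal (l' i y * (\<Psi> ((S' y)(j := s)) / p y s)) * ennreal (p y s) \<partial>lborel)
            = (\<integral>\<^sup>+s. ennreal (l' i y * \<Psi> ((S' y)(j := s))) \<partial>lborel)"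
        proof (rule nn_integral_cong_AE)
          show "AE s in lborel. ennreal (l' i y * (\<Psi> ((S' y)(j := s)) / p y s)) * ennreal (p y s) = ennreal (l' i y * \<Psi> ((S' y)(j := s)))"
            using elim(3)[rule_format, OF pos(1)]
          proof eventually_elim
            case (elim s)
            then show ?case using \<Psi>pos[of s] f0[of "(S' y)(j := s)"] step_C(3)[of i y]
              by (cases "p y s = 0") (auto simp: ennreal_mult'' [symmetric])
          qed
        qed
        also have "\<dots> = ennreal (l' i y * \<Psi>' (S' y))"
          unfolding \<Psi>'_def using int\<Psi>[OF S'y] \<Psi>pos step_C(3)[of i y]
          by (subst nn_integral_eq_integral) auto
        finally show ?thesis
          unfolding ennreal_mult''[OF mult_nonneg_nonneg[OF step_C(3) \<Psi>'0[OF S'y]], symmetric]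
          by (simp only: divide_inverse mult_ac)
      qed
    qed
  qed
  finally have le: "(\<integral>\<^sup>+z. ennreal (incr z) \<partial>PJ)
      \<le> ennreal (- (LINT y|PL I. y i * (D' (S' y) / f' (S' y)) * h' y))"
    using step_C(6)[OF iI T' zero'] by simp
  have "(LINT y|PL I. y i * (D' (S' y) / f' (S' y)) * h' y)
      = (LINT y|PL I. LINT t|lborel. flux (y(j := t)))"
  proof (rule integral_cong_AE)
    have [measurable]: "(\<lambda>z. z i) \<in> borel_measurable (PL I)"
      using measurable_component_singleton[of i I "\<lambda>_. lborel :: real measure"] iI by simp
    show "(\<lambda>y. y i * (D' (S' y) / f' (S' y)) * h' y) \<in> borel_measurable (PL I)" by measurable
    have [measurable]: "(\<lambda>z. z i) \<in> borel_measurable PJ"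
      using measurable_component_singleton[of i "insert j I" "\<lambda>_. lborel :: real measure"] i by simp
    show "(\<lambda>y. LINT t|lborel. flux (y(j := t))) \<in> borel_measurable (PL I)"
      by measurable
    show "AE y in PL I. y i * (D' (S' y) / f' (S' y)) * h' y =
       (LINT t|lborel. flux (y(j := t)))"
      using step_good AE_space step_test_zero
    proof eventually_elim
      case (elim y)
      note y [measurable] = elim(2)
      have S'y [measurable]: "S' y \<in> space (PL I)" using measurable_space[OF step_C(1) y] .
      from elim(1) show ?case
      proof (elim disjE conjE)
        assume *: "h' y = 0" "AE t in lborel. q y t = 0"
        have "(LINT t|lborel. flux (y(j := t))) = 0"
          by (rule integral_eq_zero_AE) (use *(2) in \<open>eventually_elim, simp\<close>)
        then show ?thesis using *(1) by simp
      next
        assume pos: "0 < h' y" "0 < f' (S' y)"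
          and int: "integrable lborel (p y)" "0 < (LINT s|lborel. p y s)" "integrable lborel (q y)" "0 < (LINT t|lborel. q y t)"
        have "(LINT t|lborel. flux (y(j := t)))
            = y i * (LINT t|lborel. D ((S' y)(j := \<sigma> y t)) / p y (\<sigma> y t) * q y t)"
          unfolding step_S_upd[OF y] mult.assoc Bochner_Integration.integral_mult_right_zero[symmetric]
          by (simp only: fun_upd_other[OF assms])
        also have "(LINT t|lborel. D ((S' y)(j := \<sigma> y t)) / p y (\<sigma> y t) * q y t)
            = h' y / f' (S' y) * (LINT s|lborel. D ((S' y)(j := s)) / p y s * p y s)"
          unfolding f'_def h'_def
          by (rule integral_rearrange(2)[OF int(1) f0 int(2) int(3) h0 int(4),
                where r = "\<lambda>s. D ((S' y)(j := s)) / p y s"]) measurable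
        also have "(LINT s|lborel. D ((S' y)(j := s)) / p y s * p y s) = D' (S' y)"
          unfolding D'_def
        proof (rule integral_cong_AE)
          show "AE s in lborel. D ((S' y)(j := s)) / p y s * p y s = D ((S' y)(j := s))"
            using elim(3)[rule_format, OF pos(1)] by eventually_elim auto
        qed measurable
        finally show ?thesis by (simp only: divide_inverse mult_ac)
      qed
    qed
  qed
  also have "\<dots> = (LINT z|PJ. flux z)"
    by (rule PL.product_integral_insert[OF fin step_flux_integrable, symmetric])
  finally show ?thesis using le step_C(6)[OF iI T' zero'] by simp
qed

text \<open>Direction \<open>j\<close> runs along the fibres, so \<open>rearrange_by_parts\<close>
  applies in each of them, with the marginals \<open>f' (S' y)\<close> and \<open>h' y\<close> as
  the two masses.\<close>

lemma step_by_parts_new: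
  assumes ij: "i = j"
  shows "(LINT z|PJ. flux z) \<le> 0 \<and>
    (\<integral>\<^sup>+z. ennreal (incr z) \<partial>PJ)
    \<le> ennreal (- (LINT z|PJ. flux z))"
proof -
  note [measurable] = step_C(1) step_S_measurable step_l_measurable[OF i] step_mf(1) step_mh(1) step_test_meas
  have [measurable]: "(\<lambda>z. z i) \<in> borel_measurable PJ"
    using measurable_component_singleton[of i "insert j I" "\<lambda>_. lborel :: real measure"] i by simp
  have intF: "integrable (PL I \<Otimes>\<^sub>M lborel) (\<lambda>(y, t). flux (y(j := t)))"
  proof (rule integrableI_bounded)
    show Fm: "(\<lambda>(y, t). flux (y(j := t))) \<in> borel_measurable (PL I \<Otimes>\<^sub>M lborel)" by measurable
    have "(\<lambda>x. ennreal (norm (case x of (y, t) \<Rightarrow> flux (y(j := t))))) \<in> borel_measurable (PL I \<Otimes>\<^sub>M lborel)"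
      using Fm by measurable
    from lborel.nn_integral_fst[OF this, symmetric]
    have "(\<integral>\<^sup>+x. ennreal (norm (case x of (y, t) \<Rightarrow> flux (y(j := t)))) \<partial>(PL I \<Otimes>\<^sub>M lborel))
       = (\<integral>\<^sup>+y. \<integral>\<^sup>+t. ennreal (norm (flux (y(j := t)))) \<partial>lborel \<partial>PL I)"
      by (simp only: prod.case)
    also have "\<dots> = (\<integral>\<^sup>+z. ennreal (norm (flux z)) \<partial>PJ)"
      by (rule PL.product_nn_integral_insert[OF fin, symmetric]) measurable
    also have "\<dots> < \<infinity>"
      using step_flux_integrable unfolding integrable_iff_bounded by blast
    finally show "(\<integral>\<^sup>+x. ennreal (norm (case x of (y, t) \<Rightarrow> flux (y(j := t)))) \<partial>(PL I \<Otimes>\<^sub>M lborel)) < \<infinity>" .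
  qed
  interpret pair_sigma_finite "PL I" "lborel :: real measure"
    by (intro pair_sigma_finite.intro PL.sigma_finite fin lborel.sigma_finite_measure_axioms)
  have int1: "integrable (PL I) (\<lambda>y. LINT t|lborel. flux (y(j := t)))"
    using integrable_fst[of "\<lambda>y t. flux (y(j := t))"] intF by simp
  have key: "AE y in PL I. (LINT t|lborel. flux (y(j := t))) \<le> 0 \<and>
     (\<integral>\<^sup>+t. ennreal (incr (y(j := t))) \<partial>lborel)
       \<le> ennreal (- (LINT t|lborel. flux (y(j := t))))"
    using step_good AE_space step_test_zero
  proof eventually_elim
    case (elim y)
    note y [measurable] = elim(2)
    have S'y [measurable]: "S' y \<in> space (PL I)" using measurable_space[OF step_C(1) y] .
    have \<Psi>pos: "0 \<le> \<Psi> ((S' y)(j := s))" for s using step_test_nonneg space_PL_upd[OF S'y] by blast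
    from elim(1) show ?case
    proof (elim disjE conjE)
      assume *: "h' y = 0" "AE t in lborel. q y t = 0"
      have 1: "(\<integral>\<^sup>+t. ennreal (incr (y(j := t))) \<partial>lborel)
         = (\<integral>\<^sup>+t. 0 \<partial>(lborel :: real measure))"
        by (rule nn_integral_cong_AE) (use *(2) in \<open>eventually_elim, simp\<close>)
      have 2: "(LINT t|lborel. flux (y(j := t))) = 0"
        by (rule integral_eq_zero_AE) (use *(2) in \<open>eventually_elim, simp\<close>)
      show ?thesis unfolding 1 2 by simp
    next
      assume pos: "0 < h' y" "0 < f' (S' y)"
        and int: "integrable lborel (p y)" "0 < (LINT s|lborel. p y s)" "integrable lborel (q y)" "0 < (LINT t|lborel. q y t)"
        and kt: "AE t in lborel. 0 < q y t \<longrightarrow> \<bar>t\<bar> \<le> k"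
      note pq = int(1) f0 int(2) int(3) h0 int(4)
      have [measurable]: "\<sigma> y \<in> borel_measurable borel" by (rule borel_measurable_rearrange[OF pq])
      define x where "x = (S' y)(j := 0)"
      have x: "x \<in> space PJ" unfolding x_def by (rule space_PL_upd[OF S'y])
      have xs: "(S' y)(j := s) = x(i := s)" for s by (simp add: x_def ij)
      have d0: "(LINT s|lborel. D ((S' y)(j := s))) = 0"
        and \<psi>: "\<And>c. \<Psi> ((S' y)(j := c)) = - (LINT s|lborel. indicator {c<..} s * D ((S' y)(j := s)))"
        using T x unfolding test_pair_def xs by blast+
      have zz: "AE s in lborel. p y s = 0 \<longrightarrow> D ((S' y)(j := s)) = 0"
        using elim(3)[rule_format, OF pos(1)] by eventually_elim simp
      note bp = rearrange_by_parts[OF pq, where d = "\<lambda>s. D ((S' y)(j := s))" and \<psi> = "\<lambda>s. \<Psi> ((S' y)(j := s))" and k = k,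
          OF _ test_pair_fibre[OF T fin S'y] zz d0 \<psi> \<Psi>pos k(1) kt]
      have F: "flux (y(j := t)) = t * (D ((S' y)(j := \<sigma> y t)) / p y (\<sigma> y t)) * q y t" for t
        by (simp add: ij step_S_upd[OF y])
      have le0: "(LINT t|lborel. flux (y(j := t))) \<le> 0"
        unfolding F by (rule bp(2)) measurable
      have "(\<integral>\<^sup>+t. ennreal (incr (y(j := t))) \<partial>lborel)
         \<le> (\<integral>\<^sup>+t. ennreal (h' y / f' (S' y)) * (indicator {t. 0 < q y t} t * ennreal (\<Psi> ((S' y)(j := \<sigma> y t)))) \<partial>lborel)"
      proof (rule nn_integral_mono)
        fix t
        \<comment> \<open>The factors \<open>f\<close> and \<open>h\<close> in the integrand cancel
          those of \<open>step_l\<close> only where they are positive; elsewhere the left side is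
          0.\<close>
        have "incr (y(j := t))
          \<le> h' y / f' (S' y) * (indicator {t. 0 < q y t} t * \<Psi> ((S' y)(j := \<sigma> y t)))"
          using pos \<Psi>pos f0[of "(S' y)(j := \<sigma> y t)"] h0[of "y(j := t)"]
          by (auto simp: step_l_def ij restrict_PL_upd[OF y fin(2)] step_S_upd[OF y] indicator_def less_le mult.commute)
        then have "ennreal (incr (y(j := t)))
          \<le> ennreal (h' y / f' (S' y) * (indicator {t. 0 < q y t} t * \<Psi> ((S' y)(j := \<sigma> y t))))"
          by (rule ennreal_leI)
        also have "\<dots> = ennreal (h' y / f' (S' y)) * (indicator {t. 0 < q y t} t * ennreal (\<Psi> ((S' y)(j := \<sigma> y t))))"
          using ennreal_mult''[OF \<Psi>pos, of "h' y / f' (S' y)" "\<sigma> y t"] by (auto simp: indicator_def)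
        finally show "ennreal (incr (y(j := t)))
          \<le> ennreal (h' y / f' (S' y)) * (indicator {t. 0 < q y t} t * ennreal (\<Psi> ((S' y)(j := \<sigma> y t))))" .
      qed
      also have "\<dots> = ennreal (h' y / f' (S' y)) * (\<integral>\<^sup>+t. indicator {t. 0 < q y t} t * ennreal (\<Psi> ((S' y)(j := \<sigma> y t))) \<partial>lborel)"
        by (rule nn_integral_cmult) measurable
      also have "\<dots> \<le> ennreal (h' y / f' (S' y)) * ennreal (- (f' (S' y) / h' y) * (LINT t|lborel. flux (y(j := t))))"
        unfolding F
        by (rule mult_left_mono[OF bp(3)[unfolded marginal_eq]]) simp_all
      also have "\<dots> = ennreal (- (LINT t|lborel. flux (y(j := t))))"
        using pos le0 by (subst ennreal_mult'[symmetric]) auto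
      finally show ?thesis using le0 by blast
    qed
  qed
  have "(\<integral>\<^sup>+z. ennreal (incr z) \<partial>PJ)
      = (\<integral>\<^sup>+y. \<integral>\<^sup>+t. ennreal (incr (y(j := t))) \<partial>lborel \<partial>PL I)"
    by (rule PL.product_nn_integral_insert[OF fin]) measurable
  also have "\<dots> \<le> (\<integral>\<^sup>+y. ennreal (- (LINT t|lborel. flux (y(j := t)))) \<partial>PL I)"
    by (rule nn_integral_mono_AE) (use key in \<open>eventually_elim, simp\<close>)
  also have "\<dots> = ennreal (LINT y|PL I. - (LINT t|lborel. flux (y(j := t))))"
    by (rule nn_integral_eq_integral) (use int1 in simp, use key in \<open>eventually_elim, simp\<close>)
  also have eqF: "(LINT y|PL I. - (LINT t|lborel. flux (y(j := t)))) = - (LINT z|PJ. flux z)"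
    by (subst PL.product_integral_insert[OF fin step_flux_integrable]) simp
  finally have le: "(\<integral>\<^sup>+z. ennreal (incr z) \<partial>PJ)
    \<le> ennreal (- (LINT z|PJ. flux z))" .
  have "0 \<le> (LINT y|PL I. - (LINT t|lborel. flux (y(j := t))))"
    by (rule Bochner_Integration.integral_nonneg_AE) (use key in \<open>eventually_elim, simp\<close>)
  with le eqF show ?thesis by simp
qed

end

lemma coupling_step: "coupling (insert j I) f h step_S step_l"
  unfolding coupling_def
proof (intro conjI ballI allI impI)
  fix i \<Psi> D
  assume *: "i \<in> insert j I" "test_pair (insert j I) i \<Psi> D"
    "AE x in PJ. f x = 0 \<longrightarrow> \<Psi> x = 0 \<and> D x = 0"
  show "(LINT z|PJ. z i * (D (step_S z) / f (step_S z)) * h z) \<le> 0"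
    "(\<integral>\<^sup>+z. ennreal (\<Psi> (step_S z) / f (step_S z) * step_l i z * h z) \<partial>PJ)
    \<le> ennreal (- (LINT z|PJ. z i * (D (step_S z) / f (step_S z)) * h z))"
    using step_by_parts_new[OF *(2,3,1)] step_by_parts_old[OF *(2,3,1)] by blast+
qed (use step_S_measurable step_l_measurable step_l_nonneg step_push step_det in simp_all)

end

theorem coupling_exists:
  fixes f h :: "('i \<Rightarrow> real) \<Rightarrow> real"
  assumes "finite I"
    and "f \<in> borel_measurable (PL I)" "\<And>x. 0 \<le> f x" "(\<integral>\<^sup>+x. ennreal (f x) \<partial>PL I) = 1"
    and "h \<in> borel_measurable (PL I)" "\<And>x. 0 \<le> h x" "(\<integral>\<^sup>+x. ennreal (h x) \<partial>PL I) = 1"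
    and "0 \<le> k" "AE y in PL I. 0 < h y \<longrightarrow> (\<forall>i\<in>I. \<bar>y i\<bar> \<le> k)"
  shows "\<exists>S l. coupling I f h S l"
  using assms
proof (induction I arbitrary: f h rule: finite_induct)
  case empty
  \<comment> \<open>The product over no coordinates is a single point of mass one, so both densities
    are 1 and the identity serves.\<close>
  then have "f (\<lambda>_. undefined) = 1" "h (\<lambda>_. undefined) = 1"
    by (simp_all add: PiM_empty nn_integral_count_space_finite one_ennreal_def[symmetric] ennreal_eq_1)
  then have "coupling {} f h (\<lambda>x. x) (\<lambda>_ _. 0)"
    by (auto simp: coupling_def PiM_empty AE_count_space nn_integral_count_space_finite)
  then show ?case by blast
next
  case (insert j I)
  let ?f' = "\<lambda>x. LINT s|lborel. f (x(j := s))" and ?h' = "\<lambda>x. LINT s|lborel. h (x(j := s))"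
  note mf = marginal_density[OF insert.hyps insert.prems(1-3)]
  note mh = marginal_density[OF insert.hyps insert.prems(4-6)]
  \<comment> \<open>The bounded support passes to the marginal: a point outside the box has a null
    fibre.\<close>
  have "AE y in PL I. 0 < ?h' y \<longrightarrow> (\<forall>i\<in>I. \<bar>y i\<bar> \<le> k)"
    using AE_PL_insert[OF insert.hyps insert.prems(8)]
  proof eventually_elim
    case (elim y)
    show ?case
    proof (intro impI ballI, rule ccontr)
      fix i assume "0 < ?h' y" and i: "i \<in> I" "\<not> \<bar>y i\<bar> \<le> k"
      have "AE t in lborel. h (y(j := t)) = 0"
        using elim
      proof eventually_elim
        case (elim t)
        have "i \<noteq> j" using i insert.hyps by auto
        then have "\<not> 0 < h (y(j := t))" using elim i by fastforce
        then show ?case using insert.prems(5)[of "y(j := t)"] by linarith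
      qed
      then have "?h' y = 0" by (rule integral_eq_zero_AE)
      with \<open>0 < ?h' y\<close> show False by simp
    qed
  qed
  from insert.IH[OF mf(1,2,4) mh(1,2,4) insert.prems(7) this]
  obtain S l where "coupling I ?f' ?h' S l" by blast
  from coupling_step[OF insert.hyps insert.prems this] show ?case by blast
qed

section \<open>Coordinates on a Euclidean space\<close>

definition vec_of :: "('a::euclidean_space \<Rightarrow> real) \<Rightarrow> 'a" where
  "vec_of f = (\<Sum>b\<in>Basis. f b *\<^sub>R b)"

definition coords :: "'a::euclidean_space \<Rightarrow> 'a \<Rightarrow> real" where
  "coords x = restrict (\<lambda>b. x \<bullet> b) Basis"

lemma vec_of_coords [simp]: "vec_of (coords x) = x"
  by (simp add: vec_of_def coords_def euclidean_representation)

lemma vec_of_inner: "b \<in> Basis \<Longrightarrow> vec_of f \<bullet> b = f b"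
  by (simp add: vec_of_def inner_sum_left inner_Basis if_distrib sum.delta cong: if_cong)

lemma coords_vec_of: "f \<in> space (PL Basis) \<Longrightarrow> coords (vec_of f) = f"
  by (auto simp: coords_def vec_of_inner space_PiM PiE_iff extensional_def fun_eq_iff restrict_def)

lemma vec_of_upd:
  assumes "b \<in> Basis" shows "vec_of (f(b := s)) = vec_of f + (s - f b) *\<^sub>R b"
proof (rule euclidean_eqI)
  fix c :: 'a assume "c \<in> Basis"
  then show "vec_of (f(b := s)) \<bullet> c = (vec_of f + (s - f b) *\<^sub>R b) \<bullet> c"
    using assms by (simp add: vec_of_inner inner_add_left inner_Basis)
qed

lemma measurable_vec_of [measurable]: "vec_of \<in> borel_measurable (PL Basis)"
  unfolding vec_of_def[abs_def] by measurable

lemma measurable_coords [measurable]: "coords \<in> measurable borel (PL Basis)"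
  unfolding coords_def[abs_def] by (rule measurable_restrict) simp

lemma lborel_eq_distr_vec_of: "lborel = distr (PL Basis) borel vec_of"
  by (subst lborel_eq) (simp add: vec_of_def[abs_def])

lemma nn_integral_vec_of:
  "f \<in> borel_measurable borel \<Longrightarrow> (\<integral>\<^sup>+x. f x \<partial>lborel) = (\<integral>\<^sup>+x. f (vec_of x) \<partial>PL Basis)"
  by (subst lborel_eq_distr_vec_of) (simp add: nn_integral_distr)

lemma integral_vec_of:
  fixes f :: "'a::euclidean_space \<Rightarrow> real"
  shows "f \<in> borel_measurable borel \<Longrightarrow> (LINT x|lborel. f x) = (LINT x|PL Basis. f (vec_of x))"
  by (subst lborel_eq_distr_vec_of) (simp add: integral_distr)

lemma AE_vec_of:
  fixes P :: "'a::euclidean_space \<Rightarrow> bool"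
  assumes "AE x in lborel. P x" shows "AE x in PL Basis. P (vec_of x)"
proof -
  have "AE x in distr (PL Basis) borel (vec_of :: _ \<Rightarrow> 'a). P x"
    using assms by (subst (asm) lborel_eq_distr_vec_of)
  from AE_distrD[OF measurable_vec_of this] show ?thesis .
qed

lemma AE_of_vec_of:
  fixes P :: "'a::euclidean_space \<Rightarrow> bool"
  assumes "AE x in PL Basis. P (vec_of x)" and "Measurable.pred borel P" shows "AE x in lborel. P x"
  by (subst lborel_eq_distr_vec_of, subst AE_distr_iff) (use assms in auto)

text \<open>The derivative is bounded and measurable but perhaps not continuous, so the fundamental
  theorem is taken for the gauge integral and its value compared with the Lebesgue integral on a
  compact interval.\<close>

lemma LINT_derivative:
  fixes u d :: "real \<Rightarrow> real"
  assumes [measurable]: "d \<in> borel_measurable borel" and C: "\<And>s. \<bar>d s\<bar> \<le> C"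
    and R: "\<And>s. R < \<bar>s\<bar> \<Longrightarrow> u s = 0 \<and> d s = 0"
    and der: "\<And>s. (u has_real_derivative d s) (at s)"
  shows "(LINT s|lborel. indicator {c<..} s * d s) = - u c" "integrable lborel d"
    "(LINT s|lborel. d s) = 0"
proof -
  show int: "integrable lborel d"
  proof (rule Bochner_Integration.integrable_bound)
    show "integrable lborel (\<lambda>s. C * indicator {-R..R} s)" by (intro integrable_mult_right integrable_box)
    show "AE s in lborel. norm (d s) \<le> norm (C * indicator {-R..R} s)"
    proof (rule AE_I2)
      fix s show "norm (d s) \<le> norm (C * indicator {-R..R} s)"
        using R[of s] C[of s] by (cases "R < \<bar>s\<bar>") (auto simp: indicator_def)
    qed
  qed measurable
  have main: "(LINT s|lborel. indicator {c<..} s * d s) = - u c" for c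
  proof -
    define M where "M = max (R + 1) c"
    have M: "c \<le> M" "u M = 0" using R[of M] by (auto simp: M_def)
    have "(d has_integral (u M - u c)) {c..M}"
      using M(1) der by (intro fundamental_theorem_of_calculus)
        (auto simp: has_real_derivative_iff_has_vector_derivative intro: has_vector_derivative_at_within)
    then have "((\<lambda>s. if s \<in> {c..M} then d s else 0) has_integral (u M - u c)) UNIV"
      by (subst has_integral_restrict_UNIV)
    then have A: "((\<lambda>s. indicator {c..M} s * d s) has_integral (u M - u c)) UNIV"
      by (rule has_integral_cong[THEN iffD1, rotated]) (auto simp: indicator_def)
    have B: "((\<lambda>s. indicator {c..M} s * d s) has_integral (LINT s|lborel. indicator {c..M} s * d s)) UNIV"
      using integrable_real_mult_indicator[OF _ int, of "{c..M}"]
      by (intro has_integral_integral_lborel) (simp add: mult.commute)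
    have "(LINT s|lborel. indicator {c..M} s * d s) = - u c"
      using has_integral_unique[OF B A] M(2) by simp
    moreover have "(LINT s|lborel. indicator {c<..} s * d s) = (LINT s|lborel. indicator {c..M} s * d s)"
    proof (rule integral_cong_AE)
      show "AE s in lborel. indicator {c<..} s * d s = indicator {c..M} s * d s"
        using AE_lborel_singleton[of c]
      proof eventually_elim
        case (elim s)
        have "d s = 0" if "M < s" using R[of s] that by (auto simp: M_def)
        then show ?case using elim by (auto simp: indicator_def)
      qed
    qed measurable
    ultimately show ?thesis by simp
  qed
  show "(LINT s|lborel. indicator {c<..} s * d s) = - u c" by (rule main)
  have "(LINT s|lborel. d s) = (LINT s|lborel. indicator {- \<bar>R\<bar> - 1<..} s * d s)"
    using R by (intro Bochner_Integration.integral_cong refl) (auto simp: indicator_def)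
  also have "\<dots> = - u (- \<bar>R\<bar> - 1)" by (rule main)
  finally show "(LINT s|lborel. d s) = 0" using R[of "- \<bar>R\<bar> - 1"] by simp
qed

text \<open>The derivative at parameter 0 at every base point gives, by translation, the derivative
  at every point of a line, and bounded derivatives on lines are what the fundamental theorem
  needs.\<close>

definition compact_derivative :: "'a \<Rightarrow> ('a::euclidean_space \<Rightarrow> real) \<Rightarrow> ('a \<Rightarrow> real) \<Rightarrow> bool" where
  "compact_derivative b \<Psi> D \<longleftrightarrow> \<Psi> \<in> borel_measurable borel \<and> D \<in> borel_measurable borel \<and>
     (\<exists>C. \<forall>x. \<bar>D x\<bar> \<le> C) \<and> (\<exists>R. \<forall>x. R < norm x \<longrightarrow> \<Psi> x = 0 \<and> D x = 0) \<and>
     (\<forall>x. ((\<lambda>s. \<Psi> (x + s *\<^sub>R b)) has_real_derivative D x) (at 0))"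

lemma compact_derivative_line:
  assumes "compact_derivative b \<Psi> D"
  shows "((\<lambda>s. \<Psi> (x + s *\<^sub>R b)) has_real_derivative D (x + s *\<^sub>R b)) (at s)"
proof -
  have "((\<lambda>r. \<Psi> (x + s *\<^sub>R b + r *\<^sub>R b)) has_real_derivative D (x + s *\<^sub>R b)) (at 0)"
    using assms unfolding compact_derivative_def by blast
  then have "((\<lambda>r. \<Psi> (x + (s + r) *\<^sub>R b)) has_real_derivative D (x + s *\<^sub>R b)) (at 0)"
    by (simp add: algebra_simps)
  then show ?thesis using DERIV_at_within_shift[of "\<lambda>s. \<Psi> (x + s *\<^sub>R b)" _ s 0 UNIV] by simp
qed

lemma test_pair_compact_derivative:
  fixes b :: "'a::euclidean_space"
  assumes b: "b \<in> Basis" and cd: "compact_derivative b \<Psi> D" and nonneg: "\<And>x. 0 \<le> \<Psi> x"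
  shows "test_pair Basis b (\<lambda>x. \<Psi> (vec_of x)) (\<lambda>x. D (vec_of x))"
proof -
  have [measurable]: "\<Psi> \<in> borel_measurable borel" "D \<in> borel_measurable borel"
    using cd by (auto simp: compact_derivative_def)
  obtain C where C: "\<And>x. \<bar>D x\<bar> \<le> C" using cd by (auto simp: compact_derivative_def)
  obtain R0 where R0: "\<And>x. R0 < norm x \<Longrightarrow> \<Psi> x = 0 \<and> D x = 0" using cd by (auto simp: compact_derivative_def)
  define R where "R = \<bar>R0\<bar>"
  have C0: "0 \<le> C" using C[of 0] by auto
  have coord: "norm (vec_of x) > R0" if "c \<in> Basis" "\<bar>x c\<bar> > R" for x :: "'a \<Rightarrow> real" and c
    using that Basis_le_norm[of c "vec_of x"] by (auto simp: vec_of_inner R_def)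
  show ?thesis
    unfolding test_pair_def
  proof (intro conjI ballI allI)
    show "\<exists>C\<ge>0. \<exists>R\<ge>0. \<forall>x\<in>space (PL Basis). \<bar>D (vec_of x)\<bar> \<le> C * box01 Basis R x"
    proof (rule exI[of _ C], rule conjI[OF C0], rule exI[of _ R], intro conjI ballI)
      fix x :: "'a \<Rightarrow> real"
      show "\<bar>D (vec_of x)\<bar> \<le> C * box01 Basis R x"
      proof (cases "\<forall>c\<in>Basis. \<bar>x c\<bar> \<le> R")
        case True
        then have "box01 Basis R x = 1"
          by (intro prod.neutral) (auto simp: abs_le_iff indicator_def)
        then show ?thesis using C by simp
      next
        case False
        then have "D (vec_of x) = 0" using coord R0 by (metis not_le)
        then show ?thesis using C0 by (auto intro!: mult_nonneg_nonneg prod_nonneg)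
      qed
    qed (auto simp: C0 R_def)
    fix x :: "'a \<Rightarrow> real" assume "x \<in> space (PL Basis)"
    define z where "z = vec_of x - x b *\<^sub>R b"
    have z: "vec_of (x(b := s)) = z + s *\<^sub>R b" for s
      by (simp add: vec_of_upd[OF b] z_def algebra_simps)
    have far: "\<Psi> (z + s *\<^sub>R b) = 0 \<and> D (z + s *\<^sub>R b) = 0" if "R < \<bar>s\<bar>" for s
      using R0 coord[OF b, of "x(b := s)"] that by (simp add: z)
    show "(LINT s|lborel. D (vec_of (x(b := s)))) = 0"
      unfolding z using C far compact_derivative_line[OF cd]
      by (intro LINT_derivative(3)[where u = "\<lambda>s. \<Psi> (z + s *\<^sub>R b)" and R = R and C = C]) auto
    fix c
    have "(LINT s|lborel. indicator {c<..} s * D (z + s *\<^sub>R b)) = - \<Psi> (z + c *\<^sub>R b)"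
      using C far compact_derivative_line[OF cd]
      by (intro LINT_derivative(1)[where u = "\<lambda>s. \<Psi> (z + s *\<^sub>R b)" and R = R and C = C]) auto
    then show "\<Psi> (vec_of (x(b := c))) = - (LINT s|lborel. indicator {c<..} s * D (vec_of (x(b := s))))"
      unfolding z by simp
  qed (use nonneg in auto)
qed

text \<open>Integrating along \<open>b\<close> first gives 0 on every line. In contrast to test
  pairs, \<Psi> may change sign: the equality case applies this to a coordinate times a
  cut-off.\<close>

lemma compact_derivative_integral:
  fixes b :: "'a::euclidean_space"
  assumes b: "b \<in> Basis" and cd: "compact_derivative b \<Psi> D"
  shows "integrable lborel D" "(LINT x|lborel. D x) = 0"
proof -
  have [measurable]: "\<Psi> \<in> borel_measurable borel" "D \<in> borel_measurable borel"
    using cd by (auto simp: compact_derivative_def)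
  obtain C where C: "\<And>x. \<bar>D x\<bar> \<le> C" using cd by (auto simp: compact_derivative_def)
  obtain R where R: "\<And>x. R < norm x \<Longrightarrow> \<Psi> x = 0 \<and> D x = 0" using cd by (auto simp: compact_derivative_def)
  show int: "integrable lborel D"
  proof (rule Bochner_Integration.integrable_bound)
    show "integrable lborel (\<lambda>x::'a. C * indicator (cball 0 R) x)"
      by (intro integrable_mult_right integrable_real_indicator) (use emeasure_compact_finite[OF compact_cball[of "0::'a" R]] in auto)
    show "AE x in lborel. norm (D x) \<le> norm (C * indicator (cball 0 R) x)"
      using C R by (intro AE_I2) (force simp: indicator_def dist_norm not_le intro: order_trans[OF _ abs_ge_self])
  qed measurable
  have B: "insert b (Basis - {b}) = Basis" using b by auto
  have intPL: "integrable (PL (insert b (Basis - {b}))) (\<lambda>x. D (vec_of x))"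
    using int unfolding B by (subst (asm) lborel_eq_distr_vec_of) (simp add: integrable_distr_eq)
  have "(LINT x|lborel. D x) = (LINT x|PL (insert b (Basis - {b})). D (vec_of x))"
    unfolding B by (rule integral_vec_of) simp
  also have "\<dots> = (LINT x|PL (Basis - {b}). LINT s|lborel. D (vec_of (x(b := s))))"
    by (rule PL.product_integral_insert[OF _ _ intPL]) auto
  also have "(\<lambda>x. LINT s|lborel. D (vec_of (x(b := s)))) = (\<lambda>x. 0)"
  proof
    fix x :: "'a \<Rightarrow> real"
    define z where "z = vec_of x - x b *\<^sub>R b"
    have z: "vec_of (x(b := s)) = z + s *\<^sub>R b" for s
      by (simp add: vec_of_upd[OF b] z_def algebra_simps)
    have far: "\<Psi> (z + s *\<^sub>R b) = 0 \<and> D (z + s *\<^sub>R b) = 0" if "R < \<bar>s\<bar>" for s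
    proof (rule R)
      have "\<bar>s\<bar> = \<bar>(z + s *\<^sub>R b) \<bullet> b\<bar>"
        using b by (simp flip: z add: vec_of_inner)
      also have "\<dots> \<le> norm (z + s *\<^sub>R b)" by (rule Basis_le_norm[OF b])
      finally show "R < norm (z + s *\<^sub>R b)" using that by simp
    qed
    show "(LINT s|lborel. D (vec_of (x(b := s)))) = 0"
      unfolding z using C far compact_derivative_line[OF cd]
      by (intro LINT_derivative(3)[where u = "\<lambda>s. \<Psi> (z + s *\<^sub>R b)" and R = R and C = C]) auto
  qed
  finally show "(LINT x|lborel. D x) = 0" by simp
qed

lemma euclidean_coupling:
  fixes f h :: "'a::euclidean_space \<Rightarrow> real"
  assumes f [measurable]: "f \<in> borel_measurable borel" and f0: "\<And>x. 0 \<le> f x"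
    and f1: "(\<integral>\<^sup>+x. ennreal (f x) \<partial>lborel) = 1"
    and h [measurable]: "h \<in> borel_measurable borel" and h0: "\<And>x. 0 \<le> h x"
    and h1: "(\<integral>\<^sup>+x. ennreal (h x) \<partial>lborel) = 1"
    and k: "0 \<le> k" "AE y in lborel. 0 < h y \<longrightarrow> (\<forall>b\<in>Basis. \<bar>y \<bullet> b\<bar> \<le> k)"
  obtains S :: "'a \<Rightarrow> 'a" and l :: "'a \<Rightarrow> 'a \<Rightarrow> real" where
    "S \<in> borel_measurable borel" "\<And>b. b \<in> Basis \<Longrightarrow> l b \<in> borel_measurable borel" "\<And>b y. 0 \<le> l b y"
    "\<And>\<phi>. \<phi> \<in> borel_measurable borel \<Longrightarrow>
        (\<integral>\<^sup>+y. \<phi> (S y) * ennreal (h y) \<partial>lborel) = (\<integral>\<^sup>+x. \<phi> x * ennreal (f x) \<partial>lborel)"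
    "AE y in lborel. 0 < h y \<longrightarrow> 0 < f (S y) \<and> (\<Prod>b\<in>Basis. l b y) = f (S y) / h y"
    "\<And>b \<Psi> D. b \<in> Basis \<Longrightarrow> compact_derivative b \<Psi> D \<Longrightarrow> (\<And>x. 0 \<le> \<Psi> x) \<Longrightarrow>
        (\<And>x. f x = 0 \<Longrightarrow> \<Psi> x = 0 \<and> D x = 0) \<Longrightarrow>
        (LINT y|lborel. (y \<bullet> b) * (D (S y) / f (S y)) * h y) \<le> 0 \<and>
        (\<integral>\<^sup>+y. ennreal (\<Psi> (S y) / f (S y) * l b y * h y) \<partial>lborel)
          \<le> ennreal (- (LINT y|lborel. (y \<bullet> b) * (D (S y) / f (S y)) * h y))"
proof -
  have kPL: "AE y in PL Basis. 0 < h (vec_of y) \<longrightarrow> (\<forall>b\<in>Basis. \<bar>y b\<bar> \<le> k)"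
    using AE_vec_of[OF k(2)] by eventually_elim (simp add: vec_of_inner)
  have f1': "(\<integral>\<^sup>+x. ennreal (f (vec_of x)) \<partial>PL Basis) = 1"
    using f1 nn_integral_vec_of[of "\<lambda>x. ennreal (f x)"] by simp
  have h1': "(\<integral>\<^sup>+x. ennreal (h (vec_of x)) \<partial>PL Basis) = 1"
    using h1 nn_integral_vec_of[of "\<lambda>x. ennreal (h x)"] by simp
  have "\<exists>S l. coupling Basis (\<lambda>x. f (vec_of x)) (\<lambda>x. h (vec_of x)) S l"
    by (rule coupling_exists[OF finite_Basis _ f0 f1' _ h0 h1' k(1) kPL]) simp_all
  then obtain S l where C: "coupling Basis (\<lambda>x. f (vec_of x)) (\<lambda>x. h (vec_of x)) S l" by blast
  note Cs = couplingD[OF C]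
  define S' where "S' y = vec_of (S (coords y))" for y
  define l' where "l' b y = l b (coords y)" for b y
  note [measurable] = Cs(1,2)
  have [measurable]: "S' \<in> borel_measurable borel" unfolding S'_def[abs_def] by measurable
  have l'm [measurable]: "l' b \<in> borel_measurable borel" if "b \<in> Basis" for b
    using that unfolding l'_def[abs_def] by measurable
  have sp: "S y \<in> space (PL Basis)" if "y \<in> space (PL Basis)" for y
    using measurable_space[OF Cs(1) that] .
  have S'v: "S' (vec_of y) = vec_of (S y)" "l' b (vec_of y) = l b y" if "y \<in> space (PL Basis)" for y b
    using coords_vec_of[OF that] by (simp_all add: S'_def l'_def)
  show thesis
  proof (rule that)
    show "S' \<in> borel_measurable borel" "\<And>b. b \<in> Basis \<Longrightarrow> l' b \<in> borel_measurable borel" "\<And>b y. 0 \<le> l' b y"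
      using Cs(3) by (auto simp: l'_def)
    fix \<phi> :: "'a \<Rightarrow> ennreal" assume [measurable]: "\<phi> \<in> borel_measurable borel"
    have "(\<integral>\<^sup>+y. \<phi> (S' y) * ennreal (h y) \<partial>lborel) = (\<integral>\<^sup>+y. \<phi> (vec_of (S y)) * ennreal (h (vec_of y)) \<partial>PL Basis)"
      by (subst nn_integral_vec_of) (auto simp: S'v intro!: nn_integral_cong)
    also have "\<dots> = (\<integral>\<^sup>+y. \<phi> (vec_of y) * ennreal (f (vec_of y)) \<partial>PL Basis)"
      by (rule Cs(4)) measurable
    also have "\<dots> = (\<integral>\<^sup>+x. \<phi> x * ennreal (f x) \<partial>lborel)"
      by (rule nn_integral_vec_of[symmetric]) measurable
    finally show "(\<integral>\<^sup>+y. \<phi> (S' y) * ennreal (h y) \<partial>lborel) = (\<integral>\<^sup>+x. \<phi> x * ennreal (f x) \<partial>lborel)" .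
  next
    define L where "L y = (\<Prod>b\<in>Basis. l' b y)" for y
    define R where "R y = f (S' y) / h y" for y
    have [measurable]: "L \<in> borel_measurable borel" "R \<in> borel_measurable borel"
      unfolding L_def[abs_def] R_def[abs_def] by measurable
    have [measurable]: "Measurable.pred borel (\<lambda>z. L z = R z)"
      unfolding pred_def by (rule borel_measurable_eq) measurable
    have "Measurable.pred borel (\<lambda>y. 0 < h y \<longrightarrow> 0 < f (S' y) \<and> L y = R y)" by measurable
    then show "AE y in lborel. 0 < h y \<longrightarrow> 0 < f (S' y) \<and> (\<Prod>b\<in>Basis. l' b y) = f (S' y) / h y"
      unfolding L_def R_def
    proof (rule AE_of_vec_of[rotated])
      show "AE y in PL Basis. 0 < h (vec_of y) \<longrightarrow> 0 < f (S' (vec_of y)) \<and>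
          (\<Prod>b\<in>Basis. l' b (vec_of y)) = f (S' (vec_of y)) / h (vec_of y)"
        using Cs(5) AE_space by eventually_elim (simp add: S'v)
    qed
  next
    fix b \<Psi> D
    assume b: "b \<in> Basis" and cd: "compact_derivative b \<Psi> D" and nn: "\<And>x. 0 \<le> \<Psi> x"
      and zero: "\<And>x. f x = 0 \<Longrightarrow> \<Psi> x = 0 \<and> D x = 0"
    have [measurable]: "\<Psi> \<in> borel_measurable borel" "D \<in> borel_measurable borel"
      using cd by (auto simp: compact_derivative_def)
    note [measurable] = l'm[OF b]
    have 1: "(\<integral>\<^sup>+y. ennreal (\<Psi> (S' y) / f (S' y) * l' b y * h y) \<partial>lborel)
       = (\<integral>\<^sup>+y. ennreal (\<Psi> (vec_of (S y)) / f (vec_of (S y)) * l b y * h (vec_of y)) \<partial>PL Basis)"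
      by (subst nn_integral_vec_of) (auto simp: S'v intro!: nn_integral_cong)
    have 2: "(LINT y|lborel. (y \<bullet> b) * (D (S' y) / f (S' y)) * h y)
       = (LINT y|PL Basis. y b * (D (vec_of (S y)) / f (vec_of (S y))) * h (vec_of y))"
      by (subst integral_vec_of) (auto simp: S'v b vec_of_inner intro!: Bochner_Integration.integral_cong)
    show "(LINT y|lborel. (y \<bullet> b) * (D (S' y) / f (S' y)) * h y) \<le> 0 \<and>
        (\<integral>\<^sup>+y. ennreal (\<Psi> (S' y) / f (S' y) * l' b y * h y) \<partial>lborel)
          \<le> ennreal (- (LINT y|lborel. (y \<bullet> b) * (D (S' y) / f (S' y)) * h y))"
      unfolding 1 2 using zero
      by (intro Cs(6)[OF b test_pair_compact_derivative[OF b cd nn]]) auto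
  qed
qed

section \<open>Cut-offs\<close>

text \<open>The square smooths the corner of the positive part, so both cut-offs can be built from
  it and be differentiable everywhere they are needed.\<close>

lemma DERIV_max_0_square: "((\<lambda>z::real. (max 0 z)\<^sup>2) has_real_derivative 2 * max 0 z) (at z)"
proof -
  consider "0 < z" | "z < 0" | "z = 0" by linarith
  then show ?thesis
  proof cases
    case 1
    have "((\<lambda>z::real. z\<^sup>2) has_real_derivative 2 * z) (at z)"
      by (auto intro!: derivative_eq_intros)
    then have "((\<lambda>z::real. (max 0 z)\<^sup>2) has_real_derivative 2 * z) (at z)"
      by (rule has_field_derivative_transform_within_open[where S = "{0<..}"]) (use 1 in auto)
    then show ?thesis using 1 by simp
  next
    case 2
    have "((\<lambda>z::real. 0) has_real_derivative 0) (at z)" by simp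
    then have "((\<lambda>z::real. (max 0 z)\<^sup>2) has_real_derivative 0) (at z)"
      by (rule has_field_derivative_transform_within_open[where S = "{..<0}"]) (use 2 in auto)
    then show ?thesis using 2 by simp
  next
    case 3
    have "((\<lambda>h::real. ((max 0 (0 + h))\<^sup>2 - (max 0 0)\<^sup>2) / h) \<longlongrightarrow> 0) (at 0)"
    proof (rule Lim_null_comparison)
      show "\<forall>\<^sub>F h in at 0. norm (((max 0 (0 + h))\<^sup>2 - (max 0 (0::real))\<^sup>2) / h) \<le> \<bar>h\<bar>"
        by (rule always_eventually) (auto simp: power2_eq_square max_def divide_simps)
    qed (auto intro!: tendsto_eq_intros)
    then show ?thesis using 3 by (simp add: DERIV_def)
  qed
qed

text \<open>A function with values in \<open>[0, 1/\<epsilon>]\<close> and slope in \<open>[0, 1]\<close> on \<open>[0, \<infinity>)\<close> that vanishes on \<open>[0, \<epsilon>]\<close> and tends to the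
  identity as \<open>\<epsilon>\<close> tends to \<open>0\<close>.\<close>

definition cut :: "real \<Rightarrow> real \<Rightarrow> real" where
  "cut e u = (max 0 (u - e))\<^sup>2 / (u + e * (u - e)\<^sup>2)"

definition cut' :: "real \<Rightarrow> real \<Rightarrow> real" where
  "cut' e u = (2 * max 0 (u - e) * (u + e * (u - e)\<^sup>2) - (max 0 (u - e))\<^sup>2 * (1 + 2 * e * (u - e)))
     / (u + e * (u - e)\<^sup>2)\<^sup>2"

context
  fixes e u :: real
  assumes e: "0 < e" and u: "0 \<le> u"
begin

lemma cut_denom: "0 < u + e * (u - e)\<^sup>2"
  using e u by (cases "u = 0") (auto intro: add_pos_nonneg)

lemma cut_nonneg: "0 \<le> cut e u"
  using cut_denom by (simp add: cut_def)

lemma cut_le: "cut e u \<le> 1 / e"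
proof -
  have "e * (max 0 (u - e))\<^sup>2 \<le> e * (u - e)\<^sup>2"
    using e by (intro mult_left_mono) (auto simp: max_def)
  then have "(max 0 (u - e))\<^sup>2 * e \<le> 1 * (u + e * (u - e)\<^sup>2)" using u by (simp add: mult.commute)
  then show ?thesis using cut_denom e by (simp add: cut_def divide_simps)
qed

lemma cut_le_self: "cut e u \<le> u"
proof -
  have "(max 0 (u - e))\<^sup>2 \<le> u\<^sup>2" using e u by (intro power_mono) auto
  also have "\<dots> \<le> u * (u + e * (u - e)\<^sup>2)" using e u by (simp add: power2_eq_square distrib_left)
  finally show ?thesis using cut_denom by (simp add: cut_def pos_divide_le_eq)
qed

lemma cut_zero: "u \<le> e \<Longrightarrow> cut e u = 0" "u \<le> e \<Longrightarrow> cut' e u = 0"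
  by (simp_all add: cut_def cut'_def)

lemma cut'_range: "0 \<le> cut' e u" "cut' e u \<le> 1"
proof -
  have "0 \<le> cut' e u \<and> cut' e u \<le> 1"
  proof (cases "u \<le> e")
    case False
    define z where "z = u - e"
    have z: "0 < z" "u = z + e" using False by (auto simp: z_def)
    \<comment> \<open>As u = z + e, the right side is u^2 - e^2, while the denominator of
      \<open>cut'\<close> is at least u^2. This keeps the slope below 1.\<close>
    have num: "2 * z * (u + e * z\<^sup>2) - z\<^sup>2 * (1 + 2 * e * z) = 2 * e * z + z\<^sup>2"
      by (simp add: z power2_eq_square algebra_simps)
    have eq: "cut' e u = (2 * e * z + z\<^sup>2) / (u + e * z\<^sup>2)\<^sup>2"
      using z(1) by (simp add: cut'_def z_def[symmetric] num[symmetric])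
    have "(z + e)\<^sup>2 \<le> (u + e * z\<^sup>2)\<^sup>2"
      using e z by (intro power_mono) auto
    then have "2 * e * z + z\<^sup>2 \<le> (u + e * z\<^sup>2)\<^sup>2"
      using zero_le_power2[of e] power2_sum[of z e] by (simp only: mult_ac)
    moreover have "0 < (u + e * z\<^sup>2)\<^sup>2" using cut_denom by (simp add: z_def)
    ultimately show ?thesis using e z(1) unfolding eq by (simp add: divide_le_eq_1_pos)
  qed (simp add: cut_zero)
  then show "0 \<le> cut' e u" "cut' e u \<le> 1" by auto
qed

lemma DERIV_cut: "(cut e has_real_derivative cut' e u) (at u)"
proof -
  have 1: "((\<lambda>u. (max 0 (u - e))\<^sup>2) has_real_derivative 2 * max 0 (u - e) * 1) (at u)"
    by (rule DERIV_chain'[OF _ DERIV_max_0_square]) (auto intro!: derivative_eq_intros)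
  have 2: "((\<lambda>u. u + e * (u - e)\<^sup>2) has_real_derivative 1 + 2 * e * (u - e)) (at u)"
    by (auto intro!: derivative_eq_intros)
  have "((\<lambda>u. (max 0 (u - e))\<^sup>2 / (u + e * (u - e)\<^sup>2)) has_real_derivative cut' e u) (at u)"
    using DERIV_divide[OF 1 2] cut_denom by (simp add: cut'_def power2_eq_square)
  then show ?thesis by (simp add: cut_def[abs_def])
qed

end

lemma cut_tendsto:
  assumes "0 < u" "(e \<longlongrightarrow> 0) F"
  shows "((\<lambda>m. cut (e m) u) \<longlongrightarrow> u) F" "((\<lambda>m. cut' (e m) u) \<longlongrightarrow> 1) F"
proof -
  have "((\<lambda>m. cut (e m) u) \<longlongrightarrow> (max 0 (u - 0))\<^sup>2 / (u + 0 * (u - 0)\<^sup>2)) F"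
    unfolding cut_def by (intro tendsto_intros assms) (use assms in auto)
  then show "((\<lambda>m. cut (e m) u) \<longlongrightarrow> u) F" using assms by (simp add: power2_eq_square)
  have "((\<lambda>m. cut' (e m) u) \<longlongrightarrow> (2 * max 0 (u - 0) * (u + 0 * (u - 0)\<^sup>2) - (max 0 (u - 0))\<^sup>2 * (1 + 2 * 0 * (u - 0)))
     / (u + 0 * (u - 0)\<^sup>2)\<^sup>2) F"
    unfolding cut'_def by (intro tendsto_intros assms) (use assms in auto)
  then show "((\<lambda>m. cut' (e m) u) \<longlongrightarrow> 1) F" using assms by (simp add: power2_eq_square)
qed

definition bump :: "real \<Rightarrow> 'a::real_inner \<Rightarrow> real" where
  "bump R x = (max 0 (1 - (x \<bullet> x) / R\<^sup>2))\<^sup>2"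

definition grad_bump :: "real \<Rightarrow> 'a::real_inner \<Rightarrow> 'a" where
  "grad_bump R x = (2 * max 0 (1 - (x \<bullet> x) / R\<^sup>2) * (- 2 / R\<^sup>2)) *\<^sub>R x"

lemma DERIV_bump_line:
  "((\<lambda>s. bump R (x + s *\<^sub>R b)) has_real_derivative grad_bump R x \<bullet> b) (at 0)"
proof -
  have inner: "((\<lambda>s. 1 - ((x + s *\<^sub>R b) \<bullet> (x + s *\<^sub>R b)) / R\<^sup>2) has_real_derivative - 2 / R\<^sup>2 * (x \<bullet> b)) (at 0)"
  proof -
    have eq: "(\<lambda>s. 1 - ((x + s *\<^sub>R b) \<bullet> (x + s *\<^sub>R b)) / R\<^sup>2)
      = (\<lambda>s. 1 - (x \<bullet> x + 2 * s * (x \<bullet> b) + s\<^sup>2 * (b \<bullet> b)) / R\<^sup>2)"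
      by (auto simp: inner_add_left inner_add_right inner_commute power2_eq_square algebra_simps)
    define c where "c = inverse (R\<^sup>2)"
    show ?thesis unfolding eq unfolding divide_inverse c_def[symmetric]
      by (auto intro!: derivative_eq_intros)
  qed
  show ?thesis
    unfolding bump_def
    by (rule DERIV_cong[OF DERIV_chain'[OF inner DERIV_max_0_square]]) (simp add: grad_bump_def)
qed

lemma bump_range: "0 \<le> bump R x" "bump R x \<le> 1"
proof -
  have "max 0 (1 - (x \<bullet> x) / R\<^sup>2) \<le> 1" by simp
  then show "bump R x \<le> 1" unfolding bump_def by (intro power_le_one) auto
qed (simp add: bump_def)

lemma bump_far:
  assumes "0 < R" "R < norm x" shows "bump R x = 0" "grad_bump R x = 0"
proof -
  have "R\<^sup>2 \<le> x \<bullet> x" using assms by (simp add: dot_square_norm power_mono)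
  then have "max 0 (1 - (x \<bullet> x) / R\<^sup>2) = 0" using assms by simp
  then show "bump R x = 0" "grad_bump R x = 0" by (simp_all add: bump_def grad_bump_def)
qed

text \<open>The decay in \<open>R\<close> is what makes the error of the spatial cut-off disappear
  in the limit.\<close>

lemma norm_grad_bump:
  assumes "0 < R" shows "norm (grad_bump R x) \<le> 4 / R"
proof (cases "R < norm x")
  case True
  then show ?thesis using assms by (simp add: bump_far)
next
  case False
  have "norm (grad_bump R x) = 2 * max 0 (1 - (x \<bullet> x) / R\<^sup>2) * (2 / R\<^sup>2) * norm x"
    using assms by (simp add: grad_bump_def abs_mult)
  also have "\<dots> \<le> 2 * 1 * (2 / R\<^sup>2) * R"
    using False assms by (intro mult_mono) auto
  also have "\<dots> = 4 / R" using assms by (simp add: power2_eq_square)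
  finally show ?thesis .
qed

lemma bump_tendsto:
  assumes "filterlim R at_top F" shows "((\<lambda>m. bump (R m) x) \<longlongrightarrow> 1) F"
proof -
  have "((\<lambda>m. (x \<bullet> x) / (R m)\<^sup>2) \<longlongrightarrow> 0) F"
    by (intro real_tendsto_divide_at_top[OF tendsto_const] filterlim_pow_at_top assms) auto
  then have "((\<lambda>m. bump (R m) x) \<longlongrightarrow> (max 0 (1 - 0))\<^sup>2) F"
    unfolding bump_def by (intro tendsto_intros)
  then show ?thesis by simp
qed

lemma borel_measurable_cut [measurable]: "cut e \<in> borel_measurable borel" "cut' e \<in> borel_measurable borel"
  unfolding cut_def[abs_def] cut'_def[abs_def] by measurable

lemma borel_measurable_bump [measurable]:
  "bump R \<in> borel_measurable (borel :: 'a::euclidean_space measure)"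
  "grad_bump R \<in> borel_measurable (borel :: 'a::euclidean_space measure)"
  unfolding bump_def[abs_def] grad_bump_def[abs_def] by measurable

section \<open>Cut-off powers of a density that is differentiable where it is positive\<close>

locale smooth_density =
  fixes a :: real and g :: "'a::euclidean_space \<Rightarrow> real" and \<gamma> :: "'a \<Rightarrow> 'a"
  assumes a: "0 < a" and g0: "\<And>x. 0 \<le> g x" and g_cont: "continuous_on UNIV g"
    and g_deriv: "\<And>x. 0 < g x \<Longrightarrow> GDERIV g x :> \<gamma> x"
    and \<gamma>_cont: "continuous_on {x. 0 < g x} \<gamma>"
begin

text \<open>These prepare the chain rule: \<open>dpot\<close> is the gradient of \<open>pot\<close>.
  Its first part, divided by \<open>g powr a\<close>, is (a + 1) times the gradient of
  \<open>g\<close> with the weight \<open>wt\<close> in [0, 1]; its second part is an error due to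
  the bump. The level cut-off makes \<open>pot\<close> vanish near the zeros of \<open>g\<close>,
  where nothing is assumed about \<open>\<gamma>\<close>.\<close>

definition "wt e R x = cut' e (g x powr (a + 1)) * bump R x"
definition "pot e R x = cut e (g x powr (a + 1)) * bump R x"
definition "dpot e R x = (if 0 < g x then (wt e R x * ((a + 1) * g x powr a)) *\<^sub>R \<gamma> x else 0) +
   cut e (g x powr (a + 1)) *\<^sub>R grad_bump R x"

lemma g_meas [measurable]: "g \<in> borel_measurable borel"
  using g_cont by (rule borel_measurable_continuous_onI)

lemma \<gamma>_meas [measurable]: "(\<lambda>x. if 0 < g x then \<gamma> x else 0) \<in> borel_measurable borel"
proof -
  have "open {x. 0 < g x}"
    using open_Collect_less[OF continuous_on_const g_cont, of 0] by simp
  then have "(\<lambda>x. indicator {x. 0 < g x} x *\<^sub>R \<gamma> x) \<in> borel_measurable borel"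
    by (intro borel_measurable_continuous_on_indicator \<gamma>_cont) auto
  moreover have "(\<lambda>x. indicator {x. 0 < g x} x *\<^sub>R \<gamma> x) = (\<lambda>x. if 0 < g x then \<gamma> x else 0)"
    by auto
  ultimately show ?thesis by simp
qed

lemma wt_meas [measurable]: "wt e R \<in> borel_measurable borel" "pot e R \<in> borel_measurable borel"
  unfolding wt_def[abs_def] pot_def[abs_def] by measurable

lemma dpot_meas [measurable]: "dpot e R \<in> borel_measurable borel"
proof -
  have "dpot e R = (\<lambda>x. (wt e R x * ((a + 1) * g x powr a)) *\<^sub>R (if 0 < g x then \<gamma> x else 0) +
     cut e (g x powr (a + 1)) *\<^sub>R grad_bump R x)"
    by (auto simp: dpot_def)
  also have "\<dots> \<in> borel_measurable borel" by measurable
  finally show ?thesis .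
qed

lemma wt_range: "0 < e \<Longrightarrow> 0 \<le> wt e R x" "0 < e \<Longrightarrow> wt e R x \<le> 1"
  using cut'_range[of e "g x powr (a + 1)"] bump_range[of R x] by (auto simp: wt_def intro: mult_le_one)

lemma pot_nonneg: "0 < e \<Longrightarrow> 0 \<le> pot e R x"
  using cut_nonneg[of e "g x powr (a + 1)"] bump_range[of R x] by (auto simp: pot_def)

lemma pot_le: "0 < e \<Longrightarrow> pot e R x \<le> g x powr (a + 1)"
proof -
  assume e: "0 < e"
  have "pot e R x \<le> g x powr (a + 1) * 1"
    unfolding pot_def using cut_le_self[OF e] cut_nonneg[OF e] bump_range[of R x] by (intro mult_mono) auto
  then show ?thesis by simp
qed

lemma pot_zero: "0 < e \<Longrightarrow> g x = 0 \<Longrightarrow> pot e R x = 0 \<and> dpot e R x = 0"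
  by (simp add: pot_def dpot_def cut_zero)

lemma compact_derivative_pot:
  assumes e: "0 < e" and R: "0 < R"
  shows "compact_derivative b (pot e R) (\<lambda>x. dpot e R x \<bullet> b)"
  unfolding compact_derivative_def
proof (intro conjI allI)
  show "pot e R \<in> borel_measurable borel" "(\<lambda>x. dpot e R x \<bullet> b) \<in> borel_measurable borel" by measurable
  show "\<exists>R'. \<forall>x. R' < norm x \<longrightarrow> pot e R x = 0 \<and> dpot e R x \<bullet> b = 0"
    by (intro exI[of _ R]) (auto simp: pot_def dpot_def wt_def bump_far[OF R])
  \<comment> \<open>The term with \<open>\<gamma>\<close> vanishes off this compact set, which lies
    where \<open>g\<close> is positive; there \<open>\<gamma>\<close> is continuous and hence
    bounded.\<close>
  define K where "K = {x \<in> cball 0 R. e \<le> g x powr (a + 1)}"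
  have cp: "continuous_on UNIV (\<lambda>x. g x powr (a + 1))"
    using a by (intro continuous_on_powr' g_cont continuous_on_const) (auto simp: g0)
  have "K = cball 0 R \<inter> {x. e \<le> g x powr (a + 1)}" by (auto simp: K_def)
  also have "compact \<dots>"
    using cp by (intro compact_Int_closed compact_cball closed_Collect_le continuous_on_const) auto
  finally have "compact K" .
  have Kpos: "0 < g x" if "x \<in> K" for x
    using that e g0[of x] by (cases "g x = 0") (auto simp: K_def)
  have "continuous_on K (\<lambda>x. g x powr a * norm (\<gamma> x))"
    using g_cont \<gamma>_cont
    by (intro continuous_on_mult continuous_on_powr continuous_on_const continuous_on_norm)
       (auto intro: continuous_on_subset dest: Kpos)
  with \<open>compact K\<close> have "bounded ((\<lambda>x. g x powr a * norm (\<gamma> x)) ` K)"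
    by (intro compact_imp_bounded compact_continuous_image)
  then obtain B where B: "\<And>x. x \<in> K \<Longrightarrow> norm (g x powr a * norm (\<gamma> x)) \<le> B"
    unfolding bounded_iff by blast
  have "norm (dpot e R x) \<le> (a + 1) * \<bar>B\<bar> + 1 / e * (4 / R)" for x
  proof -
    have "norm (if 0 < g x then (wt e R x * ((a + 1) * g x powr a)) *\<^sub>R \<gamma> x else 0) \<le> (a + 1) * \<bar>B\<bar>"
    proof (cases "0 < g x \<and> x \<in> K")
      case True
      have "norm ((wt e R x * ((a + 1) * g x powr a)) *\<^sub>R \<gamma> x) = wt e R x * ((a + 1) * (g x powr a * norm (\<gamma> x)))"
        using a wt_range(1)[OF e, of R x] by (simp add: abs_mult)
      also have "\<dots> \<le> 1 * ((a + 1) * \<bar>B\<bar>)"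
        using B[of x] True a wt_range[OF e, of R x] by (intro mult_mono) auto
      finally show ?thesis using True by simp
    next
      case False
      have "wt e R x = 0" if "x \<notin> K"
        using that cut_zero(2)[OF e, of "g x powr (a + 1)"] bump_far(1)[OF R, of x]
        by (auto simp: K_def wt_def)
      then show ?thesis using False a by auto
    qed
    moreover have "norm (cut e (g x powr (a + 1)) *\<^sub>R grad_bump R x) \<le> 1 / e * (4 / R)"
      unfolding norm_scaleR
      using cut_nonneg[OF e, of "g x powr (a + 1)"] cut_le[OF e, of "g x powr (a + 1)"] norm_grad_bump[OF R, of x] e
      by (intro mult_mono) auto
    ultimately show ?thesis unfolding dpot_def by (intro order_trans[OF norm_triangle_ineq]) simp
  qed
  then have "\<bar>dpot e R x \<bullet> b\<bar> \<le> ((a + 1) * \<bar>B\<bar> + 1 / e * (4 / R)) * norm b" for x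
    using Cauchy_Schwarz_ineq2[of "dpot e R x" b] by (meson mult_right_mono norm_ge_zero order_trans)
  then show "\<exists>C. \<forall>x. \<bar>dpot e R x \<bullet> b\<bar> \<le> C" by blast
  fix x
  show "((\<lambda>s. pot e R (x + s *\<^sub>R b)) has_real_derivative dpot e R x \<bullet> b) (at 0)"
  proof (cases "0 < g x")
    case True
    have "(g has_derivative (\<lambda>h. h \<bullet> \<gamma> x)) (at x)"
      using g_deriv[OF True] by (simp add: gderiv_def)
    moreover have "((\<lambda>s. x + s *\<^sub>R b) has_derivative (\<lambda>s. s *\<^sub>R b)) (at 0)"
      by (auto intro!: derivative_eq_intros)
    ultimately have "((\<lambda>s. g (x + s *\<^sub>R b)) has_derivative (\<lambda>s. (s *\<^sub>R b) \<bullet> \<gamma> x)) (at 0)"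
      using has_derivative_compose[of "\<lambda>s. x + s *\<^sub>R b" "\<lambda>s. s *\<^sub>R b" 0 UNIV g "\<lambda>h. h \<bullet> \<gamma> x"] by simp
    then have d1: "((\<lambda>s. g (x + s *\<^sub>R b)) has_real_derivative \<gamma> x \<bullet> b) (at 0)"
      by (simp add: has_field_derivative_def mult_commute_abs inner_commute)
    have d2: "((\<lambda>z. z powr (a + 1)) has_real_derivative (a + 1) * g x powr a) (at (g (x + 0 *\<^sub>R b)))"
      using has_real_derivative_powr[OF True, of "a + 1"] by simp
    have d3: "((\<lambda>s. g (x + s *\<^sub>R b) powr (a + 1)) has_real_derivative (a + 1) * g x powr a * (\<gamma> x \<bullet> b)) (at 0)"
      by (rule DERIV_chain'[OF d1 d2])
    have d4: "((\<lambda>s. cut e (g (x + s *\<^sub>R b) powr (a + 1))) has_real_derivative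
        cut' e (g x powr (a + 1)) * ((a + 1) * g x powr a * (\<gamma> x \<bullet> b))) (at 0)"
      by (rule DERIV_chain'[OF d3]) (use DERIV_cut[OF e, of "g x powr (a + 1)"] in simp)
    show ?thesis
      unfolding pot_def
      by (rule DERIV_cong[OF DERIV_mult[OF d4 DERIV_bump_line]])
         (use True in \<open>simp add: dpot_def wt_def inner_add_left algebra_simps\<close>)
  next
    case False
    then have gx: "g x = 0" using g0[of x] by simp
    \<comment> \<open>Near a zero of \<open>g\<close> the level cut-off is 0 on a whole
      neighbourhood, so the derivative of \<open>pot\<close> is 0 even if \<open>g\<close> has
      none.\<close>
    have cl: "continuous_on UNIV (\<lambda>s. g (x + s *\<^sub>R b) powr (a + 1))"
      by (rule continuous_on_compose2[OF cp]) (auto intro!: continuous_intros)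
    have "open {s. g (x + s *\<^sub>R b) powr (a + 1) < e}"
      by (intro open_Collect_less cl continuous_on_const)
    moreover have "0 \<in> {s. g (x + s *\<^sub>R b) powr (a + 1) < e}" using gx e by simp
    moreover have "pot e R (x + s *\<^sub>R b) = 0" if "s \<in> {s. g (x + s *\<^sub>R b) powr (a + 1) < e}" for s
      using that e by (simp add: pot_def cut_zero)
    ultimately have "((\<lambda>s. pot e R (x + s *\<^sub>R b)) has_real_derivative 0) (at 0)"
      using has_field_derivative_transform_within_open[of "\<lambda>_. 0" 0 0 "{s. g (x + s *\<^sub>R b) powr (a + 1) < e}"]
      by (metis DERIV_const)
    then show ?thesis using pot_zero[OF e gx, of R] by simp
  qed
qed

end

section \<open>The inequality\<close>

text \<open>The hypothesis on the product says that \<open>a * ln (v / s)\<close> and the logarithms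
  of the \<open>l b\<close> add up to 0. Bounding every logarithm by ln t \<le> t - 1 and
  multiplying by \<open>s\<close> gives the claim.\<close>

lemma weighted_AM_GM:
  fixes l :: "'b \<Rightarrow> real"
  assumes "0 < a" "0 < s" "0 < v" "finite B" "\<And>b. b \<in> B \<Longrightarrow> 0 \<le> l b"
    and prod: "(\<Prod>b\<in>B. l b) = s powr a / v powr a"
  shows "(a + card B) * s \<le> a * v + s * (\<Sum>b\<in>B. l b)"
proof -
  have pos: "0 < l b" if "b \<in> B" for b
  proof -
    have "(\<Prod>b\<in>B. l b) \<noteq> 0" using prod assms by simp
    then show ?thesis using that assms(4) assms(5)[of b] by (auto simp: less_le)
  qed
  have "(\<Sum>b\<in>B. ln (l b)) = ln (\<Prod>b\<in>B. l b)"
    using assms(4) by (intro ln_prod[symmetric]) (auto dest: pos)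
  also have "\<dots> = - a * ln (v / s)"
    using assms by (simp add: prod ln_div ln_powr algebra_simps)
  finally have "0 = a * ln (v / s) + (\<Sum>b\<in>B. ln (l b))" by simp
  also have "\<dots> \<le> a * (v / s - 1) + (\<Sum>b\<in>B. l b - 1)"
    using assms pos by (intro add_mono mult_left_mono sum_mono ln_le_minus_one) auto
  also have "\<dots> = a * (v / s) + (\<Sum>b\<in>B. l b) - (a + card B)"
    by (simp add: sum_subtractf algebra_simps)
  finally have "(a + card B) * s \<le> (a * (v / s) + (\<Sum>b\<in>B. l b)) * s"
    using assms by (intro mult_right_mono) auto
  also have "\<dots> = a * v + s * (\<Sum>b\<in>B. l b)"
    using assms by (simp add: algebra_simps)
  finally show ?thesis .
qed

context smooth_density
begin

text \<open>Allows the error of the spatial cut-off to be measured against the integrable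
  \<open>g powr a\<close>. Where the cut-off is not 0, \<open>g powr (a + 1)\<close> exceeds
  \<open>e\<close> and so \<open>g powr a\<close> exceeds \<open>e powr (a / (a + 1))\<close>;
  dividing the bound 1 / e by this gives the constant.\<close>

lemma cut_le_density:
  assumes e: "0 < e"
  shows "\<exists>K\<ge>0. \<forall>x. cut e (g x powr (a + 1)) \<le> K * g x powr a"
proof (intro exI[of _ "1 / e / e powr (a / (a + 1))"] conjI allI)
  fix x
  show "cut e (g x powr (a + 1)) \<le> 1 / e / e powr (a / (a + 1)) * g x powr a"
  proof (cases "g x powr (a + 1) \<le> e")
    case True
    then show ?thesis using e by (simp add: cut_zero)
  next
    case False
    have "e powr (a / (a + 1)) \<le> (g x powr (a + 1)) powr (a / (a + 1))"
      using False e a by (intro powr_mono2) auto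
    also have "\<dots> = g x powr a" using a by (simp add: powr_powr)
    finally have "1 \<le> g x powr a / e powr (a / (a + 1))" using e by (simp add: divide_simps)
    then have "1 / e * 1 \<le> 1 / e * (g x powr a / e powr (a / (a + 1)))"
      using e by (intro mult_left_mono) auto
    with cut_le[OF e, of "g x powr (a + 1)"] show ?thesis by simp
  qed
qed (use e in simp)

text \<open>The order of choice matters: the level \<open>e m\<close> comes first, and the radius
  \<open>R m\<close> is then taken large compared with the constant \<open>K m\<close> that belongs
  to this level. The gradient of the bump is thereby beaten by a vanishing multiple of
  \<open>g powr a\<close>.\<close>

lemma cutoff_sequence:
  fixes k1 :: real
  assumes k1: "0 \<le> k1"
  obtains e R :: "nat \<Rightarrow> real" where
    "\<And>m. 0 < e m" "\<And>m. 0 < R m"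
    "\<And>x. 0 < g x \<Longrightarrow> (\<lambda>m. wt (e m) (R m) x) \<longlonglongrightarrow> 1"
    "\<And>x. (\<lambda>m. pot (e m) (R m) x) \<longlonglongrightarrow> g x powr (a + 1)"
    "\<And>m x y. norm y \<le> k1 \<Longrightarrow>
       \<bar>cut (e m) (g x powr (a + 1)) * (y \<bullet> grad_bump (R m) x)\<bar> \<le> g x powr a * (1 / real (Suc m))"
proof -
  define e where "e m = inverse (real (Suc m))" for m
  have e: "0 < e m" for m by (simp add: e_def)
  have "\<forall>m. \<exists>K\<ge>0. \<forall>x. cut (e m) (g x powr (a + 1)) \<le> K * g x powr a"
    using cut_le_density[OF e] by blast
  then obtain K where K: "\<And>m. 0 \<le> K m" "\<And>m x. cut (e m) (g x powr (a + 1)) \<le> K m * g x powr a"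
    by metis
  \<comment> \<open>The 4 is that of \<open>norm_grad_bump\<close>; the summand 1 makes the radii
    tend to infinity even if \<open>k1 * K m\<close> is 0.\<close>
  define R where "R m = real (Suc m) * (4 * k1 * K m + 1)" for m
  have R1: "real (Suc m) \<le> R m" for m
    using K(1)[of m] k1 unfolding R_def by (intro mult_le_cancel_left1[THEN iffD2]) auto
  then have R: "0 < R m" for m by (rule less_le_trans[rotated]) simp
  have err: "\<bar>cut (e m) (g x powr (a + 1)) * (y \<bullet> grad_bump (R m) x)\<bar> \<le> g x powr a * (1 / real (Suc m))"
    if y: "norm y \<le> k1" for m x y
  proof -
    have "\<bar>y \<bullet> grad_bump (R m) x\<bar> \<le> norm y * norm (grad_bump (R m) x)"
      by (rule Cauchy_Schwarz_ineq2)
    also have "\<dots> \<le> k1 * (4 / R m)"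
      using y norm_grad_bump[OF R, of m x] k1 by (intro mult_mono) auto
    finally have 1: "\<bar>y \<bullet> grad_bump (R m) x\<bar> \<le> k1 * (4 / R m)" .
    have "\<bar>cut (e m) (g x powr (a + 1)) * (y \<bullet> grad_bump (R m) x)\<bar> \<le> (K m * g x powr a) * (k1 * (4 / R m))"
      unfolding abs_mult using 1 K cut_nonneg[OF e, of "g x powr (a + 1)" m]
      by (intro mult_mono) auto
    also have "\<dots> = g x powr a * (4 * k1 * K m / R m)" by simp
    also have "4 * k1 * K m / R m \<le> 1 / real (Suc m)"
    proof -
      have "4 * k1 * K m * real (Suc m) \<le> R m"
        unfolding R_def by (simp add: algebra_simps)
      then show ?thesis using R[of m] by (simp add: divide_simps)
    qed
    then have "g x powr a * (4 * k1 * K m / R m) \<le> g x powr a * (1 / real (Suc m))"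
      by (intro mult_left_mono) auto
    finally show ?thesis .
  qed
  have e_lim: "e \<longlonglongrightarrow> 0" unfolding e_def[abs_def] by (rule LIMSEQ_inverse_real_of_nat)
  have "filterlim (\<lambda>m. real (Suc m)) at_top sequentially"
    by (rule filterlim_compose[OF filterlim_real_sequentially filterlim_Suc])
  then have R_lim: "filterlim R at_top sequentially"
    by (rule filterlim_at_top_mono) (use R1 in auto)
  show thesis
  proof (rule that[OF e R _ _ err])
    fix x
    have "(\<lambda>m. wt (e m) (R m) x) \<longlonglongrightarrow> 1 * 1" if "0 < g x"
      unfolding wt_def using that by (intro tendsto_mult cut_tendsto(2)[OF _ e_lim] bump_tendsto[OF R_lim]) simp
    then show "0 < g x \<Longrightarrow> (\<lambda>m. wt (e m) (R m) x) \<longlonglongrightarrow> 1" by simp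
    show "(\<lambda>m. pot (e m) (R m) x) \<longlonglongrightarrow> g x powr (a + 1)"
    proof (cases "0 < g x")
      case True
      have "(\<lambda>m. pot (e m) (R m) x) \<longlonglongrightarrow> g x powr (a + 1) * 1"
        unfolding pot_def using True by (intro tendsto_mult cut_tendsto(1)[OF _ e_lim] bump_tendsto[OF R_lim]) simp
      then show ?thesis by simp
    next
      case False
      then have "g x = 0" using g0[of x] by simp
      then show ?thesis using pot_zero[OF e] by simp
    qed
  qed
qed

text \<open>\<open>L\<close> stands for the real-valued Legendre transform at the gradient, and
  \<open>good\<close> for its finiteness. \<open>U\<close> is separate from \<open>V\<close> because
  \<open>V\<close> will be a rescaled truncation, whereas the Legendre bound holds for the
  truncation itself. Positive and negative part of \<open>L\<close> are on opposite sides, so no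
  difference of infinite integrals arises.\<close>

theorem transport_inequality:
  fixes V U L :: "'a \<Rightarrow> real"
  assumes g1: "(\<integral>\<^sup>+x. ennreal (g x powr a) \<partial>lborel) = 1"
    and V [measurable]: "V \<in> borel_measurable borel" and V0: "\<And>y. 0 \<le> V y"
    and V1: "(\<integral>\<^sup>+y. ennreal (V y powr a) \<partial>lborel) = 1"
    and k: "0 \<le> k" "AE y in lborel. 0 < V y \<longrightarrow> (\<forall>b\<in>Basis. \<bar>y \<bullet> b\<bar> \<le> k)"
    and U [measurable]: "U \<in> borel_measurable borel" and U0: "\<And>y. 0 \<le> U y"
    and L [measurable]: "L \<in> borel_measurable borel"
    and good: "AE x in lborel. 0 < g x \<longrightarrow> good x"
    and ineq: "AE y in lborel. 0 < V y \<longrightarrow> (\<forall>x. 0 < g x \<longrightarrow> good x \<longrightarrow> L x \<le> y \<bullet> \<gamma> x - U y)"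
  shows "ennreal (a + 1) * (\<integral>\<^sup>+x. ennreal (max 0 (L x) * g x powr a) \<partial>lborel) +
      ennreal (a + 1) * (\<integral>\<^sup>+y. ennreal (U y * V y powr a) \<partial>lborel) +
      ennreal (a + DIM('a)) * (\<integral>\<^sup>+x. ennreal (g x powr (a + 1)) \<partial>lborel)
    \<le> ennreal (a + 1) * (\<integral>\<^sup>+x. ennreal (max 0 (- L x) * g x powr a) \<partial>lborel) +
      ennreal a * (\<integral>\<^sup>+y. ennreal (V y powr (a + 1)) \<partial>lborel)"
proof (cases "(\<integral>\<^sup>+x. ennreal (max 0 (- L x) * g x powr a) \<partial>lborel) = \<infinity>")
  case True
  then show ?thesis using a by (simp add: ennreal_mult_top)
next
  case N_fin: False
  define f where "f x = g x powr a" for x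
  define h where "h y = V y powr a" for y
  have fm [measurable]: "f \<in> borel_measurable borel" and hm [measurable]: "h \<in> borel_measurable borel"
    unfolding f_def[abs_def] h_def[abs_def] by measurable
  have f0: "0 \<le> f x" and h0: "0 \<le> h x" for x by (simp_all add: f_def h_def)
  have hV: "0 < h y \<longleftrightarrow> 0 < V y" and fg: "0 < f y \<longleftrightarrow> 0 < g y" for y
    using V0[of y] g0[of y] by (auto simp: h_def f_def less_le)
  have kh: "AE y in lborel. 0 < h y \<longrightarrow> (\<forall>b\<in>Basis. \<bar>y \<bullet> b\<bar> \<le> k)" using k(2) by (simp add: hV)
  obtain S l where S [measurable]: "S \<in> borel_measurable borel"
    and l [measurable]: "\<And>b. b \<in> Basis \<Longrightarrow> l b \<in> borel_measurable borel" and l0: "\<And>b y. 0 \<le> l b y"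
    and push: "\<And>\<phi>. \<phi> \<in> borel_measurable borel \<Longrightarrow>
        (\<integral>\<^sup>+y. \<phi> (S y) * ennreal (h y) \<partial>lborel) = (\<integral>\<^sup>+x. \<phi> x * ennreal (f x) \<partial>lborel)"
    and det: "AE y in lborel. 0 < h y \<longrightarrow> 0 < f (S y) \<and> (\<Prod>b\<in>Basis. l b y) = f (S y) / h y"
    and parts: "\<And>b \<Psi> D. b \<in> Basis \<Longrightarrow> compact_derivative b \<Psi> D \<Longrightarrow> (\<And>x. 0 \<le> \<Psi> x) \<Longrightarrow>
        (\<And>x. f x = 0 \<Longrightarrow> \<Psi> x = 0 \<and> D x = 0) \<Longrightarrow>
        (LINT y|lborel. (y \<bullet> b) * (D (S y) / f (S y)) * h y) \<le> 0 \<and>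
        (\<integral>\<^sup>+y. ennreal (\<Psi> (S y) / f (S y) * l b y * h y) \<partial>lborel)
          \<le> ennreal (- (LINT y|lborel. (y \<bullet> b) * (D (S y) / f (S y)) * h y))"
    using euclidean_coupling[OF fm f0 g1[folded f_def] hm h0 V1[folded h_def] k(1) kh] by blast
  have "AE x in lborel. 0 < f x \<longrightarrow> good x" using good by (simp add: fg)
  then have "AE y in lborel. 0 < h y \<longrightarrow> 0 < f (S y) \<longrightarrow> good (S y)"
    by (intro pushforward_AE[where f = f and P = "\<lambda>x. 0 < f x \<longrightarrow> good x", OF _ _ push])
       (use S hm in simp_all)
  with det have goodS: "AE y in lborel. 0 < h y \<longrightarrow> good (S y) \<and> 0 < g (S y)"
    by eventually_elim (auto simp: fg)
  define k1 where "k1 = k * DIM('a)"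
  have k1: "0 \<le> k1" using k(1) by (simp add: k1_def)
  have norm_le: "norm y \<le> k1" if "\<forall>b\<in>Basis. \<bar>y \<bullet> b\<bar> \<le> k" for y :: 'a
  proof -
    have "norm y \<le> (\<Sum>b\<in>Basis. \<bar>y \<bullet> b\<bar>)" by (rule norm_le_l1)
    also have "\<dots> \<le> (\<Sum>b\<in>(Basis :: 'a set). k)" using that by (intro sum_mono) auto
    finally show ?thesis by (simp add: k1_def mult.commute)
  qed
  obtain e R :: "nat \<Rightarrow> real" where e: "\<And>m. 0 < e m" and R: "\<And>m. 0 < R m"
    and wt_lim: "\<And>x. 0 < g x \<Longrightarrow> (\<lambda>m. wt (e m) (R m) x) \<longlonglongrightarrow> 1"
    and pot_lim: "\<And>x. (\<lambda>m. pot (e m) (R m) x) \<longlonglongrightarrow> g x powr (a + 1)"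
    and err: "\<And>m x y. norm y \<le> k1 \<Longrightarrow>
       \<bar>cut (e m) (g x powr (a + 1)) * (y \<bullet> grad_bump (R m) x)\<bar> \<le> g x powr a * (1 / real (Suc m))"
    using cutoff_sequence[OF k1] by blast
  define Np where "Np y = max 0 (- L (S y)) * h y" for y
  have [measurable]: "Np \<in> borel_measurable borel" unfolding Np_def[abs_def] by measurable
  have Np0: "0 \<le> Np y" for y using h0 by (simp add: Np_def)
  have N_eq: "(\<integral>\<^sup>+y. ennreal (Np y) \<partial>lborel) = (\<integral>\<^sup>+x. ennreal (max 0 (- L x) * g x powr a) \<partial>lborel)"
    using push[of "\<lambda>x. ennreal (max 0 (- L x))"] h0 f0
    by (simp add: Np_def f_def[symmetric] ennreal_mult)
  have intN: "integrable lborel Np"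
    using N_fin by (intro integrableI_bounded) (simp_all add: N_eq Np0 less_top[symmetric])
  have inth: "integrable lborel h" "(LINT y|lborel. h y) = 1"
    using V1[folded h_def] h0 by (auto intro!: integrableI_bounded simp: integral_eq_nn_integral)
  \<comment> \<open>Both \<open>A\<close> and \<open>X\<close> are nonnegative, as Fatou's lemma
    demands. The negative part of \<open>L\<close> is left out of \<open>A\<close>: it goes
    unweighted into the upper bound, which is possible because the weight is at most 1.\<close>
  define A where "A m y = (a + 1) * (wt (e m) (R m) (S y) * (max 0 (L (S y)) + U y)) * h y" for m y
  define X where "X m y = pot (e m) (R m) (S y) / f (S y) * (\<Sum>b\<in>Basis. l b y) * h y" for m y
  have [measurable]: "A m \<in> borel_measurable borel" "X m \<in> borel_measurable borel" for m
    unfolding A_def[abs_def] X_def[abs_def] by measurable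
  have A0: "0 \<le> A m y" and X0: "0 \<le> X m y" for m y
    using a wt_range(1)[OF e] U0 h0 pot_nonneg[OF e] f0 l0 unfolding A_def X_def
    by (auto intro!: mult_nonneg_nonneg divide_nonneg_nonneg sum_nonneg add_nonneg_nonneg)
  have step: "(\<integral>\<^sup>+y. ennreal (A m y + X m y) \<partial>lborel) \<le> ennreal ((a + 1) * (LINT y|lborel. Np y) + 1 / real (Suc m))" for m
  proof -
    let ?D = "dpot (e m) (R m)"
    have cd: "compact_derivative b (pot (e m) (R m)) (\<lambda>x. ?D x \<bullet> b)" for b
      by (rule compact_derivative_pot[OF e R])
    have zero: "pot (e m) (R m) x = 0 \<and> ?D x \<bullet> b = 0" if "f x = 0" for x b
      using pot_zero[OF e, of x m "R m"] that fg[of x] g0[of x] by (auto simp: f_def)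
    have intb: "integrable lborel (\<lambda>y. (y \<bullet> b) * (?D (S y) \<bullet> b / f (S y)) * h y)" if b: "b \<in> Basis" for b
      by (rule pushforward_integrable[OF _ _ _ _ push h0 f0 _ compact_derivative_integral(1)[OF b cd], where k = k])
         (use S hm fm kh b in \<open>auto elim: eventually_mono\<close>)
    define B where "B y = (y \<bullet> ?D (S y)) / f (S y) * h y" for y
    have B_sum: "B y = (\<Sum>b\<in>Basis. (y \<bullet> b) * (?D (S y) \<bullet> b / f (S y)) * h y)" for y
      unfolding B_def by (subst euclidean_inner) (simp add: sum_divide_distrib sum_distrib_right)
    have intB: "integrable lborel B" unfolding B_sum[abs_def] by (intro Bochner_Integration.integrable_sum intb)
    have LB: "(LINT y|lborel. B y) = (\<Sum>b\<in>Basis. LINT y|lborel. (y \<bullet> b) * (?D (S y) \<bullet> b / f (S y)) * h y)"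
      unfolding B_sum by (intro Bochner_Integration.integral_sum intb)
    note pp = parts[OF _ cd pot_nonneg[OF e] zero]
    have LB0: "(LINT y|lborel. B y) \<le> 0"
      unfolding LB using pp by (intro sum_nonpos) blast
    have "(\<integral>\<^sup>+y. ennreal (X m y) \<partial>lborel)
        = (\<integral>\<^sup>+y. (\<Sum>b\<in>Basis. ennreal (pot (e m) (R m) (S y) / f (S y) * l b y * h y)) \<partial>lborel)"
    proof (rule nn_integral_cong)
      fix y
      have "(\<Sum>b\<in>Basis. ennreal (pot (e m) (R m) (S y) / f (S y) * l b y * h y))
        = ennreal (\<Sum>b\<in>Basis. pot (e m) (R m) (S y) / f (S y) * l b y * h y)"
        using pot_nonneg[OF e] f0 l0 h0 by (intro sum_ennreal) auto
      then show "ennreal (X m y) = (\<Sum>b\<in>Basis. ennreal (pot (e m) (R m) (S y) / f (S y) * l b y * h y))"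
        by (simp add: X_def sum_distrib_left sum_distrib_right)
    qed
    also have "\<dots> = (\<Sum>b\<in>Basis. \<integral>\<^sup>+y. ennreal (pot (e m) (R m) (S y) / f (S y) * l b y * h y) \<partial>lborel)"
      by (rule nn_integral_sum) measurable
    also have "\<dots> \<le> (\<Sum>b\<in>Basis. ennreal (- (LINT y|lborel. (y \<bullet> b) * (?D (S y) \<bullet> b / f (S y)) * h y)))"
      using pp by (intro sum_mono) blast
    also have "\<dots> = ennreal (\<Sum>b\<in>Basis. - (LINT y|lborel. (y \<bullet> b) * (?D (S y) \<bullet> b / f (S y)) * h y))"
      using pp by (intro sum_ennreal) simp
    also have "\<dots> = ennreal (- (LINT y|lborel. B y))" by (simp add: LB sum_negf)
    finally have X_le: "(\<integral>\<^sup>+y. ennreal (X m y) \<partial>lborel) \<le> ennreal (- (LINT y|lborel. B y))" .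
    \<comment> \<open>\<open>Z\<close> dominates \<open>A\<close> by the bound on \<open>L\<close>
      and the error estimate. Its term \<open>B\<close> reappears with the opposite sign in the
      bound for \<open>X\<close> and so drops out of the sum.\<close>
    define Z where "Z y = (a + 1) * Np y + 1 / real (Suc m) * h y + B y" for y
    have AZ: "AE y in lborel. A m y \<le> Z y"
      using goodS ineq kh
    proof eventually_elim
      case (elim y)
      show ?case
      proof (cases "h y = 0")
        case True
        then show ?thesis by (simp add: A_def Z_def Np_def B_def)
      next
        case False
        then have hy: "0 < h y" using h0[of y] by simp
        then have gS: "0 < g (S y)" "good (S y)" and Vy: "0 < V y" using elim(1) hV by auto
        then have fS: "0 < f (S y)" using fg by simp
        have Ly: "L (S y) \<le> y \<bullet> \<gamma> (S y) - U y" using elim(2) gS Vy by blast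
        define w where "w = wt (e m) (R m) (S y)"
        define r where "r = cut (e m) (g (S y) powr (a + 1)) * (y \<bullet> grad_bump (R m) (S y)) / f (S y)"
        have w: "0 \<le> w" "w \<le> 1" using wt_range[OF e] by (auto simp: w_def)
        have "norm y \<le> k1" using elim(3) hy norm_le by blast
        from err[OF this, of m "S y"] have "\<bar>r\<bar> \<le> 1 / real (Suc m)"
          using fS unfolding r_def abs_divide f_def[symmetric] by (simp add: divide_simps mult.commute)
        then have r: "- r \<le> 1 / real (Suc m)" by linarith
        have BB: "y \<bullet> ?D (S y) / f (S y) = (a + 1) * (w * (y \<bullet> \<gamma> (S y))) + r"
          using gS fS by (simp add: dpot_def r_def w_def inner_add_right f_def[symmetric] add_divide_distrib)
        have "w * (max 0 (L (S y)) + U y) = w * (L (S y) + U y) + w * max 0 (- L (S y))"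
          by (simp add: algebra_simps max_def)
        also have "\<dots> \<le> w * (y \<bullet> \<gamma> (S y)) + 1 * max 0 (- L (S y))"
          using w Ly by (intro add_mono mult_left_mono mult_right_mono) auto
        finally have "(a + 1) * (w * (max 0 (L (S y)) + U y)) \<le> (a + 1) * (w * (y \<bullet> \<gamma> (S y)) + max 0 (- L (S y)))"
          using a by (intro mult_left_mono) auto
        also have "\<dots> \<le> (a + 1) * max 0 (- L (S y)) + 1 / real (Suc m) + y \<bullet> ?D (S y) / f (S y)"
          unfolding BB distrib_left using r by linarith
        finally have "(a + 1) * (w * (max 0 (L (S y)) + U y)) * h y
            \<le> ((a + 1) * max 0 (- L (S y)) + 1 / real (Suc m) + y \<bullet> ?D (S y) / f (S y)) * h y"
          by (rule mult_right_mono[OF _ h0])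
        then show ?thesis
          by (simp add: A_def Z_def Np_def B_def w_def[symmetric] distrib_right)
      qed
    qed
    have intZ: "integrable lborel Z"
      unfolding Z_def[abs_def] using intN inth intB by (intro Bochner_Integration.integrable_add) auto
    have LZ: "(LINT y|lborel. Z y) = (a + 1) * (LINT y|lborel. Np y) + 1 / real (Suc m) + (LINT y|lborel. B y)"
      unfolding Z_def[abs_def] using intN inth intB by simp
    have Z0: "AE y in lborel. 0 \<le> Z y" using AZ by eventually_elim (rule order_trans[OF A0])
    have LZ0: "0 \<le> (LINT y|lborel. Z y)" using Z0 by (rule Bochner_Integration.integral_nonneg_AE)
    have "(\<integral>\<^sup>+y. ennreal (A m y) \<partial>lborel) \<le> (\<integral>\<^sup>+y. ennreal (Z y) \<partial>lborel)"
      by (rule nn_integral_mono_AE) (use AZ in \<open>auto elim!: eventually_mono intro: ennreal_leI\<close>)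
    also have "\<dots> = ennreal (LINT y|lborel. Z y)"
      by (rule nn_integral_eq_integral[OF intZ Z0])
    finally have A_le: "(\<integral>\<^sup>+y. ennreal (A m y) \<partial>lborel) \<le> ennreal (LINT y|lborel. Z y)" .
    have "(\<integral>\<^sup>+y. ennreal (A m y + X m y) \<partial>lborel) = (\<integral>\<^sup>+y. ennreal (A m y) \<partial>lborel) + (\<integral>\<^sup>+y. ennreal (X m y) \<partial>lborel)"
      using A0 X0 by (subst nn_integral_add[symmetric]) auto
    also have "\<dots> \<le> ennreal (LINT y|lborel. Z y) + ennreal (- (LINT y|lborel. B y))"
      by (rule add_mono[OF A_le X_le])
    also have "\<dots> = ennreal ((a + 1) * (LINT y|lborel. Np y) + 1 / real (Suc m))"
      using LZ0 LB0 by (subst ennreal_plus[symmetric]) (auto simp: LZ)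
    finally show ?thesis .
  qed
  define F where "F y = (a + 1) * (max 0 (L (S y)) + U y) * h y + g (S y) * (\<Sum>b\<in>Basis. l b y) * h y" for y
  have [measurable]: "F \<in> borel_measurable borel" unfolding F_def[abs_def] by measurable
  have lim: "AE y in lborel. (\<lambda>m. ennreal (A m y + X m y)) \<longlonglongrightarrow> ennreal (F y)"
    using goodS
  proof eventually_elim
    case (elim y)
    show ?case
    proof (cases "h y = 0")
      case True
      then show ?thesis by (simp add: A_def X_def F_def)
    next
      case False
      then have gS: "0 < g (S y)" using elim h0[of y] by auto
      have "(\<lambda>m. A m y + X m y) \<longlonglongrightarrow> (a + 1) * (1 * (max 0 (L (S y)) + U y)) * h y
          + g (S y) powr (a + 1) / f (S y) * (\<Sum>b\<in>Basis. l b y) * h y"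
        unfolding A_def X_def using gS by (intro tendsto_intros wt_lim pot_lim) (auto simp: f_def)
      moreover have "g (S y) powr (a + 1) / f (S y) = g (S y)"
        using gS by (simp add: f_def powr_add)
      ultimately show ?thesis by (intro tendsto_ennrealI) (simp add: F_def)
    qed
  qed
  have "(\<integral>\<^sup>+y. ennreal (F y) \<partial>lborel) = (\<integral>\<^sup>+y. liminf (\<lambda>m. ennreal (A m y + X m y)) \<partial>lborel)"
  proof (rule nn_integral_cong_AE)
    show "AE y in lborel. ennreal (F y) = liminf (\<lambda>m. ennreal (A m y + X m y))"
      using lim by eventually_elim (simp add: lim_imp_Liminf)
  qed
  also have "\<dots> \<le> liminf (\<lambda>m. \<integral>\<^sup>+y. ennreal (A m y + X m y) \<partial>lborel)"
    by (rule nn_integral_liminf) measurable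
  also have "\<dots> \<le> liminf (\<lambda>m. ennreal ((a + 1) * (LINT y|lborel. Np y) + 1 / real (Suc m)))"
    by (rule Liminf_mono) (use step in auto)
  also have "\<dots> = ennreal ((a + 1) * (LINT y|lborel. Np y) + 0)"
  proof (rule lim_imp_Liminf)
    have "(\<lambda>m. 1 / real (Suc m)) \<longlonglongrightarrow> 0"
      using LIMSEQ_inverse_real_of_nat by (simp add: inverse_eq_divide)
    then show "(\<lambda>m. ennreal ((a + 1) * (LINT y|lborel. Np y) + 1 / real (Suc m))) \<longlonglongrightarrow> ennreal ((a + 1) * (LINT y|lborel. Np y) + 0)"
      by (intro tendsto_intros)
  qed simp
  also have "\<dots> = ennreal (a + 1) * (\<integral>\<^sup>+y. ennreal (Np y) \<partial>lborel)"
    using a nn_integral_eq_integral[OF intN] Np0 by (simp add: ennreal_mult')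
  also note N_eq
  finally have F_le: "(\<integral>\<^sup>+y. ennreal (F y) \<partial>lborel) \<le> ennreal (a + 1) * (\<integral>\<^sup>+x. ennreal (max 0 (- L x) * g x powr a) \<partial>lborel)" .
  have P_eq: "(\<integral>\<^sup>+x. ennreal (max 0 (L x) * g x powr a) \<partial>lborel) = (\<integral>\<^sup>+y. ennreal (max 0 (L (S y)) * h y) \<partial>lborel)"
    using push[of "\<lambda>x. ennreal (max 0 (L x))"] h0 f0 by (simp add: f_def[symmetric] ennreal_mult)
  have G_eq: "(\<integral>\<^sup>+x. ennreal (g x powr (a + 1)) \<partial>lborel) = (\<integral>\<^sup>+y. ennreal (g (S y) * h y) \<partial>lborel)"
  proof -
    have "g x powr (a + 1) = g x * f x" for x
      using g0[of x] by (cases "g x = 0") (auto simp: f_def powr_add)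
    then show ?thesis using push[of "\<lambda>x. ennreal (g x)"] h0 f0 g0 by (simp add: ennreal_mult)
  qed
  \<comment> \<open>The mean inequality with s = g (S y) and v = V y, multiplied by
    \<open>h y\<close>; the product \<open>V y * h y\<close> is
    \<open>V y powr (a + 1)\<close>.\<close>
  have AB: "AE y in lborel. (a + 1) * (max 0 (L (S y)) * h y) + (a + 1) * (U y * h y) + (a + DIM('a)) * (g (S y) * h y)
      \<le> F y + a * V y powr (a + 1)"
    using det
  proof eventually_elim
    case (elim y)
    show ?case
    proof (cases "h y = 0")
      case True
      then show ?thesis using a by (simp add: F_def)
    next
      case False
      then have hy: "0 < h y" using h0[of y] by simp
      then have Vy: "0 < V y" and gS: "0 < g (S y)" using elim hV fg by auto
      have "(a + DIM('a)) * g (S y) \<le> a * V y + g (S y) * (\<Sum>b\<in>Basis. l b y)"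
        by (rule weighted_AM_GM) (use a gS Vy l0 elim hy in \<open>auto simp: f_def h_def\<close>)
      then have "(a + DIM('a)) * g (S y) * h y \<le> (a * V y + g (S y) * (\<Sum>b\<in>Basis. l b y)) * h y"
        using hy by (intro mult_right_mono) auto
      moreover have "V y powr (a + 1) = V y * h y" using Vy by (simp add: h_def powr_add)
      ultimately show ?thesis by (simp add: F_def algebra_simps)
    qed
  qed
  have F0: "0 \<le> F y" for y
    using a U0 h0 g0 l0 unfolding F_def by (auto intro!: mult_nonneg_nonneg sum_nonneg add_nonneg_nonneg)
  have "ennreal (a + 1) * (\<integral>\<^sup>+y. ennreal (max 0 (L (S y)) * h y) \<partial>lborel) +
      ennreal (a + 1) * (\<integral>\<^sup>+y. ennreal (U y * h y) \<partial>lborel) +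
      ennreal (a + DIM('a)) * (\<integral>\<^sup>+y. ennreal (g (S y) * h y) \<partial>lborel)
    = (\<integral>\<^sup>+y. ennreal ((a + 1) * (max 0 (L (S y)) * h y) + (a + 1) * (U y * h y) + (a + DIM('a)) * (g (S y) * h y)) \<partial>lborel)"
    using a U0 h0 g0 by (simp add: nn_integral_add nn_integral_cmult ennreal_mult')
  also have "\<dots> \<le> (\<integral>\<^sup>+y. ennreal (F y + a * V y powr (a + 1)) \<partial>lborel)"
    by (rule nn_integral_mono_AE) (use AB in \<open>auto elim!: eventually_mono intro: ennreal_leI\<close>)
  also have "\<dots> = (\<integral>\<^sup>+y. ennreal (F y) \<partial>lborel) + ennreal a * (\<integral>\<^sup>+y. ennreal (V y powr (a + 1)) \<partial>lborel)"
    using a F0 by (simp add: nn_integral_add nn_integral_cmult ennreal_mult')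
  also have "\<dots> \<le> ennreal (a + 1) * (\<integral>\<^sup>+x. ennreal (max 0 (- L x) * g x powr a) \<partial>lborel) + ennreal a * (\<integral>\<^sup>+y. ennreal (V y powr (a + 1)) \<partial>lborel)"
    by (rule add_right_mono[OF F_le])
  finally show ?thesis unfolding P_eq G_eq h_def .
qed

end

lemma ennreal_add_right_cancel:
  fixes A B C N :: ennreal
  assumes "A + (B + C) \<le> N + C" "C \<noteq> \<infinity>"
  shows "A + B \<le> N"
  using assms ennreal_add_left_cancel_le[of C "A + B" N]
  unfolding add.assoc[symmetric] add.commute[of _ C] by simp

text \<open>The truncations \<open>U j\<close> are brought back to mass one by factors
  \<open>c j\<close>. For them the last term of the transport inequality is finite and can be
  cancelled; what remains has the coefficient \<open>(a + 1 - a * c j) * c j powr a\<close>, which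
  tends to 1. Monotone convergence then yields the full integral of \<open>W powr (a + 1)\<close>,
  finite or not.\<close>

lemma (in smooth_density) transport_inequality_limit:
  fixes W L :: "'a \<Rightarrow> real"
  assumes g1: "(\<integral>\<^sup>+x. ennreal (g x powr a) \<partial>lborel) = 1"
    and W [measurable]: "W \<in> borel_measurable borel" and W0: "\<And>y. 0 \<le> W y"
    and W1: "(\<integral>\<^sup>+y. ennreal (W y powr a) \<partial>lborel) = 1"
    and L [measurable]: "L \<in> borel_measurable borel"
    and good: "AE x in lborel. 0 < g x \<longrightarrow> good x"
    and ineq: "AE y in lborel. 0 < W y \<longrightarrow> (\<forall>x. 0 < g x \<longrightarrow> good x \<longrightarrow> L x \<le> y \<bullet> \<gamma> x - W y)"
  shows "ennreal (a + 1) * (\<integral>\<^sup>+x. ennreal (max 0 (L x) * g x powr a) \<partial>lborel) +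
      ennreal (a + DIM('a)) * (\<integral>\<^sup>+x. ennreal (g x powr (a + 1)) \<partial>lborel) +
      (\<integral>\<^sup>+y. ennreal (W y powr (a + 1)) \<partial>lborel)
    \<le> ennreal (a + 1) * (\<integral>\<^sup>+x. ennreal (max 0 (- L x) * g x powr a) \<partial>lborel)"
    (is "?P + ?G + ?X \<le> ?N")
proof -
  define U where "U j y = (if norm y \<le> real j \<and> W y \<le> real j then W y else 0)" for j y
  have U [measurable]: "U j \<in> borel_measurable borel" for j unfolding U_def[abs_def] by measurable
  have U0: "0 \<le> U j y" for j y using W0 by (simp add: U_def)
  have UW: "U j y \<le> W y" for j y using W0 by (simp add: U_def)
  have mono: "U i y \<le> U j y" if "i \<le> j" for i j y using that W0[of y] by (auto simp: U_def)
  have ev: "\<forall>\<^sub>F j in sequentially. U j y = W y" for y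
  proof -
    obtain j0 where "max (norm y) (W y) \<le> real j0" using real_arch_simple by blast
    then show ?thesis by (intro eventually_sequentiallyI[of j0]) (auto simp: U_def)
  qed
  have conv: "(\<lambda>j. \<integral>\<^sup>+y. ennreal (U j y powr c) \<partial>lborel) \<longlonglongrightarrow> (\<integral>\<^sup>+y. ennreal (W y powr c) \<partial>lborel)" if c: "0 \<le> c" for c
  proof (rule nn_integral_LIMSEQ)
    show "incseq (\<lambda>j y. ennreal (U j y powr c))"
      using mono U0 c by (auto simp: incseq_def le_fun_def intro!: ennreal_leI powr_mono2)
    show "(\<lambda>j. ennreal (U j y powr c)) \<longlonglongrightarrow> ennreal (W y powr c)" for y
      by (rule tendsto_eventually) (use ev[of y] in eventually_elim, simp)
  qed measurable
  define m where "m j = enn2real (\<integral>\<^sup>+y. ennreal (U j y powr a) \<partial>lborel)" for j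
  have m_le: "(\<integral>\<^sup>+y. ennreal (U j y powr a) \<partial>lborel) \<le> 1" for j
    unfolding W1[symmetric] using UW U0 a by (intro nn_integral_mono ennreal_leI powr_mono2) auto
  have m_eq: "(\<integral>\<^sup>+y. ennreal (U j y powr a) \<partial>lborel) = ennreal (m j)" for j
    using le_less_trans[OF m_le ennreal_one_less_top, of j] by (simp add: m_def)
  have m_lim: "m \<longlonglongrightarrow> 1"
  proof -
    have "(\<lambda>j. ennreal (m j)) \<longlonglongrightarrow> ennreal 1"
      using conv[of a] a by (simp add: W1 m_eq)
    then show ?thesis by (rule tendsto_ennrealD) (auto simp: m_def)
  qed
  \<comment> \<open>Multiplying a function by \<open>c j\<close> divides the integral of its a-th
    power by \<open>m j\<close>.\<close>
  define c where "c j = m j powr (- 1 / a)" for j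
  have c_lim: "c \<longlonglongrightarrow> 1"
  proof -
    have "c \<longlonglongrightarrow> 1 powr (- 1 / a)" unfolding c_def[abs_def] by (intro tendsto_powr m_lim tendsto_const) auto
    then show ?thesis by simp
  qed
  let ?Xj = "\<lambda>j. \<integral>\<^sup>+y. ennreal (U j y powr (a + 1)) \<partial>lborel"
  have X_fin: "?Xj j < \<infinity>" for j
  proof -
    have "?Xj j \<le> (\<integral>\<^sup>+y. ennreal (real j) * ennreal (U j y powr a) \<partial>lborel)"
    proof (rule nn_integral_mono)
      fix y
      have "U j y powr (a + 1) = U j y * U j y powr a"
        using U0[of j y] by (cases "U j y = 0") (auto simp: powr_add)
      also have "\<dots> \<le> real j * U j y powr a" by (intro mult_right_mono) (auto simp: U_def)
      finally show "ennreal (U j y powr (a + 1)) \<le> ennreal (real j) * ennreal (U j y powr a)"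
        by (subst ennreal_mult[symmetric]) (auto intro: ennreal_leI)
    qed
    also have "\<dots> = ennreal (real j) * ennreal (m j)" by (simp add: nn_integral_cmult m_eq)
    also have "\<dots> < \<infinity>" by (simp add: ennreal_mult_less_top)
    finally show ?thesis .
  qed
  \<comment> \<open>Below this bound \<open>a + 1 - a * c j\<close> is positive, so that
    \<open>ennreal\<close> does not cut it off; \<open>c j\<close> gets there because its limit is
    1.\<close>
  have ac1: "1 < (a + 1) / a" using a by simp
  have le: "\<forall>\<^sub>F j in sequentially. ?P + ?G + ennreal ((a + 1 - a * c j) * c j powr a) * ?Xj j \<le> ?N"
    using order_tendstoD(1)[OF m_lim zero_less_one] order_tendstoD(2)[OF c_lim ac1]
  proof eventually_elim
    case (elim j)
    have cj: "0 < c j" using elim(1) by (simp add: c_def)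
    have ac: "0 \<le> a + 1 - a * c j" using elim(2) a by (simp add: field_simps)
    have "c j powr a = m j powr (- 1 / a * a)" by (simp only: c_def powr_powr)
    also have "\<dots> = m j powr - 1" using a by simp
    finally have ca: "c j powr a * m j = 1" using elim(1) by (simp only: powr_minus) simp
    define V where "V y = c j * U j y" for y
    have V [measurable]: "V \<in> borel_measurable borel" unfolding V_def[abs_def] by measurable
    have V0: "0 \<le> V y" for y using cj U0 by (simp add: V_def)
    have Vp: "ennreal (V y powr d) = ennreal (c j powr d) * ennreal (U j y powr d)" for y d
      using cj U0[of j y] by (simp add: V_def powr_mult ennreal_mult)
    have V1: "(\<integral>\<^sup>+y. ennreal (V y powr a) \<partial>lborel) = 1"
    proof -
      have "(\<integral>\<^sup>+y. ennreal (V y powr a) \<partial>lborel) = ennreal (c j powr a) * ennreal (m j)"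
        by (simp add: Vp nn_integral_cmult m_eq)
      also have "\<dots> = ennreal (c j powr a * m j)" by (simp add: ennreal_mult')
      finally show ?thesis by (simp add: ca)
    qed
    have pos: "0 < V y \<longleftrightarrow> U j y = W y \<and> norm y \<le> real j \<and> 0 < W y" for y
      using cj W0[of y] by (auto simp: V_def U_def zero_less_mult_iff less_le)
    have k: "AE y in lborel. 0 < V y \<longrightarrow> (\<forall>b\<in>Basis. \<bar>y \<bullet> b\<bar> \<le> real j)"
      unfolding pos using Basis_le_norm order_trans by (intro AE_I2) blast
    have iq: "AE y in lborel. 0 < V y \<longrightarrow> (\<forall>x. 0 < g x \<longrightarrow> good x \<longrightarrow> L x \<le> y \<bullet> \<gamma> x - U j y)"
      using ineq unfolding pos by eventually_elim auto
    have "?P + ennreal (a + 1) * (\<integral>\<^sup>+y. ennreal (U j y * V y powr a) \<partial>lborel) + ?G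
        \<le> ?N + ennreal a * (\<integral>\<^sup>+y. ennreal (V y powr (a + 1)) \<partial>lborel)"
      by (rule transport_inequality[OF g1 V V0 V1 _ k U U0 L good iq]) simp
    moreover have "(\<integral>\<^sup>+y. ennreal (U j y * V y powr a) \<partial>lborel) = ennreal (c j powr a) * ?Xj j"
    proof -
      have "ennreal (U j y * V y powr a) = ennreal (c j powr a) * ennreal (U j y powr (a + 1))" for y
        using U0[of j y] cj
        by (cases "U j y = 0") (auto simp: V_def powr_mult powr_add ennreal_mult[symmetric] mult_ac)
      then show ?thesis by (simp add: nn_integral_cmult)
    qed
    moreover have "(\<integral>\<^sup>+y. ennreal (V y powr (a + 1)) \<partial>lborel) = ennreal (c j powr (a + 1)) * ?Xj j"
      by (simp add: Vp nn_integral_cmult)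
    ultimately have *: "?P + ?G + ennreal (a + 1) * (ennreal (c j powr a) * ?Xj j)
        \<le> ?N + ennreal a * (ennreal (c j powr (a + 1)) * ?Xj j)"
      by (simp add: ac_simps)
    have split: "ennreal (a + 1) * (ennreal (c j powr a) * ?Xj j) =
        ennreal ((a + 1 - a * c j) * c j powr a) * ?Xj j + ennreal a * (ennreal (c j powr (a + 1)) * ?Xj j)"
    proof -
      have "(a + 1) * c j powr a = (a + 1 - a * c j) * c j powr a + a * c j powr (a + 1)"
        using cj by (simp add: powr_add algebra_simps)
      then have "ennreal (a + 1) * ennreal (c j powr a) =
          ennreal ((a + 1 - a * c j) * c j powr a) + ennreal a * ennreal (c j powr (a + 1))"
        using a ac cj by (simp only: ennreal_mult[symmetric] ennreal_plus[symmetric] mult_nonneg_nonneg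
            powr_ge_zero add_nonneg_nonneg less_imp_le zero_le_one)
      then show ?thesis by (simp add: mult.assoc[symmetric] distrib_right[symmetric])
    qed
    have "ennreal a * (ennreal (c j powr (a + 1)) * ?Xj j) \<noteq> \<infinity>"
      using X_fin[of j] by (auto simp: ennreal_mult_eq_top_iff)
    with * show ?case
      unfolding split by (rule ennreal_add_right_cancel)
  qed
  have lim: "(\<lambda>j. ?P + ?G + ennreal ((a + 1 - a * c j) * c j powr a) * ?Xj j) \<longlonglongrightarrow> ?P + ?G + ennreal 1 * ?X"
  proof (intro tendsto_add tendsto_const tendsto_mult_ennreal)
    have "(\<lambda>j. (a + 1 - a * c j) * c j powr a) \<longlonglongrightarrow> (a + 1 - a * 1) * 1 powr a"
      by (intro tendsto_intros c_lim) simp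
    then show "(\<lambda>j. ennreal ((a + 1 - a * c j) * c j powr a)) \<longlonglongrightarrow> ennreal 1"
      by (intro tendsto_ennrealI) simp
    show "?Xj \<longlonglongrightarrow> ?X" using conv[of "a + 1"] a by simp
  qed simp
  have "?P + ?G + ennreal 1 * ?X \<le> ?N" by (rule tendsto_upperbound[OF lim le sequentially_bot])
  then show ?thesis by simp
qed


section \<open>From nonnegative integrals to extended real ones\<close>

lemma legendre_le: "y \<in> pos_set W \<Longrightarrow> legendre W v \<le> ereal (y \<bullet> v - W y)"
  unfolding legendre_def by (rule INF_lower)

text \<open>An infimum of affine functions is upper semicontinuous. The family may be uncountable,
  so measurability comes from open strict sublevel sets and not from countable infima.\<close>

lemma borel_measurable_legendre [measurable]: "legendre W \<in> borel_measurable (borel :: 'a::euclidean_space measure)"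
proof (rule borel_measurableI_less)
  fix c :: ereal
  have "{v \<in> space borel. legendre W v < c} = (\<Union>y\<in>pos_set W. {v. ereal (y \<bullet> v - W y) < c})"
    by (auto simp: legendre_def INF_less_iff)
  also have "open \<dots>"
    by (intro open_UN ballI open_Collect_less continuous_on_ereal continuous_intros)
  finally show "{v \<in> space borel. legendre W v < c} \<in> sets borel" by auto
qed

lemma nn_integral_lebesgue:
  fixes f :: "'a::euclidean_space \<Rightarrow> ennreal"
  assumes "f \<in> borel_measurable borel"
  shows "(\<integral>\<^sup>+x. f x \<partial>lebesgue) = (\<integral>\<^sup>+x. f x \<partial>lborel)"
  using assms by (intro nn_integral_completion)

lemma leb_int_nonneg:
  assumes "\<And>x. 0 \<le> f x"
  shows "leb_int (\<lambda>x. ereal (f x)) = enn2ereal (\<integral>\<^sup>+x. ennreal (f x) \<partial>lebesgue)"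
proof -
  have "(\<integral>\<^sup>+x. ennreal (- f x) \<partial>lebesgue) = 0"
    using assms by (simp add: ennreal_neg)
  then show ?thesis by (simp add: leb_int_def zero_ennreal.rep_eq flip: ennreal.abs_eq)
qed

lemma smooth_density_smooth_nonneg:
  fixes g :: "real ^ 'n \<Rightarrow> real"
  assumes "0 < a" "smooth_nonneg g"
  shows "smooth_density a g (grad g)"
proof
  show "0 < a" "\<And>x. 0 \<le> g x" "continuous_on UNIV g"
    using assms by (auto simp: smooth_nonneg_def)
  have td: "times_differentiable_on k {x. 0 < g x} g" for k
    using assms by (simp add: smooth_nonneg_def smooth_on_def pos_set_def)
  show "GDERIV g x :> grad g x" if "0 < g x" for x
    using td[of 1] that by (intro grad_GDERIV) auto
  have "continuous_on {x. 0 < g x} (\<lambda>x. frechet_derivative g (at x) v)" for v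
    using td[of 1] by simp
  then show "continuous_on {x. 0 < g x} (grad g)"
    unfolding grad_def[abs_def] by (intro continuous_on_vec_lambda) auto
qed

text \<open>A Lebesgue measurable \<open>W\<close> agrees almost everywhere with a Borel function
  \<open>V\<close>, which becomes the source density. The Legendre transform remains that of
  \<open>W\<close>, since a change on a null set can alter the infimum; the bound in terms of
  \<open>V y\<close> is asked for only at almost every \<open>y\<close>.\<close>

lemma legendre_inequality:
  fixes W g :: "real ^ 'n \<Rightarrow> real" and a :: real
  assumes a: "a > 0" and W0: "\<And>x. 0 \<le> W x" and W: "W \<in> borel_measurable lebesgue"
    and g: "smooth_nonneg g"
    and g1: "leb_int (\<lambda>x. ereal (g x powr a)) = 1" and W1: "leb_int (\<lambda>x. ereal (W x powr a)) = 1"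
  defines "I \<equiv> leb_int (\<lambda>x. legendre W (grad g x) * ereal (g x powr a))"
    and "G \<equiv> leb_int (\<lambda>x. ereal (g x powr (1 + a)))"
  assumes has: "has_leb_int (\<lambda>x. legendre W (grad g x) * ereal (g x powr a))"
    and nondeg: "\<not> (I = -\<infinity> \<and> G = \<infinity>)"
  shows "ereal (a + 1) * I + ereal (a + real CARD('n)) * G \<le> - leb_int (\<lambda>x. ereal (W x powr (1 + a)))"
proof -
  interpret smooth_density a g "grad g" by (rule smooth_density_smooth_nonneg[OF a g])
  let ?F = "\<lambda>x. legendre W (grad g x) * ereal (g x powr a)"
  define X where "X = (\<integral>\<^sup>+x. ennreal (W x powr (1 + a)) \<partial>lebesgue)"
  define G' where "G' = (\<integral>\<^sup>+x. ennreal (g x powr (1 + a)) \<partial>lborel)"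
  define P where "P = (\<integral>\<^sup>+x. e2ennreal (?F x) \<partial>lborel)"
  define N where "N = (\<integral>\<^sup>+x. e2ennreal (- ?F x) \<partial>lborel)"
  \<comment> \<open>The gradient is known to be measurable only where \<open>g\<close> is positive.
    Elsewhere the factor \<open>g powr a\<close> is 0, and 0 times any extended real is 0.\<close>
  have F_if: "?F x = legendre W (if 0 < g x then grad g x else 0) * ereal (g x powr a)" for x
    using g0[of x] by (auto simp: zero_ereal_def[symmetric])
  have [measurable]: "?F \<in> borel_measurable borel" unfolding F_if by measurable
  have I: "I = enn2ereal P - enn2ereal N"
    unfolding I_def leb_int_def P_def N_def by (subst (1 2) nn_integral_lebesgue) auto
  have G: "G = enn2ereal G'"
    unfolding G_def G'_def by (subst leb_int_nonneg) (auto simp: nn_integral_lebesgue)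
  have X: "leb_int (\<lambda>x. ereal (W x powr (1 + a))) = enn2ereal X"
    unfolding X_def by (rule leb_int_nonneg) simp
  have g1': "(\<integral>\<^sup>+x. ennreal (g x powr a) \<partial>lborel) = 1"
    using g1 by (simp add: leb_int_nonneg nn_integral_lebesgue one_ereal_def[symmetric])
      (metis enn2ereal_inject one_ennreal.rep_eq)
  obtain W' where W' [measurable]: "W' \<in> borel_measurable lborel" and AEW: "AE x in lborel. W x = W' x"
    using completion_ex_borel_measurable_real[OF W] by blast
  define V where "V x = max 0 (W' x)" for x
  have V [measurable]: "V \<in> borel_measurable borel" unfolding V_def[abs_def] using W' by simp
  have V0: "0 \<le> V x" for x by (simp add: V_def)
  have AEV: "AE x in lborel. W x = V x" using AEW by eventually_elim (metis V_def W0 max.absorb2)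
  have WV: "(\<integral>\<^sup>+x. ennreal (W x powr c) \<partial>lebesgue) = (\<integral>\<^sup>+x. ennreal (V x powr c) \<partial>lborel)" for c
  proof -
    have "(\<integral>\<^sup>+x. ennreal (W x powr c) \<partial>lebesgue) = (\<integral>\<^sup>+x. ennreal (V x powr c) \<partial>lebesgue)"
      by (rule nn_integral_cong_AE) (use AE_completion[OF AEV] in \<open>eventually_elim, simp\<close>)
    then show ?thesis by (simp add: nn_integral_lebesgue)
  qed
  have V1: "(\<integral>\<^sup>+x. ennreal (V x powr a) \<partial>lborel) = 1"
    using W1 unfolding leb_int_nonneg[OF powr_ge_zero] WV
    by (metis enn2ereal_inject one_ennreal.rep_eq)
  have "pos_set W \<noteq> {}"
  proof
    assume "pos_set W = {}"
    then have "W x = 0" for x using W0[of x] by (auto simp: pos_set_def less_le)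
    then show False using W1 by (simp add: leb_int_nonneg zero_ennreal.rep_eq)
  qed
  then obtain y0 where y0: "y0 \<in> pos_set W" by blast
  have L_top: "legendre W v \<noteq> \<infinity>" for v using legendre_le[OF y0, of v] by auto
  show ?thesis
  proof (cases "N = \<infinity>")
    case True
    \<comment> \<open>With an infinite negative part, \<open>I\<close> is -\<infinity>; then
      \<open>G\<close> is finite by the excluded case, and the left side is -\<infinity>.\<close>
    then have "P \<noteq> \<infinity>"
      using has unfolding has_leb_int_def P_def N_def by (subst (asm) (1 2) nn_integral_lebesgue) auto
    then have "I = -\<infinity>" unfolding I True by (cases P) (auto simp: enn2ereal_ennreal)
    moreover have "G \<noteq> \<infinity>" using nondeg calculation by blast
    moreover have "0 \<le> G" by (simp add: G)
    ultimately show ?thesis using a by (cases G) auto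
  next
    case False
    define L where "L x = (if 0 < g x then real_of_ereal (legendre W (if 0 < g x then grad g x else 0)) else 0)" for x
    have L [measurable]: "L \<in> borel_measurable borel" unfolding L_def[abs_def] by measurable
    define good where "good x \<longleftrightarrow> legendre W (grad g x) = ereal (L x)" for x
    \<comment> \<open>Finiteness of the negative part rules out the value -\<infinity> almost
      everywhere on the support of \<open>g\<close>; the value \<infinity> never occurs because
      \<open>pos_set W\<close> is not empty.\<close>
    have "AE x in lborel. e2ennreal (- ?F x) \<noteq> \<infinity>"
      using False unfolding N_def by (intro nn_integral_PInf_AE) auto
    then have good: "AE x in lborel. 0 < g x \<longrightarrow> good x"
    proof eventually_elim
      case (elim x)
      show ?case
      proof
        assume gx: "0 < g x"
        then have "legendre W (grad g x) \<noteq> -\<infinity>" using elim by (auto simp: e2ennreal_infty)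
        then show "good x" using L_top[of "grad g x"] gx
          by (cases "legendre W (grad g x)") (auto simp: good_def L_def)
      qed
    qed
    have FL: "AE x in lborel. ?F x = ereal (L x * g x powr a)"
      using good
    proof eventually_elim
      case (elim x)
      then show ?case using g0[of x] by (cases "g x = 0") (auto simp: good_def less_le zero_ereal_def[symmetric])
    qed
    have P_eq: "P = (\<integral>\<^sup>+x. ennreal (max 0 (L x) * g x powr a) \<partial>lborel)"
      unfolding P_def
    proof (rule nn_integral_cong_AE)
      show "AE x in lborel. e2ennreal (?F x) = ennreal (max 0 (L x) * g x powr a)"
        using FL by eventually_elim
          (auto simp: ennreal.abs_eq[symmetric] max_def ennreal_neg mult_nonpos_nonneg not_le)
    qed
    have N_eq: "N = (\<integral>\<^sup>+x. ennreal (max 0 (- L x) * g x powr a) \<partial>lborel)"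
      unfolding N_def
    proof (rule nn_integral_cong_AE)
      show "AE x in lborel. e2ennreal (- ?F x) = ennreal (max 0 (- L x) * g x powr a)"
        using FL by eventually_elim
          (auto simp: ennreal.abs_eq[symmetric] max_def ennreal_neg mult_nonneg_nonneg not_le)
    qed
    have ineq: "AE y in lborel. 0 < V y \<longrightarrow> (\<forall>x. 0 < g x \<longrightarrow> good x \<longrightarrow> L x \<le> y \<bullet> grad g x - V y)"
      using AEV
    proof eventually_elim
      case (elim y)
      show ?case
      proof (intro impI allI)
        fix x assume *: "0 < V y" "0 < g x" "good x"
        then have "ereal (L x) \<le> ereal (y \<bullet> grad g x - W y)"
          using legendre_le[of y W "grad g x"] elim by (simp add: good_def pos_set_def)
        then show "L x \<le> y \<bullet> grad g x - V y" using elim by simp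
      qed
    qed
    have main: "ennreal (a + 1) * P + ennreal (a + real CARD('n)) * G' + X \<le> ennreal (a + 1) * N"
      using transport_inequality_limit[OF g1' V V0 V1 L good ineq] False
      unfolding P_eq[symmetric] N_eq[symmetric]
      by (simp add: X_def WV G'_def add.commute less_top[symmetric])
    have "ennreal (a + 1) * N < \<infinity>" using False by (simp add: ennreal_mult_eq_top_iff less_top[symmetric])
    with main have fin: "ennreal (a + 1) * P + ennreal (a + real CARD('n)) * G' + X < \<infinity>"
      by (rule le_less_trans)
    then have "P \<noteq> \<infinity>" "G' \<noteq> \<infinity>" "X \<noteq> \<infinity>"
      using a by (auto simp: ennreal_mult_eq_top_iff)
    with False obtain p n' \<gamma>' x where r: "P = ennreal p" "N = ennreal n'" "G' = ennreal \<gamma>'" "X = ennreal x"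
      and nn: "0 \<le> p" "0 \<le> n'" "0 \<le> \<gamma>'" "0 \<le> x"
      by (metis ennreal_cases infinity_ennreal_def)
    have "ennreal ((a + 1) * p + (a + real CARD('n)) * \<gamma>' + x) \<le> ennreal ((a + 1) * n')"
      using main nn a unfolding r by (simp only: ennreal_mult[symmetric] ennreal_plus[symmetric]
          mult_nonneg_nonneg add_nonneg_nonneg less_imp_le zero_le_one of_nat_0_le_iff)
    then have "(a + 1) * p + (a + real CARD('n)) * \<gamma>' + x \<le> (a + 1) * n'"
      using nn a by (subst (asm) ennreal_le_iff) auto
    then have "(a + 1) * (p - n') + (a + real CARD('n)) * \<gamma>' \<le> - x"
      by (simp add: algebra_simps)
    then show ?thesis
      unfolding I G X r using nn by (simp add: enn2ereal_ennreal)
  qed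
qed

section \<open>The equality case\<close>

text \<open>An unbounded convex set contains the convex hull of a fixed ball and points arbitrarily
  far away. In the half of this hull next to the ball there is room for balls of half the radius,
  and a long hull holds many disjoint ones.\<close>

lemma open_convex_finite_measure_bounded:
  fixes S :: "'a::euclidean_space set"
  assumes "open S" "convex S" "emeasure lborel S < \<infinity>"
  shows "bounded S"
proof (rule ccontr)
  assume unb: "\<not> bounded S"
  then obtain x where x: "x \<in> S" by (cases "S = {}") auto
  then obtain r where r: "0 < r" "ball x r \<subseteq> S" using \<open>open S\<close> open_contains_ball by blast
  define v where "v = emeasure lborel (ball (0::'a) (r / 2))"
  have v: "0 < v" using r(1) by (simp add: v_def emeasure_ball)
  have "of_nat N * v \<le> emeasure lborel S" for N :: nat
  proof -
    \<comment> \<open>The distance is chosen so that \<open>N\<close> centres with spacing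
      \<open>r\<close>, starting from \<open>x\<close>, lie in the first half of the segment to
      \<open>y\<close>.\<close>
    obtain y where y: "y \<in> S" "dist x y > 2 * r * real N"
      using unb unfolding bounded_any_center[of _ x] by (meson bounded_def not_le)
    define d where "d = dist x y"
    have d: "2 * r * real N < d" using y(2) by (simp add: d_def)
    then have d0: "0 < d" using r(1) by (smt (verit) mult_nonneg_nonneg of_nat_0_le_iff)
    define p where "p i = x + (real i * r / d) *\<^sub>R (y - x)" for i :: nat
    have sub: "ball (p i) (r / 2) \<subseteq> S" if "i < N" for i
    proof
      fix z assume z: "z \<in> ball (p i) (r / 2)"
      define t where "t = real i * r / d"
      have "real i * r \<le> real N * r" using that r(1) by (intro mult_right_mono) auto
      then have "2 * (real i * r) < d" using d by (simp add: mult_ac)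
      then have t: "0 \<le> t" "t < 1 / 2" using d0 r(1) by (auto simp: t_def field_simps)
      \<comment> \<open>The homothety with centre \<open>y\<close> and ratio 1 - t sends
        \<open>w\<close> to \<open>z\<close> and \<open>x\<close> to \<open>p i\<close>. As the
        ratio exceeds 1 / 2, \<open>w\<close> is within \<open>r\<close> of
        \<open>x\<close>.\<close>
      define w where "w = x + (1 / (1 - t)) *\<^sub>R (z - p i)"
      have "dist x w = 1 / (1 - t) * norm (z - p i)"
        using t by (simp add: w_def dist_norm)
      also have "\<dots> < 2 * (r / 2)"
      proof (rule mult_le_less_imp_less)
        show "1 / (1 - t) \<le> 2" using t by (simp add: field_simps)
        show "norm (z - p i) < r / 2" using z by (simp add: dist_norm norm_minus_commute)
      qed (use t in auto)
      finally have "w \<in> S" using r(2) by auto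
      then have "(1 - t) *\<^sub>R w + t *\<^sub>R y \<in> S"
        using y(1) t \<open>convex S\<close> by (intro convexD) auto
      also have "(1 - t) *\<^sub>R w = (1 - t) *\<^sub>R x + (z - p i)"
        using t by (simp add: w_def scaleR_add_right)
      also have "p i = x + t *\<^sub>R (y - x)" by (simp add: p_def t_def)
      also have "(1 - t) *\<^sub>R x + (z - (x + t *\<^sub>R (y - x))) + t *\<^sub>R y = z"
        by (simp add: algebra_simps)
      finally show "z \<in> S" .
    qed
    have disj: "disjoint_family_on (\<lambda>i. ball (p i) (r / 2)) {..<N}"
      unfolding disjoint_family_on_def
    proof (intro ballI impI)
      fix i j :: nat assume "i \<noteq> j"
      have "dist (p i) (p j) = \<bar>real i - real j\<bar> * r"
      proof -
        have "p i - p j = ((real i - real j) * r / d) *\<^sub>R (y - x)"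
          by (simp add: p_def algebra_simps diff_divide_distrib)
        then have "dist (p i) (p j) = \<bar>(real i - real j) * r / d\<bar> * d"
          by (simp add: dist_norm d_def norm_minus_commute)
        then show ?thesis using d0 r(1) by (simp add: abs_mult)
      qed
      also have "1 * r \<le> \<dots>" using \<open>i \<noteq> j\<close> r(1) by (intro mult_right_mono) linarith+
      finally have "r \<le> dist (p i) (p j)" by simp
      then show "ball (p i) (r / 2) \<inter> ball (p j) (r / 2) = {}"
        by (intro disjoint_ballI) simp
    qed
    have "of_nat N * v = (\<Sum>i<N. emeasure lborel (ball (p i) (r / 2)))"
      using r(1) by (simp add: v_def emeasure_ball)
    also have "\<dots> = emeasure lborel (\<Union>i<N. ball (p i) (r / 2))"
      by (rule sum_emeasure) (use disj in auto)
    also have "\<dots> \<le> emeasure lborel S"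
      using sub \<open>open S\<close> by (intro emeasure_mono) auto
    finally show ?thesis .
  qed
  moreover obtain s where s: "emeasure lborel S = ennreal s" "0 \<le> s"
    using assms(3) by (cases "emeasure lborel S") auto
  moreover obtain N where "s < real N * enn2real v" if "v < \<infinity>"
  proof (cases "v < \<infinity>")
    case True
    then have "0 < enn2real v" using v by (simp add: enn2real_positive_iff)
    then obtain N where "s < real N * enn2real v" by (metis reals_Archimedean3)
    then show ?thesis using that by blast
  qed (use that in auto)
  ultimately show False
  proof (cases "v < \<infinity>")
    case True
    have "of_nat N * v = ennreal (real N * enn2real v)"
      using True by (simp add: ennreal_mult ennreal_of_nat_eq_real_of_nat)
    then have "ennreal (real N * enn2real v) \<le> ennreal s"
      using \<open>\<And>N. of_nat N * v \<le> emeasure lborel S\<close> s by metis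
    then show False using s(2) \<open>v < \<infinity> \<Longrightarrow> s < real N * enn2real v\<close>[OF True]
      by (simp add: ennreal_le_iff)
  next
    case False
    then show False using \<open>\<And>N. of_nat N * v \<le> emeasure lborel S\<close>[of 1] s by (auto simp: top_unique less_top[symmetric])
  qed
qed

section \<open>Concave densities and their gradients\<close>

locale concave_density = smooth_density +
  assumes conc: "concave_on {x. 0 < g x} g"
    and g1: "(\<integral>\<^sup>+x. ennreal (g x powr a) \<partial>lborel) = 1"
begin

lemma open_level: "open {x. c < g x}"
  using open_Collect_less[OF continuous_on_const g_cont] .

lemma segment:
  assumes "0 < g x" "0 < g z" "0 \<le> t" "t \<le> 1"
  shows "(1 - t) * g x + t * g z \<le> g (x + t *\<^sub>R (z - x))" "0 < g (x + t *\<^sub>R (z - x))"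
proof -
  have eq: "x + t *\<^sub>R (z - x) = (1 - t) *\<^sub>R x + t *\<^sub>R z" by (simp add: algebra_simps)
  show 1: "(1 - t) * g x + t * g z \<le> g (x + t *\<^sub>R (z - x))"
    unfolding eq using concave_onD[OF conc] assms by simp
  have "0 < (1 - t) * g x + t * g z"
    using assms by (cases "t = 0") (auto intro: add_nonneg_pos)
  with 1 show "0 < g (x + t *\<^sub>R (z - x))" by simp
qed

lemma ex_pos: "\<exists>x. 0 < g x"
proof (rule ccontr)
  assume "\<not> ?thesis"
  then have "g x = 0" for x using g0[of x] by (auto simp: less_le)
  then show False using g1 by simp
qed

text \<open>The set where \<open>g\<close> exceeds half of a positive value \<open>g x1\<close> is
  open, convex and, by integrability of \<open>g powr a\<close>, of finite measure, hence bounded.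
  Concavity puts the midpoint between \<open>x1\<close> and any point of the support into this
  set.\<close>

lemma bounded_support: "bounded {x. 0 < g x}"
proof -
  obtain x1 where x1: "0 < g x1" using ex_pos by blast
  define c where "c = g x1 / 2"
  have c: "0 < c" "c < g x1" using x1 by (auto simp: c_def)
  let ?S = "{x. c < g x}"
  have "convex ?S"
    unfolding convex_alt
  proof (intro ballI allI impI)
    fix x z t assume *: "x \<in> ?S" "z \<in> ?S" "0 \<le> t \<and> t \<le> (1::real)"
    then have "(1 - t) * g x + t * g z \<le> g (x + t *\<^sub>R (z - x))" using c by (intro segment) auto
    moreover have "c < (1 - t) * g x + t * g z"
    proof -
      have "0 < (1 - t) * (g x - c) + t * (g z - c)"
        using * by (cases "t = 0") (auto intro: add_nonneg_pos)
      then show ?thesis by (simp add: algebra_simps)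
    qed
    moreover have "x + t *\<^sub>R (z - x) = (1 - t) *\<^sub>R x + t *\<^sub>R z" by (simp add: algebra_simps)
    ultimately show "(1 - t) *\<^sub>R x + t *\<^sub>R z \<in> ?S" by simp
  qed
  moreover have "emeasure lborel ?S < \<infinity>"
  proof -
    have "ennreal (c powr a) * emeasure lborel ?S = (\<integral>\<^sup>+x. ennreal (c powr a) * indicator ?S x \<partial>lborel)"
      using open_level by (simp add: nn_integral_cmult_indicator)
    also have "\<dots> \<le> (\<integral>\<^sup>+x. ennreal (g x powr a) \<partial>lborel)"
      using c a by (intro nn_integral_mono) (auto simp: indicator_def intro!: ennreal_leI powr_mono2)
    finally have "ennreal (c powr a) * emeasure lborel ?S \<le> 1" by (simp add: g1)
    then show ?thesis using c
      by (cases "emeasure lborel ?S = \<infinity>") (auto simp: ennreal_mult_top top_unique less_top)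
  qed
  ultimately have "bounded ?S" using open_level by (intro open_convex_finite_measure_bounded)
  then obtain B where B: "\<And>x. c < g x \<Longrightarrow> norm x \<le> B" unfolding bounded_iff by blast
  have "norm x \<le> 2 * B + norm x1" if x: "0 < g x" for x
  proof -
    have "c < g (x + (1 / 2) *\<^sub>R (x1 - x))"
      using segment(1)[OF x x1, of "1 / 2"] x by (simp add: c_def)
    then have "norm (x + (1 / 2) *\<^sub>R (x1 - x)) \<le> B" by (rule B)
    moreover have "x = 2 *\<^sub>R (x + (1 / 2) *\<^sub>R (x1 - x)) - x1" by (simp add: algebra_simps scaleR_2)
    then have "norm x \<le> 2 * norm (x + (1 / 2) *\<^sub>R (x1 - x)) + norm x1"
      by (metis norm_triangle_ineq4 norm_scaleR abs_numeral)
    ultimately show ?thesis by simp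
  qed
  then show ?thesis unfolding bounded_iff by blast
qed

lemma g_bounded: "\<exists>M>0. \<forall>x. g x \<le> M"
proof -
  obtain B where B: "\<And>x. 0 < g x \<Longrightarrow> norm x \<le> B"
    using bounded_support unfolding bounded_iff by blast
  have "compact (g ` cball 0 B)"
    using g_cont by (intro compact_continuous_image) (auto intro: continuous_on_subset)
  then have "bounded (g ` cball 0 B)" by (rule compact_imp_bounded)
  then obtain M where "\<forall>y\<in>g ` cball 0 B. norm y \<le> M"
    unfolding bounded_iff by blast
  then have M: "\<And>x. x \<in> cball 0 B \<Longrightarrow> norm (g x) \<le> M" by auto
  have "g x \<le> max 1 M" for x
    using M[of x] B[of x] g0[of x] by (cases "g x = 0") (auto simp: less_le)
  then show ?thesis by (intro exI[of _ "max 1 M"]) auto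
qed

lemma gradient_inequality:
  assumes x: "0 < g x" and z: "0 < g z"
  shows "g z \<le> g x + (z - x) \<bullet> \<gamma> x"
proof -
  have "(g has_derivative (\<lambda>h. h \<bullet> \<gamma> x)) (at x)"
    using g_deriv[OF x] by (simp add: gderiv_def)
  moreover have "((\<lambda>s. x + s *\<^sub>R (z - x)) has_derivative (\<lambda>s. s *\<^sub>R (z - x))) (at 0)"
    by (auto intro!: derivative_eq_intros)
  ultimately have "((\<lambda>s. g (x + s *\<^sub>R (z - x))) has_derivative (\<lambda>s. (s *\<^sub>R (z - x)) \<bullet> \<gamma> x)) (at 0)"
    using has_derivative_compose[of "\<lambda>s. x + s *\<^sub>R (z - x)" "\<lambda>s. s *\<^sub>R (z - x)" 0 UNIV g "\<lambda>h. h \<bullet> \<gamma> x"] by simp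
  then have "((\<lambda>s. g (x + s *\<^sub>R (z - x))) has_real_derivative (z - x) \<bullet> \<gamma> x) (at 0)"
    by (simp add: has_field_derivative_def mult_commute_abs)
  then have "((\<lambda>s. (g (x + s *\<^sub>R (z - x)) - g x) / s) \<longlongrightarrow> (z - x) \<bullet> \<gamma> x) (at 0)"
    by (simp add: DERIV_def)
  then have "((\<lambda>s. (g (x + s *\<^sub>R (z - x)) - g x) / s) \<longlongrightarrow> (z - x) \<bullet> \<gamma> x) (at_right 0)"
    by (simp add: filterlim_at_split)
  moreover have "\<forall>\<^sub>F s in at_right 0. g z - g x \<le> (g (x + s *\<^sub>R (z - x)) - g x) / s"
    unfolding eventually_at_right_field
  proof (intro exI[of _ 1] conjI allI impI)
    fix s :: real assume s: "0 < s" "s < 1"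
    have "(1 - s) * g x + s * g z \<le> g (x + s *\<^sub>R (z - x))" using segment[OF x z] s by simp
    then have "(g z - g x) * s \<le> g (x + s *\<^sub>R (z - x)) - g x"
      using left_diff_distrib[of 1 s "g x"] left_diff_distrib[of "g z" "g x" s] by (simp only: mult_ac)
    then show "g z - g x \<le> (g (x + s *\<^sub>R (z - x)) - g x) / s"
      using s(1) by (subst pos_le_divide_eq)
  qed simp
  ultimately have "g z - g x \<le> (z - x) \<bullet> \<gamma> x"
    by (intro tendsto_lowerbound) auto
  then show ?thesis by simp
qed

lemma legendre_self:
  assumes x: "0 < g x" shows "legendre g (\<gamma> x) = ereal (x \<bullet> \<gamma> x - g x)"
proof (rule antisym)
  show "legendre g (\<gamma> x) \<le> ereal (x \<bullet> \<gamma> x - g x)"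
    using x by (intro legendre_le) (simp add: pos_set_def)
  show "ereal (x \<bullet> \<gamma> x - g x) \<le> legendre g (\<gamma> x)"
    unfolding legendre_def
    by (intro INF_greatest) (use gradient_inequality[OF x] in \<open>simp add: pos_set_def inner_diff_left algebra_simps\<close>)
qed

definition "\<gamma>0 x = (if 0 < g x then \<gamma> x else 0)"

lemma \<gamma>0_meas [measurable]: "\<gamma>0 \<in> borel_measurable borel"
  using \<gamma>_meas by (simp add: \<gamma>0_def[abs_def])

lemma int_g: "integrable lborel (\<lambda>x. g x powr a)" "integrable lborel (\<lambda>x. g x powr (a + 1))"
proof -
  show 1: "integrable lborel (\<lambda>x. g x powr a)"
    using g1 by (intro integrableI_bounded) auto
  obtain M where M: "0 < M" "\<And>x. g x \<le> M" using g_bounded by blast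
  show "integrable lborel (\<lambda>x. g x powr (a + 1))"
  proof (rule Bochner_Integration.integrable_bound)
    show "integrable lborel (\<lambda>x. M * g x powr a)" using 1 by simp
    show "AE x in lborel. norm (g x powr (a + 1)) \<le> norm (M * g x powr a)"
    proof (rule AE_I2)
      fix x
      have "g x powr (a + 1) = g x * g x powr a"
        using g0[of x] by (cases "g x = 0") (auto simp: powr_add)
      also have "\<dots> \<le> M * g x powr a" using M by (intro mult_right_mono) auto
      finally show "norm (g x powr (a + 1)) \<le> norm (M * g x powr a)" using M by simp
    qed
  qed measurable
qed

text \<open>The field with value \<open>pot e R x *\<^sub>R (x - c)\<close> has compact support, so
  its divergence integrates to 0. The centre is left free because it is placed both inside the
  support and at the origin.\<close>

lemma pot_by_parts:
  assumes e: "0 < e" and R: "0 < R"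
  shows "integrable lborel (\<lambda>x. (x - c) \<bullet> dpot e R x)" "integrable lborel (pot e R)"
    "(LINT x|lborel. (x - c) \<bullet> dpot e R x) = - real DIM('a) * (LINT x|lborel. pot e R x)"
proof -
  have cd: "compact_derivative b (\<lambda>x. ((x - c) \<bullet> b) * pot e R x) (\<lambda>x. pot e R x + ((x - c) \<bullet> b) * (dpot e R x \<bullet> b))"
    if b: "b \<in> Basis" for b
    unfolding compact_derivative_def
  proof (intro conjI allI)
    note c0 = compact_derivative_pot[OF e R, of b, unfolded compact_derivative_def]
    show "(\<lambda>x. ((x - c) \<bullet> b) * pot e R x) \<in> borel_measurable borel"
      "(\<lambda>x. pot e R x + ((x - c) \<bullet> b) * (dpot e R x \<bullet> b)) \<in> borel_measurable borel"
      by measurable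
    have far: "pot e R x = 0 \<and> dpot e R x = 0" if "R < norm x" for x
      using that by (auto simp: pot_def dpot_def wt_def bump_far[OF R])
    then show "\<exists>R'. \<forall>x. R' < norm x \<longrightarrow> ((x - c) \<bullet> b) * pot e R x = 0 \<and> pot e R x + ((x - c) \<bullet> b) * (dpot e R x \<bullet> b) = 0"
      by (intro exI[of _ R]) simp
    obtain C where C: "\<And>x. \<bar>dpot e R x \<bullet> b\<bar> \<le> C" using c0 by blast
    have "\<bar>pot e R x + ((x - c) \<bullet> b) * (dpot e R x \<bullet> b)\<bar> \<le> 1 / e + (R + norm c) * C" for x
    proof (cases "R < norm x")
      case True
      then show ?thesis using far[OF True] C[of x] e R by (simp add: add_nonneg_nonneg)
    next
      case False
      have "pot e R x \<le> 1 / e * 1"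
        unfolding pot_def using cut_le[OF e] cut_nonneg[OF e] bump_range[of R x] e by (intro mult_mono) auto
      moreover have "\<bar>(x - c) \<bullet> b\<bar> \<le> R + norm c"
        using Basis_le_norm[OF b, of "x - c"] norm_triangle_ineq4[of x c] False by linarith
      then have "\<bar>((x - c) \<bullet> b) * (dpot e R x \<bullet> b)\<bar> \<le> (R + norm c) * C"
        unfolding abs_mult using C[of x] by (intro mult_mono) auto
      ultimately show ?thesis using pot_nonneg[OF e, of R x] by linarith
    qed
    then show "\<exists>C. \<forall>x. \<bar>pot e R x + ((x - c) \<bullet> b) * (dpot e R x \<bullet> b)\<bar> \<le> C" by blast
    fix x
    have d1: "((\<lambda>s. pot e R (x + s *\<^sub>R b)) has_real_derivative dpot e R x \<bullet> b) (at 0)" using c0 by blast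
    have d2: "((\<lambda>s. (x + s *\<^sub>R b - c) \<bullet> b) has_real_derivative 1) (at 0)"
    proof -
      have "(\<lambda>s. (x + s *\<^sub>R b - c) \<bullet> b) = (\<lambda>s. (x - c) \<bullet> b + s)"
        using b by (auto simp: inner_add_left inner_diff_left)
      then show ?thesis by (auto intro!: derivative_eq_intros)
    qed
    show "((\<lambda>s. ((x + s *\<^sub>R b - c) \<bullet> b) * pot e R (x + s *\<^sub>R b)) has_real_derivative pot e R x + ((x - c) \<bullet> b) * (dpot e R x \<bullet> b)) (at 0)"
      by (rule DERIV_cong[OF DERIV_mult[OF d2 d1]]) simp
  qed
  show ip: "integrable lborel (pot e R)"
  proof (rule Bochner_Integration.integrable_bound[OF int_g(2)])
    show "AE x in lborel. norm (pot e R x) \<le> norm (g x powr (a + 1))"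
      using pot_nonneg[OF e] pot_le[OF e] by simp
  qed measurable
  have int: "integrable lborel (\<lambda>x. ((x - c) \<bullet> b) * (dpot e R x \<bullet> b))" if b: "b \<in> Basis" for b
    using Bochner_Integration.integrable_diff[OF compact_derivative_integral(1)[OF b cd[OF b]] ip] by simp
  have val: "(LINT x|lborel. ((x - c) \<bullet> b) * (dpot e R x \<bullet> b)) = - (LINT x|lborel. pot e R x)" if b: "b \<in> Basis" for b
    using compact_derivative_integral(2)[OF b cd[OF b]] ip int[OF b] by simp
  have eq: "(x - c) \<bullet> dpot e R x = (\<Sum>b\<in>Basis. ((x - c) \<bullet> b) * (dpot e R x \<bullet> b))" for x
    by (rule euclidean_inner)
  show "integrable lborel (\<lambda>x. (x - c) \<bullet> dpot e R x)"
    unfolding eq by (intro Bochner_Integration.integrable_sum int)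
  show "(LINT x|lborel. (x - c) \<bullet> dpot e R x) = - real DIM('a) * (LINT x|lborel. pot e R x)"
    unfolding eq by (subst Bochner_Integration.integral_sum) (simp_all add: int val)
qed

lemma dpot_eq:
  "y \<bullet> dpot e R x = (a + 1) * (wt e R x * (g x powr a * (y \<bullet> \<gamma>0 x))) + cut e (g x powr (a + 1)) * (y \<bullet> grad_bump R x)"
  by (simp add: dpot_def \<gamma>0_def inner_add_right)

text \<open>The gradient may blow up at the boundary of the support. Concavity towards a ball around
  \<open>x0\<close> inside the support bounds \<open>r * norm (\<gamma>0 x)\<close> by
  \<open>M - (x - x0) \<bullet> \<gamma>0 x\<close>, whose weighted integral is controlled by
  integration by parts.\<close>

lemma gradient_integrable: "integrable lborel (\<lambda>x. g x powr a * norm (\<gamma>0 x))"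
proof -
  obtain x0 where x0: "0 < g x0" using ex_pos by blast
  obtain r where r: "0 < r" "cball x0 r \<subseteq> {x. 0 < g x}"
    using open_level[of 0] x0 unfolding open_contains_cball by blast
  obtain M where M: "0 < M" "\<And>x. g x \<le> M" using g_bounded by blast
  obtain B where B: "\<And>x. 0 < g x \<Longrightarrow> norm x \<le> B" using bounded_support unfolding bounded_iff by blast
  define k1 where "k1 = \<bar>B\<bar> + norm x0"
  have k1: "0 \<le> k1" by (simp add: k1_def)
  have kx: "norm (x - x0) \<le> k1" if "0 < g x" for x
    using norm_triangle_ineq4[of x x0] B[OF that] by (simp add: k1_def)
  obtain e R :: "nat \<Rightarrow> real" where e: "\<And>m. 0 < e m" and R: "\<And>m. 0 < R m"
    and wt_lim: "\<And>x. 0 < g x \<Longrightarrow> (\<lambda>m. wt (e m) (R m) x) \<longlonglongrightarrow> 1"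
    and pot_lim: "\<And>x. (\<lambda>m. pot (e m) (R m) x) \<longlonglongrightarrow> g x powr (a + 1)"
    and err: "\<And>m x y. norm y \<le> k1 \<Longrightarrow>
       \<bar>cut (e m) (g x powr (a + 1)) * (y \<bullet> grad_bump (R m) x)\<bar> \<le> g x powr a * (1 / real (Suc m))"
    using cutoff_sequence[OF k1] by blast
  define Q where "Q x = g x powr a * (M - (x - x0) \<bullet> \<gamma>0 x)" for x
  have [measurable]: "Q \<in> borel_measurable borel" unfolding Q_def[abs_def] by measurable
  have Qr: "r * norm (\<gamma>0 x) \<le> M - (x - x0) \<bullet> \<gamma>0 x" for x
  proof (cases "0 < g x \<and> \<gamma> x \<noteq> 0")
    case True
    \<comment> \<open>Among the points of the ball, \<open>x0 + u\<close> lies farthest against the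
      gradient, which makes the gradient inequality strongest.\<close>
    define u where "u = - (r / norm (\<gamma> x)) *\<^sub>R \<gamma> x"
    have "norm u = r" using r True by (simp add: u_def)
    then have "x0 + u \<in> cball x0 r" by (simp add: dist_norm)
    then have "0 < g (x0 + u)" using r(2) by blast
    then have "0 \<le> g x + (x0 + u - x) \<bullet> \<gamma> x"
      using gradient_inequality[of x "x0 + u"] True by simp
    moreover have "u \<bullet> \<gamma> x = - r * norm (\<gamma> x)"
      using True by (simp add: u_def dot_square_norm power2_eq_square)
    ultimately show ?thesis using True M(2)[of x]
      by (simp add: \<gamma>0_def inner_diff_left inner_add_left)
  next
    case False
    then show ?thesis using M(1) by (auto simp: \<gamma>0_def)
  qed
  then have Q0: "0 \<le> M - (x - x0) \<bullet> \<gamma>0 x" for x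
    using r(1) by (meson mult_nonneg_nonneg norm_ge_zero order_trans less_imp_le)
  \<comment> \<open>The summands bound, in turn, the constant \<open>M\<close> weighted by the mass
    1, the result of the integration by parts, and the error
    \<open>1 / real (Suc m)\<close>.\<close>
  define K where "K = (a + 1) * M + real DIM('a) * (LINT x|lborel. g x powr (a + 1)) + 1"
  have step: "(\<integral>\<^sup>+x. ennreal ((a + 1) * (wt (e m) (R m) x * Q x)) \<partial>lborel) \<le> ennreal K" for m
  proof -
    let ?E = "\<lambda>x. cut (e m) (g x powr (a + 1)) * ((x - x0) \<bullet> grad_bump (R m) x)"
    let ?T = "\<lambda>x. (a + 1) * M * g x powr a - (x - x0) \<bullet> dpot (e m) (R m) x + g x powr a * (1 / real (Suc m))"
    have E: "\<bar>?E x\<bar> \<le> g x powr a * (1 / real (Suc m))" for x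
    proof (cases "0 < g x")
      case False
      then have "g x = 0" using g0[of x] by simp
      then show ?thesis using e[of m] by (simp add: cut_zero)
    qed (rule err[OF kx])
    have le: "(a + 1) * (wt (e m) (R m) x * Q x) \<le> ?T x" for x
    proof -
      have "(a + 1) * (wt (e m) (R m) x * Q x) =
          wt (e m) (R m) x * ((a + 1) * M * g x powr a) - (a + 1) * (wt (e m) (R m) x * (g x powr a * ((x - x0) \<bullet> \<gamma>0 x)))"
        by (simp add: Q_def algebra_simps)
      also have "\<dots> = wt (e m) (R m) x * ((a + 1) * M * g x powr a) - (x - x0) \<bullet> dpot (e m) (R m) x + ?E x"
        unfolding dpot_eq by simp
      also have "wt (e m) (R m) x * ((a + 1) * M * g x powr a) \<le> 1 * ((a + 1) * M * g x powr a)"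
        using wt_range[OF e] a M by (intro mult_right_mono) auto
      finally show ?thesis using E[of x] by linarith
    qed
    have intT: "integrable lborel ?T"
      using int_g pot_by_parts(1)[OF e R] by (intro Bochner_Integration.integrable_add Bochner_Integration.integrable_diff) auto
    have one: "(LINT x|lborel. g x powr a) = 1"
      using g1 by (simp add: integral_eq_nn_integral)
    have "(LINT x|lborel. ?T x) = (a + 1) * M + real DIM('a) * (LINT x|lborel. pot (e m) (R m) x) + 1 / real (Suc m)"
      using int_g pot_by_parts(1,3)[OF e[of m] R[of m], of x0] by (simp add: one)
    also have "\<dots> \<le> K"
      unfolding K_def
    proof (intro add_mono mult_left_mono order_refl)
      show "(LINT x|lborel. pot (e m) (R m) x) \<le> (LINT x|lborel. g x powr (a + 1))"
        using pot_le[OF e] pot_by_parts(2)[OF e R] int_g by (intro integral_mono) auto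
    qed (use a in auto)
    finally have TK: "(LINT x|lborel. ?T x) \<le> K" .
    have T0: "0 \<le> ?T x" for x
      using a wt_range(1)[OF e, of m "R m" x] Q0[of x] by (intro order_trans[OF _ le]) (simp add: Q_def)
    have "(\<integral>\<^sup>+x. ennreal ((a + 1) * (wt (e m) (R m) x * Q x)) \<partial>lborel) \<le> (\<integral>\<^sup>+x. ennreal (?T x) \<partial>lborel)"
      using le by (intro nn_integral_mono ennreal_leI)
    also have "\<dots> = ennreal (LINT x|lborel. ?T x)"
      using T0 by (intro nn_integral_eq_integral intT) auto
    also have "\<dots> \<le> ennreal K" by (rule ennreal_leI[OF TK])
    finally show ?thesis .
  qed
  have "(\<lambda>m. ennreal ((a + 1) * (wt (e m) (R m) x * Q x))) \<longlonglongrightarrow> ennreal ((a + 1) * (1 * Q x))" for x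
  proof (cases "0 < g x")
    case True
    show ?thesis by (intro tendsto_ennrealI tendsto_intros wt_lim True)
  next
    case False
    then have "g x = 0" using g0[of x] by simp
    then show ?thesis by (simp add: Q_def)
  qed
  then have "(\<integral>\<^sup>+x. ennreal ((a + 1) * (1 * Q x)) \<partial>lborel) = (\<integral>\<^sup>+x. liminf (\<lambda>m. ennreal ((a + 1) * (wt (e m) (R m) x * Q x))) \<partial>lborel)"
    by (intro nn_integral_cong lim_imp_Liminf[symmetric]) auto
  also have "\<dots> \<le> liminf (\<lambda>m. \<integral>\<^sup>+x. ennreal ((a + 1) * (wt (e m) (R m) x * Q x)) \<partial>lborel)"
    by (rule nn_integral_liminf) measurable
  also have "\<dots> \<le> liminf (\<lambda>m. ennreal K)"
    by (rule Liminf_mono) (use step in auto)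
  also have "\<dots> < \<infinity>" by (simp add: Liminf_const)
  finally have intQ: "integrable lborel (\<lambda>x. (a + 1) * (1 * Q x))"
    using a Q0 by (intro integrableI_bounded) (auto simp: Q_def)
  show ?thesis
  proof (rule Bochner_Integration.integrable_bound)
    show "integrable lborel (\<lambda>x. (1 / r / (a + 1)) * ((a + 1) * (1 * Q x)))"
      by (rule integrable_mult_right[OF intQ])
    show "AE x in lborel. norm (g x powr a * norm (\<gamma>0 x)) \<le> norm ((1 / r / (a + 1)) * ((a + 1) * (1 * Q x)))"
    proof (rule AE_I2)
      fix x
      have "g x powr a * norm (\<gamma>0 x) = 1 / r * (g x powr a * (r * norm (\<gamma>0 x)))" using r by simp
      also have "\<dots> \<le> 1 / r * Q x"
        unfolding Q_def using Qr r by (intro mult_left_mono) auto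
      also have "\<dots> = (1 / r / (a + 1)) * ((a + 1) * (1 * Q x))" using a by simp
      finally have "g x powr a * norm (\<gamma>0 x) \<le> (1 / r / (a + 1)) * ((a + 1) * (1 * Q x))" .
      moreover have "0 \<le> g x powr a * norm (\<gamma>0 x)" by simp
      ultimately show "norm (g x powr a * norm (\<gamma>0 x)) \<le> norm ((1 / r / (a + 1)) * ((a + 1) * (1 * Q x)))"
        unfolding real_norm_def by linarith
    qed
  qed measurable
qed

text \<open>Formally the integral of the divergence of the field x times
  \<open>g powr (a + 1)\<close>. Since the support is bounded, \<open>gradient_integrable\<close>
  supplies the dominating function for removing the cut-offs.\<close>

lemma virial:
  "integrable lborel (\<lambda>x. g x powr a * (x \<bullet> \<gamma>0 x))"
  "(a + 1) * (LINT x|lborel. g x powr a * (x \<bullet> \<gamma>0 x)) = - real DIM('a) * (LINT x|lborel. g x powr (a + 1))"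
proof -
  obtain B where B: "\<And>x. 0 < g x \<Longrightarrow> norm x \<le> B" using bounded_support unfolding bounded_iff by blast
  define k1 where "k1 = \<bar>B\<bar>"
  have k1: "0 \<le> k1" by (simp add: k1_def)
  have kx: "norm x \<le> k1" if "0 < g x" for x using B[OF that] by (simp add: k1_def)
  let ?H = "\<lambda>x. g x powr a * (x \<bullet> \<gamma>0 x)"
  have dom: "\<bar>?H x\<bar> \<le> k1 * (g x powr a * norm (\<gamma>0 x))" for x
  proof (cases "0 < g x")
    case True
    have "\<bar>x \<bullet> \<gamma>0 x\<bar> \<le> norm x * norm (\<gamma>0 x)" by (rule Cauchy_Schwarz_ineq2)
    also have "\<dots> \<le> k1 * norm (\<gamma>0 x)" using kx[OF True] by (intro mult_right_mono) auto
    finally have "g x powr a * \<bar>x \<bullet> \<gamma>0 x\<bar> \<le> g x powr a * (k1 * norm (\<gamma>0 x))" by (intro mult_left_mono) auto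
    then show ?thesis by (simp add: abs_mult mult_ac)
  qed (simp add: \<gamma>0_def)
  show intH: "integrable lborel ?H"
    by (rule Bochner_Integration.integrable_bound[OF integrable_mult_right[OF gradient_integrable, of k1]])
       (measurable, use dom in \<open>auto intro!: AE_I2 order_trans[OF dom abs_ge_self]\<close>)
  obtain e R :: "nat \<Rightarrow> real" where e: "\<And>m. 0 < e m" and R: "\<And>m. 0 < R m"
    and wt_lim: "\<And>x. 0 < g x \<Longrightarrow> (\<lambda>m. wt (e m) (R m) x) \<longlonglongrightarrow> 1"
    and pot_lim: "\<And>x. (\<lambda>m. pot (e m) (R m) x) \<longlonglongrightarrow> g x powr (a + 1)"
    and err: "\<And>m x y. norm y \<le> k1 \<Longrightarrow>
       \<bar>cut (e m) (g x powr (a + 1)) * (y \<bullet> grad_bump (R m) x)\<bar> \<le> g x powr a * (1 / real (Suc m))"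
    using cutoff_sequence[OF k1] by blast
  have E: "\<bar>cut (e m) (g x powr (a + 1)) * (x \<bullet> grad_bump (R m) x)\<bar> \<le> g x powr a * (1 / real (Suc m))" for m x
  proof (cases "0 < g x")
    case False
    then have "g x = 0" using g0[of x] by simp
    then show ?thesis using e[of m] by (simp add: cut_zero)
  qed (rule err[OF kx])
  have lim1: "(\<lambda>m. LINT x|lborel. x \<bullet> dpot (e m) (R m) x) \<longlonglongrightarrow> (LINT x|lborel. (a + 1) * ?H x)"
  proof (rule integral_dominated_convergence)
    show "integrable lborel (\<lambda>x. (a + 1) * (k1 * (g x powr a * norm (\<gamma>0 x))) + g x powr a)"
      using gradient_integrable int_g by (intro Bochner_Integration.integrable_add integrable_mult_right)
    show "AE x in lborel. norm (x \<bullet> dpot (e m) (R m) x) \<le> (a + 1) * (k1 * (g x powr a * norm (\<gamma>0 x))) + g x powr a" for m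
    proof (rule AE_I2)
      fix x
      have "\<bar>(a + 1) * (wt (e m) (R m) x * ?H x)\<bar> = (a + 1) * (wt (e m) (R m) x * \<bar>?H x\<bar>)"
        using a wt_range(1)[OF e, of m "R m" x] by (simp add: abs_mult)
      also have "\<dots> \<le> (a + 1) * (1 * (k1 * (g x powr a * norm (\<gamma>0 x))))"
        using a wt_range[OF e, of m "R m" x] dom[of x] by (intro mult_left_mono mult_mono) auto
      finally have 1: "\<bar>(a + 1) * (wt (e m) (R m) x * ?H x)\<bar> \<le> (a + 1) * (k1 * (g x powr a * norm (\<gamma>0 x)))" by simp
      have "g x powr a * (1 / real (Suc m)) \<le> g x powr a * 1" by (intro mult_left_mono) auto
      with E[of m x] have 2: "\<bar>cut (e m) (g x powr (a + 1)) * (x \<bullet> grad_bump (R m) x)\<bar> \<le> g x powr a" by linarith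
      show "norm (x \<bullet> dpot (e m) (R m) x) \<le> (a + 1) * (k1 * (g x powr a * norm (\<gamma>0 x))) + g x powr a"
        unfolding dpot_eq real_norm_def using 1 2 by linarith
    qed
    show "AE x in lborel. (\<lambda>m. x \<bullet> dpot (e m) (R m) x) \<longlonglongrightarrow> (a + 1) * ?H x"
    proof (rule AE_I2)
      fix x
      have inv: "(\<lambda>m. g x powr a * (1 / real (Suc m))) \<longlonglongrightarrow> g x powr a * 0"
        using LIMSEQ_inverse_real_of_nat by (intro tendsto_mult tendsto_const) (simp add: inverse_eq_divide)
      have z: "(\<lambda>m. cut (e m) (g x powr (a + 1)) * (x \<bullet> grad_bump (R m) x)) \<longlonglongrightarrow> 0"
        by (rule Lim_null_comparison[OF _ inv[simplified]]) (use E in \<open>simp add: real_norm_def\<close>)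
      have w: "(\<lambda>m. wt (e m) (R m) x * ?H x) \<longlonglongrightarrow> 1 * ?H x"
      proof (cases "0 < g x")
        case True
        show ?thesis by (intro tendsto_mult wt_lim[OF True] tendsto_const)
      qed (simp add: \<gamma>0_def)
      have "(\<lambda>m. (a + 1) * (wt (e m) (R m) x * ?H x) + cut (e m) (g x powr (a + 1)) * (x \<bullet> grad_bump (R m) x))
          \<longlonglongrightarrow> (a + 1) * (1 * ?H x) + 0"
        by (intro tendsto_add tendsto_mult[OF tendsto_const] w z)
      then show "(\<lambda>m. x \<bullet> dpot (e m) (R m) x) \<longlonglongrightarrow> (a + 1) * ?H x"
        unfolding dpot_eq by simp
    qed
  qed measurable
  have lim2: "(\<lambda>m. LINT x|lborel. pot (e m) (R m) x) \<longlonglongrightarrow> (LINT x|lborel. g x powr (a + 1))"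
  proof (rule integral_dominated_convergence[OF _ _ int_g(2)])
    show "AE x in lborel. norm (pot (e m) (R m) x) \<le> g x powr (a + 1)" for m
      using pot_nonneg[OF e] pot_le[OF e] by simp
    show "AE x in lborel. (\<lambda>m. pot (e m) (R m) x) \<longlonglongrightarrow> g x powr (a + 1)"
      by (rule AE_I2[OF pot_lim])
  qed measurable
  have "(LINT x|lborel. x \<bullet> dpot (e m) (R m) x) = - real DIM('a) * (LINT x|lborel. pot (e m) (R m) x)" for m
    using pot_by_parts(3)[OF e[of m] R[of m], of 0] by simp
  then have "(\<lambda>m. LINT x|lborel. x \<bullet> dpot (e m) (R m) x) \<longlonglongrightarrow> - real DIM('a) * (LINT x|lborel. g x powr (a + 1))"
    by (simp only:) (intro tendsto_mult tendsto_const lim2)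
  from LIMSEQ_unique[OF lim1 this]
  show "(a + 1) * (LINT x|lborel. ?H x) = - real DIM('a) * (LINT x|lborel. g x powr (a + 1))" by simp
qed

end

text \<open>On the support the integrand is explicit by \<open>legendre_self\<close>, so with H and
  G for the integrals of \<open>g powr a * (x \<bullet> \<gamma>0 x)\<close> and
  \<open>g powr (a + 1)\<close> everything is finite, and \<open>virial\<close> makes (a + 1)(H - G)
  + (a + n) G equal to -G.\<close>

lemma legendre_equality:
  fixes g :: "real ^ 'n \<Rightarrow> real" and a :: real
  assumes a: "a > 0" and g: "smooth_nonneg g" and g1: "leb_int (\<lambda>x. ereal (g x powr a)) = 1"
    and conc: "concave_on_support g"
  shows "ereal (a + 1) * leb_int (\<lambda>x. legendre g (grad g x) * ereal (g x powr a)) +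
      ereal (a + real CARD('n)) * leb_int (\<lambda>x. ereal (g x powr (1 + a)))
    = - leb_int (\<lambda>x. ereal (g x powr (1 + a)))"
proof -
  interpret smooth_density a g "grad g" by (rule smooth_density_smooth_nonneg[OF a g])
  interpret concave_density a g "grad g"
  proof
    show "concave_on {x. 0 < g x} g"
      using conc by (simp add: concave_on_support_iff pos_set_def)
    show "(\<integral>\<^sup>+x. ennreal (g x powr a) \<partial>lborel) = 1"
      using g1 by (simp add: leb_int_nonneg nn_integral_lebesgue one_ereal_def[symmetric])
        (metis enn2ereal_inject one_ennreal.rep_eq)
  qed
  let ?J = "\<lambda>x. g x powr a * (x \<bullet> \<gamma>0 x) - g x powr (a + 1)"
  have F: "legendre g (grad g x) * ereal (g x powr a) = ereal (?J x)" for x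
  proof (cases "0 < g x")
    case True
    then show ?thesis by (simp add: legendre_self \<gamma>0_def powr_add algebra_simps)
  next
    case False
    then have "g x = 0" using g0[of x] by simp
    then show ?thesis by (simp add: zero_ereal_def[symmetric])
  qed
  have intJ: "integrable lborel ?J" using virial(1) int_g by simp
  have val: "(LINT x|lebesgue. f x) = (LINT x|lborel. f x)" "integrable lebesgue f"
    if "integrable lborel f" for f :: "real ^ 'n \<Rightarrow> real"
    using that by (auto simp: integral_completion integrable_completion)
  define G where "G = (LINT x|lborel. g x powr (a + 1))"
  define H where "H = (LINT x|lborel. g x powr a * (x \<bullet> \<gamma>0 x))"
  have I: "leb_int (\<lambda>x. legendre g (grad g x) * ereal (g x powr a)) = ereal (H - G)"
    unfolding F using leb_int_eq_lebesgue_integral[OF val(2)[OF intJ]] val(1)[OF intJ] virial(1) int_g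
    by (simp add: G_def H_def)
  have G: "leb_int (\<lambda>x. ereal (g x powr (1 + a))) = ereal G"
    using leb_int_eq_lebesgue_integral[OF val(2)[OF int_g(2)]] val(1)[OF int_g(2)]
    by (simp add: G_def add.commute)
  have "(a + 1) * H = - real CARD('n) * G"
    using virial(2) by (simp add: G_def H_def)
  then have "(a + 1) * (H - G) + (a + real CARD('n)) * G = - G"
    by (simp add: algebra_simps)
  then show ?thesis unfolding I G by simp
qed

text \<open>The extended reals evaluate -\<infinity> + \<infinity> to \<infinity>, which would make
  the inequality false; hence the excluded combination. In the equality case both integrals on the
  left are finite.\<close>

theorem theorem5:
  fixes W g :: "real ^ 'n \<Rightarrow> real" and a :: real
  assumes "a > 0"
    and "\<And>x. 0 \<le> W x"
    and "W \<in> borel_measurable lebesgue"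
    and "smooth_nonneg g"
    and "leb_int (\<lambda>x. ereal (g x powr a)) = 1"
    and "leb_int (\<lambda>x. ereal (W x powr a)) = 1"
  defines "I \<equiv> leb_int (\<lambda>x. legendre W (grad g x) * ereal (g x powr a))"
    and "G \<equiv> leb_int (\<lambda>x. ereal (g x powr (1 + a)))"
  shows "(has_leb_int (\<lambda>x. legendre W (grad g x) * ereal (g x powr a)) \<and> \<not> (I = -\<infinity> \<and> G = \<infinity>) \<longrightarrow>
           ereal (a + 1) * I + ereal (a + real CARD('n)) * G
             \<le> - leb_int (\<lambda>x. ereal (W x powr (1 + a)))) \<and>
         (g = W \<and> concave_on_support W \<longrightarrow>
           ereal (a + 1) * I + ereal (a + real CARD('n)) * G
             = - leb_int (\<lambda>x. ereal (W x powr (1 + a))))"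
proof (intro conjI impI)
  assume "has_leb_int (\<lambda>x. legendre W (grad g x) * ereal (g x powr a)) \<and> \<not> (I = -\<infinity> \<and> G = \<infinity>)"
  then show "ereal (a + 1) * I + ereal (a + real CARD('n)) * G \<le> - leb_int (\<lambda>x. ereal (W x powr (1 + a)))"
    unfolding I_def G_def using assms(1-6) by (intro legendre_inequality) auto
next
  assume "g = W \<and> concave_on_support W"
  then show "ereal (a + 1) * I + ereal (a + real CARD('n)) * G = - leb_int (\<lambda>x. ereal (W x powr (1 + a)))"
    unfolding I_def G_def using legendre_equality[of a g] assms(1,4,5) by simp
qed

end
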